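(* Let $\psi$ be a wavelet (with respect to $\boldsymbol\alpha,\lambda$) and suppose $C_{\boldsymbol\alpha,\lambda}=(2\pi)^N\int_{\mathbb{R}^N_0}|(\mathfrak F_{\boldsymbol\alpha,\lambda}\psi)(\boldsymbol u)|^2\frac{d\boldsymbol u}{|\boldsymbol u|_m}\neq0$. Then $F\in L^2\!\left(\mathbb{R}^N_0\times\mathbb{R}^N,\frac{d\boldsymbol a\,d\boldsymbol b}{|\boldsymbol a|_m^2}\right)$ is the MFrWT $W_\psi^{\boldsymbol\alpha,\lambda}f$ of some $f\in L^2(\mathbb{R}^N)$ if and only if, for all $(\boldsymbol a_0,\boldsymbol b_0)\in\mathbb{R}^N_0\times\mathbb{R}^N$, $$F(\boldsymbol a_0,\boldsymbol b_0)=\int_{\mathbb{R}^N_0}\int_{\mathbb{R}^N}F(\boldsymbol a,\boldsymbol b)\,K_{\boldsymbol\alpha,\lambda,\boldsymbol\Psi}(\boldsymbol a_0,\boldsymbol b_0;\boldsymbol a,\boldsymbol b)\,\frac{d\boldsymbol a\,d\boldsymbol b}{|\boldsymbol a|_m^2},$$ where $K_{\boldsymbol\alpha,\lambda,\boldsymbol\Psi}$ is the reproducing kernel (of the range of $W_\psi^{\boldsymbol\alpha,\lambda}$) given by $$K_{\boldsymbol\alpha,\lambda,\boldsymbol\Psi}(\boldsymbol a_0,\boldsymbol b_0;\boldsymbol a,\boldsymbol b)=\frac{1}{C_{\boldsymbol\alpha,\lambda}}\int_{\mathbb{R}^N}\boldsymbol\Psi_{\boldsymbol\alpha,\lambda,\boldsymbol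 a,\boldsymbol b}(\boldsymbol t)\,\overline{\boldsymbol\Psi_{\boldsymbol\alpha,\lambda,\boldsymbol a_0,\boldsymbol b_0}(\boldsymbol t)}\,d\boldsymbol t.$$
   Context: $N\ge1$ is an integer, $\lambda\in\mathbb{R}\setminus\{0\}$, $\boldsymbol\alpha=(\alpha_1,\dots,\alpha_N)$ with $\alpha_k\in(-\pi,\pi)\setminus\{0\}$. For $\boldsymbol x\in\mathbb{R}^N$, $|\boldsymbol x|_m=|x_1x_2\cdots x_N|$ and $\mathbb{R}^N_0=\{\boldsymbol x\in\mathbb{R}^N:|\boldsymbol x|_m\ne0\}$. Products and quotients of vectors are componentwise. Put $a(\alpha_k)=\tfrac12\cot\alpha_k$, $c(\alpha_k)=\sqrt{1-i\cot\alpha_k}$, $c(\boldsymbol\alpha_\lambda)=c(\alpha_1)\cdots c(\alpha_N)$, $e_{\boldsymbol\alpha,\pm\lambda^2}(\boldsymbol x)=e^{\pm i\lambda^2\sum_{k=1}^N a(\alpha_k)x_k^2}$. The multidimensional fractional Fourier transform (MFrFT) is $(\mathfrak F_{\boldsymbol\alpha,\lambda}f)(\boldsymbol\xi)=\int_{\mathbb{R}^N}f(\boldsymbol x)K_{\boldsymbol\alpha,\lambda}(\boldsymbol x,\boldsymbol\xi)\,d\boldsymbol x$ (extended to $L^2(\mathbb{R}^N)$ as usual), with kernel $K_{\boldsymbol\alpha,\lambda}(\boldsymbol x,\boldsymbol\xi)=\frac{c(\boldsymbol\alpha_\lambda)}{(\sqrt{2\pi})^N}e_{\boldsymbol\alpha,\lambda^2}(\boldsymbol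 x)e_{\boldsymbol\alpha,\lambda^2}(\boldsymbol\xi)e^{-i\lambda^2\sum_{k=1}^N x_k\xi_k\csc\alpha_k}$. A wavelet is a non-zero $\psi\in L^2(\mathbb{R}^N)$ with $\int_{\mathbb{R}^N_0}|(\mathfrak F_{\boldsymbol\alpha,\lambda}\psi)(\boldsymbol u)|^2\frac{d\boldsymbol u}{|\boldsymbol u|_m}<\infty$. The multidimensional fractional wavelet transform (MFrWT) of $f\in L^2(\mathbb{R}^N)$ is, for $\boldsymbol a\in\mathbb{R}^N_0$, $\boldsymbol b\in\mathbb{R}^N$, $(W_\psi^{\boldsymbol\alpha,\lambda}f)(\boldsymbol a,\boldsymbol b)=\int_{\mathbb{R}^N}f(\boldsymbol t)\overline{\boldsymbol\Psi_{\boldsymbol\alpha,\lambda,\boldsymbol a,\boldsymbol b}(\boldsymbol t)}\,d\boldsymbol t$, where $\boldsymbol\Psi_{\boldsymbol\alpha,\lambda,\boldsymbol a,\boldsymbol b}(\boldsymbol t)=\overline{c(\boldsymbol\alpha_\lambda)}\,e_{\boldsymbol\alpha,\lambda^2}(\boldsymbol b)\,e_{\boldsymbol\alpha,-\lambda^2}(\boldsymbol t)\frac{1}{\sqrt{|\boldsymbol a|_m}}\tilde\psi\!\left(\frac{\boldsymbol t-\boldsymbol b}{\boldsymbol a}\right)$ and $\tilde\psi=\psi\,e_{\boldsymbol\alpha,\lambda^2}$. Reproducing kernel: for a Hilbert space $X$ of complex-valued functions on a set $S$, $\mathcal K:S\times S\to\mathbb{C}$ is a reproducing kernel of $X$ if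 for every $p\in S$, $\mathcal K(\cdot,p)\in X$ and $f(p)=\langle f,\mathcal K(\cdot,p)\rangle_X$ for all $f\in X$. Here $S=\mathbb{R}^N_0\times\mathbb{R}^N$ and $X$ is the range of $W_\psi^{\boldsymbol\alpha,\lambda}$ with the inner product of $L^2\!\left(S,\frac{d\boldsymbol a\,d\boldsymbol b}{|\boldsymbol a|_m^2}\right)$. *)

theory Defs
  imports "HOL-Analysis.Analysis"
begin

section \<open>Square-integrable functions\<close>

text \<open>Elements of \<open>L\<^sup>2(M)\<close> are represented by honest functions, not by a.e. classes.\<close>

definition L2 :: "'a measure \<Rightarrow> ('a \<Rightarrow> complex) set" where
  "L2 M = {f. f \<in> borel_measurable M \<and> integrable M (\<lambda>x. (cmod (f x))\<^sup>2)}"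

definition L2_inner :: "'a measure \<Rightarrow> ('a \<Rightarrow> complex) \<Rightarrow> ('a \<Rightarrow> complex) \<Rightarrow> complex" where
  "L2_inner M f g = (LINT x|M. f x * cnj (g x))"

definition L2_tendsto ::
    "'a measure \<Rightarrow> (nat \<Rightarrow> 'a \<Rightarrow> complex) \<Rightarrow> ('a \<Rightarrow> complex) \<Rightarrow> bool" where
  "L2_tendsto M s f \<longleftrightarrow>
     (\<lambda>n. \<integral>\<^sup>+x. ennreal ((cmod (s n x - f x))\<^sup>2) \<partial>M) \<longlonglongrightarrow> 0"

section \<open>The multidimensional fractional Fourier transform\<close>

definition mabs :: "real ^ 'n \<Rightarrow> real" where
  "mabs x = \<bar>\<Prod>k\<in>UNIV. x $ k\<bar>"

definition R0 :: "(real ^ 'n) set" where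
  "R0 = {x. mabs x \<noteq> 0}"

definition a_coeff :: "real \<Rightarrow> real" where
  "a_coeff \<theta> = cot \<theta> / 2"

definition c_coeff :: "real \<Rightarrow> complex" where
  "c_coeff \<theta> = csqrt (1 - \<i> * complex_of_real (cot \<theta>))"

definition c_prod :: "real ^ 'n \<Rightarrow> complex" where
  "c_prod \<alpha> = (\<Prod>k\<in>UNIV. c_coeff (\<alpha> $ k))"

text \<open>The function \<open>e\<close> with index \<open>\<alpha>, s\<close>; it is used with \<open>s = \<lambda>\<^sup>2\<close> and \<open>s = - \<lambda>\<^sup>2\<close>.\<close>

definition chirp :: "real ^ 'n \<Rightarrow> real \<Rightarrow> real ^ 'n \<Rightarrow> complex" where
  "chirp \<alpha> s x =
     exp (\<i> * complex_of_real (s * (\<Sum>k\<in>UNIV. a_coeff (\<alpha> $ k) * (x $ k)\<^sup>2)))"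

definition mfrft_kernel :: "real ^ 'n \<Rightarrow> real \<Rightarrow> real ^ 'n \<Rightarrow> real ^ 'n \<Rightarrow> complex" where
  "mfrft_kernel \<alpha> l x \<xi> =
     c_prod \<alpha> / complex_of_real (sqrt (2 * pi) ^ CARD('n))
     * chirp \<alpha> (l\<^sup>2) x * chirp \<alpha> (l\<^sup>2) \<xi>
     * exp (- \<i> * complex_of_real (l\<^sup>2 * (\<Sum>k\<in>UNIV. x $ k * \<xi> $ k * (1 / sin (\<alpha> $ k)))))"

definition mfrft_integral ::
    "real ^ 'n \<Rightarrow> real \<Rightarrow> (real ^ 'n \<Rightarrow> complex) \<Rightarrow> real ^ 'n \<Rightarrow> complex" where
  "mfrft_integral \<alpha> l f \<xi> = (LINT x|lebesgue. f x * mfrft_kernel \<alpha> l x \<xi>)"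

text \<open>
  Extension by continuity from \<open>L\<^sup>1 \<inter> L\<^sup>2\<close> to \<open>L\<^sup>2\<close>: \<open>g\<close> is the transform of \<open>f\<close> if it is the
  \<open>L\<^sup>2\<close>-limit of the integral transforms of every sequence in \<open>L\<^sup>1 \<inter> L\<^sup>2\<close> that tends to \<open>f\<close> in
  \<open>L\<^sup>2\<close>. This determines \<open>g\<close> up to a null set, and \<open>mfrft\<close> picks one representative.
\<close>

definition is_mfrft ::
    "real ^ 'n \<Rightarrow> real \<Rightarrow> (real ^ 'n \<Rightarrow> complex) \<Rightarrow> (real ^ 'n \<Rightarrow> complex) \<Rightarrow> bool" where
  "is_mfrft \<alpha> l f g \<longleftrightarrow> g \<in> L2 lebesgue \<and>
     (\<forall>s. (\<forall>n. integrable lebesgue (s n) \<and> s n \<in> L2 lebesgue) \<and> L2_tendsto lebesgue s f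
        \<longrightarrow> L2_tendsto lebesgue (\<lambda>n. mfrft_integral \<alpha> l (s n)) g)"

definition mfrft ::
    "real ^ 'n \<Rightarrow> real \<Rightarrow> (real ^ 'n \<Rightarrow> complex) \<Rightarrow> real ^ 'n \<Rightarrow> complex" where
  "mfrft \<alpha> l f = (SOME g. is_mfrft \<alpha> l f g)"

section \<open>Wavelets and the multidimensional fractional wavelet transform\<close>

definition wavelet :: "real ^ 'n \<Rightarrow> real \<Rightarrow> (real ^ 'n \<Rightarrow> complex) \<Rightarrow> bool" where
  "wavelet \<alpha> l \<psi> \<longleftrightarrow>
     \<psi> \<in> L2 lebesgue \<and> \<not> (AE t in lebesgue. \<psi> t = 0) \<and>
     (\<integral>\<^sup>+u\<in>R0. ennreal ((cmod (mfrft \<alpha> l \<psi> u))\<^sup>2 / mabs u) \<partial>lebesgue) < \<infinity>"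

definition C_adm :: "real ^ 'n \<Rightarrow> real \<Rightarrow> (real ^ 'n \<Rightarrow> complex) \<Rightarrow> real" where
  "C_adm \<alpha> l \<psi> =
     (2 * pi) ^ CARD('n) * (LINT u:R0|lebesgue. (cmod (mfrft \<alpha> l \<psi> u))\<^sup>2 / mabs u)"

definition psi_tilde ::
    "real ^ 'n \<Rightarrow> real \<Rightarrow> (real ^ 'n \<Rightarrow> complex) \<Rightarrow> real ^ 'n \<Rightarrow> complex" where
  "psi_tilde \<alpha> l \<psi> t = \<psi> t * chirp \<alpha> (l\<^sup>2) t"

definition Psi ::
    "real ^ 'n \<Rightarrow> real \<Rightarrow> (real ^ 'n \<Rightarrow> complex) \<Rightarrow> (real ^ 'n) \<times> (real ^ 'n) \<Rightarrow> real ^ 'n \<Rightarrow> complex"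
  where
  "Psi \<alpha> l \<psi> = (\<lambda>(a, b) t.
     cnj (c_prod \<alpha>) * chirp \<alpha> (l\<^sup>2) b * chirp \<alpha> (- (l\<^sup>2)) t
     * complex_of_real (1 / sqrt (mabs a))
     * psi_tilde \<alpha> l \<psi> (\<chi> k. (t $ k - b $ k) / a $ k))"

definition mfrwt ::
    "real ^ 'n \<Rightarrow> real \<Rightarrow> (real ^ 'n \<Rightarrow> complex) \<Rightarrow> (real ^ 'n \<Rightarrow> complex)
     \<Rightarrow> (real ^ 'n) \<times> (real ^ 'n) \<Rightarrow> complex" where
  "mfrwt \<alpha> l \<psi> f p = (LINT t|lebesgue. f t * cnj (Psi \<alpha> l \<psi> p t))"

definition S0 :: "((real ^ 'n) \<times> (real ^ 'n)) set" where
  "S0 = R0 \<times> UNIV"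

definition S0_measure :: "((real ^ 'n) \<times> (real ^ 'n)) measure" where
  "S0_measure = density (lebesgue_on S0) (\<lambda>(a, b). ennreal (1 / (mabs a)\<^sup>2))"

text \<open>
  Functions on \<open>S0\<close> are total functions of which only the values on \<open>S0\<close> count; so the range of
  the transform consists of all functions agreeing on \<open>S0\<close> with some transform.
\<close>

definition mfrwt_range ::
    "real ^ 'n \<Rightarrow> real \<Rightarrow> (real ^ 'n \<Rightarrow> complex) \<Rightarrow> ((real ^ 'n) \<times> (real ^ 'n) \<Rightarrow> complex) set"
  where
  "mfrwt_range \<alpha> l \<psi> = {F. \<exists>f\<in>L2 lebesgue. \<forall>p\<in>S0. F p = mfrwt \<alpha> l \<psi> f p}"

definition mfrwt_kernel ::
    "real ^ 'n \<Rightarrow> real \<Rightarrow> (real ^ 'n \<Rightarrow> complex)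
     \<Rightarrow> (real ^ 'n) \<times> (real ^ 'n) \<Rightarrow> (real ^ 'n) \<times> (real ^ 'n) \<Rightarrow> complex" where
  "mfrwt_kernel \<alpha> l \<psi> p0 p =
     1 / complex_of_real (C_adm \<alpha> l \<psi>)
     * (LINT t|lebesgue. Psi \<alpha> l \<psi> p t * cnj (Psi \<alpha> l \<psi> p0 t))"

section \<open>Reproducing kernels\<close>

text \<open>
  A Hilbert space \<open>X\<close> of complex-valued functions on \<open>S\<close>, with inner product \<open>ip\<close> (linear in the
  first argument). Functions are total; \<open>on_S\<close> expresses that values off \<open>S\<close> are irrelevant.
\<close>

locale hilbert_function_space =
  fixes S :: "'p set"
    and X :: "('p \<Rightarrow> complex) set"
    and ip :: "('p \<Rightarrow> complex) \<Rightarrow> ('p \<Rightarrow> complex) \<Rightarrow> complex"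
  assumes on_S: "\<And>f g. f \<in> X \<Longrightarrow> (\<And>p. p \<in> S \<Longrightarrow> g p = f p) \<Longrightarrow>
                   g \<in> X \<and> (\<forall>h\<in>X. ip g h = ip f h)"
    and zero_mem: "(\<lambda>p. 0) \<in> X"
    and add_mem: "\<And>f g. f \<in> X \<Longrightarrow> g \<in> X \<Longrightarrow> (\<lambda>p. f p + g p) \<in> X"
    and scale_mem: "\<And>c f. f \<in> X \<Longrightarrow> (\<lambda>p. c * f p) \<in> X"
    and ip_add: "\<And>f g h. f \<in> X \<Longrightarrow> g \<in> X \<Longrightarrow> h \<in> X \<Longrightarrow>
                   ip (\<lambda>p. f p + g p) h = ip f h + ip g h"
    and ip_scale: "\<And>c f h. f \<in> X \<Longrightarrow> h \<in> X \<Longrightarrow> ip (\<lambda>p. c * f p) h = c * ip f h"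
    and ip_cnj: "\<And>f g. f \<in> X \<Longrightarrow> g \<in> X \<Longrightarrow> ip g f = cnj (ip f g)"
    and ip_nonneg: "\<And>f. f \<in> X \<Longrightarrow> 0 \<le> Re (ip f f)"
    and ip_definite: "\<And>f p. f \<in> X \<Longrightarrow> ip f f = 0 \<Longrightarrow> p \<in> S \<Longrightarrow> f p = 0"
    and complete: "\<And>s :: nat \<Rightarrow> 'p \<Rightarrow> complex.
          (\<And>n. s n \<in> X) \<Longrightarrow>
          (\<And>\<epsilon>. \<epsilon> > 0 \<Longrightarrow> \<exists>M. \<forall>m\<ge>M. \<forall>n\<ge>M.
              sqrt (Re (ip (\<lambda>p. s m p - s n p) (\<lambda>p. s m p - s n p))) < \<epsilon>) \<Longrightarrow>
          \<exists>f\<in>X. (\<lambda>n. sqrt (Re (ip (\<lambda>p. s n p - f p) (\<lambda>p. s n p - f p)))) \<longlonglongrightarrow> 0"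

locale reproducing_kernel = hilbert_function_space S X ip
  for S :: "'p set" and X and ip +
  fixes K :: "'p \<Rightarrow> 'p \<Rightarrow> complex"
  assumes kernel_mem: "\<And>p. p \<in> S \<Longrightarrow> (\<lambda>q. K q p) \<in> X"
    and reproducing: "\<And>f p. f \<in> X \<Longrightarrow> p \<in> S \<Longrightarrow> f p = ip f (\<lambda>q. K q p)"

end

theory Submission
  imports Defs "HOL-Probability.Characteristic_Functions"
begin

text \<open>
  Write \<open>e = chirp \<alpha> (l\<^sup>2)\<close>. Chirps have modulus one, so multiplication by \<open>e\<close> is unitary, and it
  turns the fractional transforms into classical ones. The fractional Fourier transform of \<open>\<psi>\<close> is,
  up to a constant and a chirp, the Fourier transform \<open>g\<close> of \<open>e \<psi>\<close> evaluated at \<open>\<kappa> \<xi>\<close>, where the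
  product of vectors is coordinatewise and \<open>\<kappa>\<^sub>k = l\<^sup>2 / sin \<alpha>\<^sub>k\<close>; the fractional wavelet transform of
  \<open>f\<close> is, up to a factor depending on \<open>(a, b)\<close> only, the classical wavelet transform of \<open>e f\<close> with
  the wavelet \<open>e \<psi>\<close>. With \<open>|\<xi>|\<close> for the product of the absolute
  values of the coordinates, \<open>d\<xi> / |\<xi>|\<close> is invariant under coordinatewise scaling, so \<open>\<kappa>\<close> disappears from
  the admissibility integral.

  The analytic heart is the orthogonality relation \<open>\<langle>W f, W h\<rangle> = C \<langle>f, h\<rangle>\<close> (\<open>mfrwt_inner\<close>), which follows
  by polarization from \<open>\<parallel>W f\<parallel>\<^sup>2 = C \<parallel>f\<parallel>\<^sup>2\<close> (\<open>cwt_isometry\<close>). For fixed \<open>a\<close> the wavelet transform as a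
  function of \<open>b\<close> is, by Parseval, a Fourier integral of \<open>F(\<xi>) cnj (g (a \<xi>))\<close>, where \<open>F\<close> is the Fourier transform
  of \<open>e f\<close>; Plancherel in \<open>b\<close>, Tonelli, and the invariance of \<open>da / |a|\<close> under \<open>a \<mapsto> a \<xi>\<close> give the isometry. The Plancherel
  identity itself is obtained by inserting a Gaussian into the integral of \<open>|ft f|\<^sup>2\<close> and letting it
  flatten out: this gives an inequality for every \<open>f\<close>, equality for bounded continuous \<open>f\<close>, and hence
  equality in general by density.

  Given the orthogonality relation, the rest is Hilbert space geometry. The value \<open>W f p\<close> is the inner
  product \<open>\<langle>f, \<Psi>\<^sub>p\<rangle> = \<langle>W f, W \<Psi>\<^sub>p\<rangle> / C\<close>, so the function \<open>W \<Psi>\<^sub>p / C\<close>, which is the kernel at \<open>p\<close>,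
  reproduces the range (\<open>mfrwt_reproducing\<close>). The range is complete because \<open>W\<close> is a multiple of an
  isometry on a complete space. Conversely, let \<open>F\<close> satisfy the reproducing equation and let \<open>P\<close> be
  its orthogonal projection to the range. The kernels lie in the range, so \<open>F - P\<close> is orthogonal to
  all of them, and \<open>F p = \<langle>F, K\<^sub>p\<rangle> = \<langle>P, K\<^sub>p\<rangle> = P p\<close> at every point \<open>p\<close>.
\<close>

section \<open>The geometry of square-integrable functions\<close>

definition L2_norm :: "'a measure \<Rightarrow> ('a \<Rightarrow> complex) \<Rightarrow> real" where
  "L2_norm M f = sqrt (LINT x|M. (cmod (f x))\<^sup>2)"

lemma L2_measurable [measurable_dest]: "f \<in> L2 M \<Longrightarrow> f \<in> borel_measurable M"
  by (simp add: L2_def)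

lemma L2_integrable: "f \<in> L2 M \<Longrightarrow> integrable M (\<lambda>x. (cmod (f x))\<^sup>2)"
  by (simp add: L2_def)

lemma cmod_add_square_le: "(cmod (a + b))\<^sup>2 \<le> 2 * (cmod a)\<^sup>2 + 2 * (cmod b)\<^sup>2"
proof -
  have "(cmod (a + b))\<^sup>2 \<le> (cmod a + cmod b)\<^sup>2"
    by (intro power_mono norm_triangle_ineq norm_ge_zero)
  also have "\<dots> \<le> 2 * (cmod a)\<^sup>2 + 2 * (cmod b)\<^sup>2"
    using sum_squares_bound[of "cmod a" "cmod b"] by (simp add: power2_sum)
  finally show ?thesis .
qed

lemma L2_bounded_by:
  assumes "f \<in> borel_measurable M" "integrable M g" "AE x in M. (cmod (f x))\<^sup>2 \<le> g x"
  shows "f \<in> L2 M"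
  unfolding L2_def
  using assms by (auto intro!: Bochner_Integration.integrable_bound[OF assms(2)])

lemma L2_add: "f \<in> L2 M \<Longrightarrow> g \<in> L2 M \<Longrightarrow> (\<lambda>x. f x + g x) \<in> L2 M"
  by (rule L2_bounded_by[where g="\<lambda>x. 2 * (cmod (f x))\<^sup>2 + 2 * (cmod (g x))\<^sup>2"])
     (auto intro!: L2_measurable L2_integrable Bochner_Integration.integrable_add
        integrable_mult_right borel_measurable_add intro: cmod_add_square_le)

lemma L2_scale: "f \<in> L2 M \<Longrightarrow> (\<lambda>x. c * f x) \<in> L2 M"
  by (auto simp: L2_def norm_mult power_mult_distrib)

lemma L2_zero: "(\<lambda>x. 0) \<in> L2 M"
  by (auto simp: L2_def)

lemma L2_diff:
  assumes "f \<in> L2 M" "g \<in> L2 M"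
  shows "(\<lambda>x. f x - g x) \<in> L2 M"
  using L2_add[OF assms(1) L2_scale[OF assms(2), of "-1"]] by simp

lemma borel_measurable_cnj [measurable (raw)]:
  "f \<in> borel_measurable M \<Longrightarrow> (\<lambda>x. cnj (f x)) \<in> borel_measurable M"
  by (rule borel_measurable_continuous_on) (intro continuous_intros)

lemma L2_times_integrable:
  assumes "f \<in> L2 M" "g \<in> L2 M"
  shows "integrable M (\<lambda>x. f x * cnj (g x))"
proof (rule Bochner_Integration.integrable_bound)
  show "integrable M (\<lambda>x. (cmod (f x))\<^sup>2 + (cmod (g x))\<^sup>2)"
    using assms by (auto dest: L2_integrable)
  show "(\<lambda>x. f x * cnj (g x)) \<in> borel_measurable M"
    using assms by (intro borel_measurable_times borel_measurable_cnj L2_measurable)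
  have "cmod (f x) * cmod (g x) \<le> (cmod (f x))\<^sup>2 + (cmod (g x))\<^sup>2" for x
    using sum_squares_bound[of "cmod (f x)" "cmod (g x)"] 
      mult_nonneg_nonneg[of "cmod (f x)" "cmod (g x)"] by (simp del: mult_nonneg_nonneg)
  then show "AE x in M. norm (f x * cnj (g x)) \<le> norm ((cmod (f x))\<^sup>2 + (cmod (g x))\<^sup>2)"
    by (auto simp: norm_mult)
qed

lemma L2_inner_add_left:
  assumes "f \<in> L2 M" "g \<in> L2 M" "h \<in> L2 M"
  shows "L2_inner M (\<lambda>x. f x + g x) h = L2_inner M f h + L2_inner M g h"
  using assms by (simp add: L2_inner_def distrib_right L2_times_integrable)

lemma L2_inner_scale_left: "L2_inner M (\<lambda>x. c * f x) h = c * L2_inner M f h"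
  by (simp add: L2_inner_def mult.assoc)

lemma L2_inner_cnj: "L2_inner M g f = cnj (L2_inner M f g)"
  unfolding L2_inner_def
  by (subst Bochner_Integration.integral_cnj[symmetric]) (simp add: mult.commute)

lemma L2_inner_diff_left:
  assumes "f \<in> L2 M" "g \<in> L2 M" "h \<in> L2 M"
  shows "L2_inner M (\<lambda>x. f x - g x) h = L2_inner M f h - L2_inner M g h"
  using assms by (simp add: L2_inner_def left_diff_distrib L2_times_integrable)

lemma L2_inner_self: "L2_inner M f f = complex_of_real ((L2_norm M f)\<^sup>2)"
  by (simp add: L2_inner_def L2_norm_def complex_norm_square[symmetric] Bochner_Integration.integral_nonneg
      del: of_real_power)

lemma L2_norm_nonneg [simp]: "0 \<le> L2_norm M f"
  by (simp add: L2_norm_def)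

lemma sqrt_Re_L2_inner_self: "sqrt (Re (L2_inner M f f)) = L2_norm M f"
  by (simp add: L2_inner_self del: of_real_power)

lemma L2_norm_square: "(L2_norm M f)\<^sup>2 = (LINT x|M. (cmod (f x))\<^sup>2)"
  by (simp add: L2_norm_def)

lemma L2_norm_scale: "L2_norm M (\<lambda>x. c * f x) = cmod c * L2_norm M f"
  by (simp add: L2_norm_def norm_mult power_mult_distrib real_sqrt_mult)

lemma L2_norm_minus_commute: "L2_norm M (\<lambda>x. f x - g x) = L2_norm M (\<lambda>x. g x - f x)"
  by (simp add: L2_norm_def norm_minus_commute)

lemma ennreal_L2_norm_square:
  "f \<in> L2 M \<Longrightarrow> (\<integral>\<^sup>+x. ennreal ((cmod (f x))\<^sup>2) \<partial>M) = ennreal ((L2_norm M f)\<^sup>2)"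
  unfolding L2_norm_square by (intro nn_integral_eq_integral L2_integrable) auto

lemma L2_norm_eq_0_iff:
  assumes "f \<in> L2 M"
  shows "L2_norm M f = 0 \<longleftrightarrow> (AE x in M. f x = 0)"
  using assms by (simp add: L2_norm_def integral_nonneg_eq_0_iff_AE L2_integrable)

lemma L2_mono_norm:
  assumes "f \<in> L2 M" "g \<in> borel_measurable M" "AE x in M. cmod (g x) \<le> cmod (f x)"
  shows "g \<in> L2 M" and "L2_norm M g \<le> L2_norm M f"
proof -
  have *: "AE x in M. (cmod (g x))\<^sup>2 \<le> (cmod (f x))\<^sup>2"
    using assms(3) by (auto intro: power_mono)
  then show g: "g \<in> L2 M"
    using assms by (intro L2_bounded_by[where g="\<lambda>x. (cmod (f x))\<^sup>2"]) (auto dest: L2_integrable)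
  show "L2_norm M g \<le> L2_norm M f"
    unfolding L2_norm_def using assms g *
    by (intro real_sqrt_le_mono integral_mono_AE L2_integrable)
qed

text \<open>The elementary bound \<open>2 |f g| \<le> t |f|\<^sup>2 + |g|\<^sup>2 / t\<close> is integrated and optimised in \<open>t\<close>.\<close>

lemma L2_Cauchy_Schwarz:
  assumes f: "f \<in> L2 M" and g: "g \<in> L2 M"
  shows "(LINT x|M. cmod (f x * cnj (g x))) \<le> L2_norm M f * L2_norm M g"
proof -
  define I where "I = (LINT x|M. cmod (f x * cnj (g x)))"
  have fg: "integrable M (\<lambda>x. cmod (f x * cnj (g x)))"
    by (intro integrable_norm L2_times_integrable f g)
  have bound: "2 * I \<le> t * (L2_norm M f)\<^sup>2 + (L2_norm M g)\<^sup>2 / t" if "t > 0" for t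
  proof -
    have "2 * cmod (f x * cnj (g x)) \<le> t * (cmod (f x))\<^sup>2 + (cmod (g x))\<^sup>2 / t" for x
      using sum_squares_bound[of "sqrt t * cmod (f x)" "cmod (g x) / sqrt t"] that
      by (simp add: norm_mult power_mult_distrib power_divide)
    then have "(LINT x|M. 2 * cmod (f x * cnj (g x))) \<le>
        (LINT x|M. t * (cmod (f x))\<^sup>2 + (cmod (g x))\<^sup>2 / t)"
      using fg by (intro integral_mono Bochner_Integration.integrable_add integrable_mult_right
          integrable_divide L2_integrable f g)
    also have "\<dots> = t * (L2_norm M f)\<^sup>2 + (L2_norm M g)\<^sup>2 / t"
      using f g by (simp add: L2_norm_square L2_integrable)
    finally show ?thesis by (simp add: I_def)
  qed
  show ?thesis
  proof (cases "L2_norm M f = 0 \<or> L2_norm M g = 0")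
    case True
    then have "AE x in M. f x = 0 \<or> g x = 0"
      using L2_norm_eq_0_iff[OF f] L2_norm_eq_0_iff[OF g] by auto
    then have "(LINT x|M. cmod (f x * cnj (g x))) = (LINT x|M. 0)"
      using f g by (intro integral_cong_AE) (auto dest!: L2_measurable)
    with True show ?thesis by auto
  next
    case False
    then have pos: "L2_norm M f > 0" "L2_norm M g > 0"
      using L2_norm_nonneg[of M f] L2_norm_nonneg[of M g] by linarith+
    then show ?thesis
      using bound[of "L2_norm M g / L2_norm M f"]
      by (simp add: I_def power2_eq_square field_simps)
  qed
qed

lemma cmod_L2_inner_le:
  assumes "f \<in> L2 M" "g \<in> L2 M"
  shows "cmod (L2_inner M f g) \<le> L2_norm M f * L2_norm M g"
  unfolding L2_inner_def
  using integral_norm_bound[of M "\<lambda>x. f x * cnj (g x)"] L2_Cauchy_Schwarz[OF assms] by linarith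

lemma L2_norm_add_square:
  assumes "f \<in> L2 M" "g \<in> L2 M"
  shows "(L2_norm M (\<lambda>x. f x + g x))\<^sup>2 =
    (L2_norm M f)\<^sup>2 + (L2_norm M g)\<^sup>2 + 2 * Re (L2_inner M f g)"
proof -
  let ?h = "\<lambda>x. f x + g x"
  have h: "?h \<in> L2 M" using assms by (rule L2_add)
  have "L2_inner M ?h ?h = L2_inner M f ?h + L2_inner M g ?h"
    using assms h by (simp add: L2_inner_add_left)
  also have "\<dots> = cnj (L2_inner M ?h f) + cnj (L2_inner M ?h g)"
    by (simp add: L2_inner_cnj[of M _ ?h])
  also have "\<dots> = cnj (L2_inner M f f + L2_inner M g f) + cnj (L2_inner M f g + L2_inner M g g)"
    using assms by (simp add: L2_inner_add_left)
  also have "L2_inner M g f = cnj (L2_inner M f g)"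
    by (rule L2_inner_cnj)
  finally have "Re (L2_inner M ?h ?h) =
      Re (L2_inner M f f) + Re (L2_inner M g g) + 2 * Re (L2_inner M f g)"
    by simp
  then show ?thesis by (simp only: L2_inner_self Re_complex_of_real)
qed

lemma L2_norm_triangle:
  assumes "f \<in> L2 M" "g \<in> L2 M"
  shows "L2_norm M (\<lambda>x. f x + g x) \<le> L2_norm M f + L2_norm M g"
proof (rule power2_le_imp_le)
  have "Re (L2_inner M f g) \<le> L2_norm M f * L2_norm M g"
    using complex_Re_le_cmod cmod_L2_inner_le[OF assms] by (rule order_trans)
  then show "(L2_norm M (\<lambda>x. f x + g x))\<^sup>2 \<le> (L2_norm M f + L2_norm M g)\<^sup>2"
    using L2_norm_add_square[OF assms] by (simp add: power2_sum)
qed simp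

lemma L2_norm_diff_triangle:
  assumes "f \<in> L2 M" "g \<in> L2 M" "h \<in> L2 M"
  shows "L2_norm M (\<lambda>x. f x - h x) \<le> L2_norm M (\<lambda>x. f x - g x) + L2_norm M (\<lambda>x. g x - h x)"
  using L2_norm_triangle[OF L2_diff[OF assms(1,2)] L2_diff[OF assms(2,3)]] by simp

lemma L2_norm_diff_abs_le:
  assumes "f \<in> L2 M" "g \<in> L2 M"
  shows "\<bar>L2_norm M f - L2_norm M g\<bar> \<le> L2_norm M (\<lambda>x. f x - g x)"
  using L2_norm_triangle[OF L2_diff[OF assms] assms(2)]
    L2_norm_triangle[OF L2_diff[OF assms(2,1)] assms(1)] L2_norm_minus_commute[of M f g]
  by simp

lemma L2_norm_tendsto:
  assumes "\<And>n. s n \<in> L2 M" "f \<in> L2 M" "(\<lambda>n. L2_norm M (\<lambda>x. s n x - f x)) \<longlonglongrightarrow> 0"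
  shows "(\<lambda>n. L2_norm M (s n)) \<longlonglongrightarrow> L2_norm M f"
proof (rule LIM_zero_cancel, rule tendsto_0_le[OF assms(3), where K=1])
  show "\<forall>\<^sub>F n in sequentially. norm (L2_norm M (s n) - L2_norm M f) \<le>
      norm (L2_norm M (\<lambda>x. s n x - f x)) * 1"
    using L2_norm_diff_abs_le[OF assms(1,2)] by simp
qed

lemma L2_tendsto_iff_norm:
  assumes "\<And>n. s n \<in> L2 M" "f \<in> L2 M"
  shows "L2_tendsto M s f \<longleftrightarrow> (\<lambda>n. L2_norm M (\<lambda>x. s n x - f x)) \<longlonglongrightarrow> 0"
proof -
  have "L2_tendsto M s f \<longleftrightarrow> (\<lambda>n. ennreal ((L2_norm M (\<lambda>x. s n x - f x))\<^sup>2)) \<longlonglongrightarrow> ennreal 0"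
    unfolding L2_tendsto_def by (simp add: ennreal_L2_norm_square L2_diff assms)
  also have "\<dots> \<longleftrightarrow> (\<lambda>n. (L2_norm M (\<lambda>x. s n x - f x))\<^sup>2) \<longlonglongrightarrow> 0"
    by (rule tendsto_ennreal_iff) auto
  also have "\<dots> \<longleftrightarrow> (\<lambda>n. L2_norm M (\<lambda>x. s n x - f x)) \<longlonglongrightarrow> 0"
    by simp
  finally show ?thesis .
qed

text \<open>
  Polarization with the two real quadratic forms \<open>\<parallel>f + g\<parallel>\<^sup>2\<close> and \<open>\<parallel>f + \<i> g\<parallel>\<^sup>2\<close>: a linear map that scales all
  norms by one factor scales all inner products by the square of that factor.
\<close>

lemma L2_inner_polarization:
  assumes "f \<in> L2 M" "g \<in> L2 M"
  shows "L2_inner M f g = complex_of_real (((L2_norm M (\<lambda>x. f x + g x))\<^sup>2 - (L2_norm M f)\<^sup>2 - (L2_norm M g)\<^sup>2) / 2)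
   + \<i> * complex_of_real (((L2_norm M (\<lambda>x. f x + \<i> * g x))\<^sup>2 - (L2_norm M f)\<^sup>2 - (L2_norm M g)\<^sup>2) / 2)"
proof -
  have "L2_inner M f (\<lambda>x. \<i> * g x) = cnj (\<i> * L2_inner M g f)"
    by (metis L2_inner_cnj L2_inner_scale_left)
  also have "\<dots> = - \<i> * L2_inner M f g"
    by (simp add: L2_inner_cnj[of M f g])
  finally have "Re (L2_inner M f (\<lambda>x. \<i> * g x)) = Im (L2_inner M f g)"
    by simp
  moreover have "L2_norm M (\<lambda>x. \<i> * g x) = L2_norm M g"
    by (simp add: L2_norm_scale)
  ultimately show ?thesis
    using L2_norm_add_square[OF assms] L2_norm_add_square[OF assms(1) L2_scale[OF assms(2), of \<i>]]
    by (simp add: complex_eq_iff)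
qed

lemma L2_cong_space:
  assumes "\<And>x. x \<in> space M \<Longrightarrow> f x = g x"
  shows "f \<in> L2 M \<longleftrightarrow> g \<in> L2 M"
  unfolding L2_def using assms
  by (auto simp: cong: measurable_cong Bochner_Integration.integrable_cong)

lemma L2_norm_cong_space:
  assumes "\<And>x. x \<in> space M \<Longrightarrow> f x = g x"
  shows "L2_norm M f = L2_norm M g"
  unfolding L2_norm_def using assms by (simp cong: Bochner_Integration.integral_cong)

lemma L2_inner_cong_space:
  assumes "\<And>x. x \<in> space M \<Longrightarrow> f x = f' x" "\<And>x. x \<in> space M \<Longrightarrow> g x = g' x"
  shows "L2_inner M f g = L2_inner M f' g'"
  unfolding L2_inner_def using assms by (simp cong: Bochner_Integration.integral_cong)

section \<open>Completeness and orthogonal projection\<close>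

text \<open>
  Riesz--Fischer. A subsequence with increments of norm at most \<open>2\<^sup>-\<^sup>k\<close> converges almost everywhere, and
  Fatou's lemma bounds the distance of the sequence to the pointwise limit.
\<close>

lemma L2_complete:
  assumes s: "\<And>n :: nat. s n \<in> L2 M"
    and cauchy: "\<And>e. e > 0 \<Longrightarrow> \<exists>K. \<forall>m\<ge>K. \<forall>n\<ge>K. L2_norm M (\<lambda>x. s m x - s n x) < e"
  shows "\<exists>f\<in>L2 M. (\<lambda>n. L2_norm M (\<lambda>x. s n x - f x)) \<longlonglongrightarrow> 0"
proof -
  have [measurable]: "s n \<in> borel_measurable M" for n
    using s by (rule L2_measurable)
  obtain K where K: "\<And>j m n. K j \<le> m \<Longrightarrow> K j \<le> n \<Longrightarrow> L2_norm M (\<lambda>x. s m x - s n x) < (1/2) ^ j"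
    using cauchy[of "(1/2) ^ j" for j] by (metis zero_less_power half_gt_zero zero_less_one)
  \<comment> \<open>Summing the thresholds makes \<open>r k\<close> at least as large as each of \<open>K 0, \<dots>, K k\<close>.\<close>
  define r where "r k = k + (\<Sum>j\<le>k. K j)" for k
  have rK: "K j \<le> r k" if "j \<le> k" for j k
  proof -
    have "K j \<le> (\<Sum>j\<le>k. K j)"
      using that by (intro member_le_sum) auto
    then show ?thesis by (simp add: r_def)
  qed
  define d where "d k x = cmod (s (r (Suc k)) x - s (r k) x)" for k x
  have d_meas [measurable]: "d k \<in> borel_measurable M" for k
    unfolding d_def by measurable
  \<comment> \<open>The squared increments have integrals at most \<open>4\<^sup>-\<^sup>k\<close>; the weight \<open>2\<^sup>k\<close> keeps the series of integrals
    convergent and yields geometric decay of the increments at almost every point.\<close>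
  have "(\<integral>\<^sup>+x. (\<Sum>k. ennreal (2 ^ k * (d k x)\<^sup>2)) \<partial>M) = (\<Sum>k. \<integral>\<^sup>+x. ennreal (2 ^ k * (d k x)\<^sup>2) \<partial>M)"
    by (rule nn_integral_suminf) measurable
  also have "\<dots> \<le> (\<Sum>k. ennreal ((1/2) ^ k))"
  proof (rule suminf_le)
    fix k
    have "(\<integral>\<^sup>+x. ennreal (2 ^ k * (d k x)\<^sup>2) \<partial>M) = ennreal (2 ^ k) * (\<integral>\<^sup>+x. ennreal ((d k x)\<^sup>2) \<partial>M)"
      by (simp add: ennreal_mult nn_integral_cmult)
    also have "(\<integral>\<^sup>+x. ennreal ((d k x)\<^sup>2) \<partial>M) = ennreal ((L2_norm M (\<lambda>x. s (r (Suc k)) x - s (r k) x))\<^sup>2)"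
      unfolding d_def by (intro ennreal_L2_norm_square L2_diff s)
    also have "\<dots> \<le> ennreal (((1/2) ^ k)\<^sup>2)"
      using K[OF rK[of k "Suc k"] rK[of k k]] by (intro ennreal_leI power_mono) auto
    also have "ennreal (2 ^ k) * ennreal (((1/2) ^ k)\<^sup>2) = ennreal ((1/2) ^ k)"
      by (subst ennreal_mult[symmetric]) (auto simp: power2_eq_square power_mult_distrib[symmetric])
    finally show "(\<integral>\<^sup>+x. ennreal (2 ^ k * (d k x)\<^sup>2) \<partial>M) \<le> ennreal ((1/2) ^ k)"
      by (simp add: mult_left_mono)
  qed auto
  also have "\<dots> = ennreal 2"
    by (subst suminf_ennreal2) (auto simp: suminf_geometric)
  finally have "(\<integral>\<^sup>+x. (\<Sum>k. ennreal (2 ^ k * (d k x)\<^sup>2)) \<partial>M) \<noteq> \<infinity>"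
    by (auto simp: top_unique)
  then have "AE x in M. (\<Sum>k. ennreal (2 ^ k * (d k x)\<^sup>2)) \<noteq> \<infinity>"
    by (intro nn_integral_noteq_infinite) auto
  then have conv: "AE x in M. convergent (\<lambda>k. s (r k) x)"
  proof (rule AE_mp, intro AE_I2 impI)
    fix x assume fin: "(\<Sum>k. ennreal (2 ^ k * (d k x)\<^sup>2)) \<noteq> \<infinity>"
    have "summable (\<lambda>k. 2 ^ k * (d k x)\<^sup>2)"
      using fin by (intro summable_suminf_not_top) auto
    then have "Bseq (\<lambda>k. 2 ^ k * (d k x)\<^sup>2)"
      by (intro convergent_imp_Bseq summable_LIMSEQ_zero[THEN convergentI])
    then obtain B where B: "B > 0" "\<And>k. norm (2 ^ k * (d k x)\<^sup>2) \<le> B"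
      by (auto simp: Bseq_def)
    have dk: "d k x \<le> sqrt B * (sqrt (1/2)) ^ k" for k
    proof -
      have "(d k x)\<^sup>2 \<le> B * (1/2) ^ k"
        using B(2)[of k] by (simp add: power_divide field_simps)
      then have "sqrt ((d k x)\<^sup>2) \<le> sqrt (B * (1/2) ^ k)"
        by (rule real_sqrt_le_mono)
      then show ?thesis
        by (simp add: d_def real_sqrt_mult real_sqrt_power)
    qed
    have "summable (\<lambda>k. norm (s (r (Suc k)) x - s (r k) x))"
    proof (rule summable_comparison_test')
      show "summable (\<lambda>k. sqrt B * (sqrt (1/2)) ^ k)"
        by (intro summable_mult summable_geometric) (simp add: real_sqrt_divide)
      show "norm (norm (s (r (Suc k)) x - s (r k) x)) \<le> sqrt B * (sqrt (1/2)) ^ k" if "0 \<le> k" for k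
        using dk[of k] by (simp add: d_def)
    qed
    then have "summable (\<lambda>k. s (r (Suc k)) x - s (r k) x)"
      by (rule summable_norm_cancel)
    then have "convergent (\<lambda>n. \<Sum>k<n. s (r (Suc k)) x - s (r k) x)"
      by (simp add: summable_iff_convergent)
    then have "convergent (\<lambda>n. s (r n) x - s (r 0) x)"
      by (simp add: sum_lessThan_telescope[of "\<lambda>k. s (r k) x"])
    from convergent_add[OF this convergent_const[of "s (r 0) x"]]
    show "convergent (\<lambda>k. s (r k) x)" by simp
  qed
  define f where "f x = lim (\<lambda>k. s (r k) x)" for x
  have [measurable]: "f \<in> borel_measurable M"
    unfolding f_def by (rule borel_measurable_lim_metric) measurable
  have close: "(\<lambda>x. s n x - f x) \<in> L2 M \<and> L2_norm M (\<lambda>x. s n x - f x) \<le> (1/2) ^ j" if "K j \<le> n" for n j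
  proof -
    have "(\<integral>\<^sup>+x. ennreal ((cmod (s n x - f x))\<^sup>2) \<partial>M) =
        (\<integral>\<^sup>+x. liminf (\<lambda>k. ennreal ((cmod (s n x - s (r k) x))\<^sup>2)) \<partial>M)"
    proof (rule nn_integral_cong_AE, rule AE_mp[OF conv], intro AE_I2 impI)
      fix x assume "convergent (\<lambda>k. s (r k) x)"
      then have "(\<lambda>k. s (r k) x) \<longlonglongrightarrow> f x"
        by (simp add: f_def convergent_LIMSEQ_iff)
      then have "(\<lambda>k. ennreal ((cmod (s n x - s (r k) x))\<^sup>2)) \<longlonglongrightarrow> ennreal ((cmod (s n x - f x))\<^sup>2)"
        by (intro tendsto_intros)
      then show "ennreal ((cmod (s n x - f x))\<^sup>2) = liminf (\<lambda>k. ennreal ((cmod (s n x - s (r k) x))\<^sup>2))"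
        by (rule lim_imp_Liminf[OF sequentially_bot, symmetric])
    qed
    also have "\<dots> \<le> liminf (\<lambda>k. \<integral>\<^sup>+x. ennreal ((cmod (s n x - s (r k) x))\<^sup>2) \<partial>M)"
      by (rule nn_integral_liminf) measurable
    also have "\<dots> \<le> ennreal (((1/2) ^ j)\<^sup>2)"
    proof -
      have "\<forall>\<^sub>F k in sequentially. (\<integral>\<^sup>+x. ennreal ((cmod (s n x - s (r k) x))\<^sup>2) \<partial>M) \<le> ennreal (((1/2) ^ j)\<^sup>2)"
        using eventually_ge_at_top[of j]
      proof eventually_elim
        case (elim k)
        have "(\<integral>\<^sup>+x. ennreal ((cmod (s n x - s (r k) x))\<^sup>2) \<partial>M) = ennreal ((L2_norm M (\<lambda>x. s n x - s (r k) x))\<^sup>2)"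
          by (intro ennreal_L2_norm_square L2_diff s)
        also have "\<dots> \<le> ennreal (((1/2) ^ j)\<^sup>2)"
          using K[OF that rK[OF elim]] by (intro ennreal_leI power_mono) auto
        finally show ?case .
      qed
      then have "limsup (\<lambda>k. \<integral>\<^sup>+x. ennreal ((cmod (s n x - s (r k) x))\<^sup>2) \<partial>M) \<le> ennreal (((1/2) ^ j)\<^sup>2)"
        by (rule Limsup_bounded)
      then show ?thesis
        using Liminf_le_Limsup order_trans sequentially_bot by blast
    qed
    finally have le: "(\<integral>\<^sup>+x. ennreal ((cmod (s n x - f x))\<^sup>2) \<partial>M) \<le> ennreal (((1/2) ^ j)\<^sup>2)" .
    then have mem: "(\<lambda>x. s n x - f x) \<in> L2 M"
      unfolding L2_def by (auto simp: integrable_iff_bounded intro: le_less_trans)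
    then have "(L2_norm M (\<lambda>x. s n x - f x))\<^sup>2 \<le> ((1/2) ^ j)\<^sup>2"
      using le by (simp add: ennreal_L2_norm_square)
    then have "L2_norm M (\<lambda>x. s n x - f x) \<le> (1/2) ^ j"
      by (rule power2_le_imp_le) simp
    with mem show ?thesis by simp
  qed
  have "f \<in> L2 M"
    using L2_diff[OF s[of "K 0"]] close[of 0 "K 0"] by fastforce
  moreover have "(\<lambda>n. L2_norm M (\<lambda>x. s n x - f x)) \<longlonglongrightarrow> 0"
  proof (rule LIMSEQ_I)
    fix e :: real assume "e > 0"
    then obtain j where j: "(1/2::real) ^ j < e"
      using real_arch_pow_inv[of e "1/2"] by auto
    have "norm (L2_norm M (\<lambda>x. s n x - f x) - 0) < e" if "n \<ge> K j" for n
      using close[OF that] j by simp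
    then show "\<exists>no. \<forall>n\<ge>no. norm (L2_norm M (\<lambda>x. s n x - f x) - 0) < e" by blast
  qed
  ultimately show ?thesis by (intro bexI[of _ f])
qed

lemma L2_parallelogram:
  assumes "f \<in> L2 M" "g \<in> L2 M"
  shows "(L2_norm M (\<lambda>x. f x + g x))\<^sup>2 + (L2_norm M (\<lambda>x. f x - g x))\<^sup>2 =
    2 * (L2_norm M f)\<^sup>2 + 2 * (L2_norm M g)\<^sup>2"
proof -
  have "L2_inner M f (\<lambda>x. - 1 * g x) = - L2_inner M f g"
    using L2_inner_scale_left[of M "-1" g f] L2_inner_cnj[of M f "\<lambda>x. - 1 * g x"] L2_inner_cnj[of M f g]
    by simp
  then show ?thesis
    using L2_norm_add_square[OF assms] L2_norm_add_square[OF assms(1) L2_scale[OF assms(2), of "-1"]]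
      L2_norm_scale[of M "-1" g] by simp
qed

text \<open>
  A minimising sequence for the distance from \<open>F\<close> to \<open>X\<close> is Cauchy by the parallelogram law, and the
  minimality of its limit forces the orthogonality. Closedness of \<open>X\<close> enters as completeness, which is
  the form in which it is available for the range of a transform.
\<close>

lemma L2_projection:
  assumes F: "F \<in> L2 M" and X: "X \<subseteq> L2 M" "X \<noteq> {}"
    and add: "\<And>f g. f \<in> X \<Longrightarrow> g \<in> X \<Longrightarrow> (\<lambda>x. f x + g x) \<in> X"
    and scale: "\<And>c f. f \<in> X \<Longrightarrow> (\<lambda>x. c * f x) \<in> X"
    and closed: "\<And>s :: nat \<Rightarrow> _. (\<And>n. s n \<in> X) \<Longrightarrow>
      (\<And>e. e > 0 \<Longrightarrow> \<exists>K. \<forall>m\<ge>K. \<forall>n\<ge>K. L2_norm M (\<lambda>x. s m x - s n x) < e) \<Longrightarrow>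
      \<exists>f\<in>X. (\<lambda>n. L2_norm M (\<lambda>x. s n x - f x)) \<longlonglongrightarrow> 0"
  shows "\<exists>P\<in>X. \<forall>h\<in>X. L2_inner M (\<lambda>x. F x - P x) h = 0"
proof -
  define \<delta> where "\<delta> f = L2_norm M (\<lambda>x. F x - f x)" for f
  define d where "d = Inf (\<delta> ` X)"
  have bdd: "bdd_below (\<delta> ` X)"
    by (rule bdd_belowI[of _ 0]) (auto simp: \<delta>_def)
  have d_le: "d \<le> \<delta> f" if "f \<in> X" for f
    unfolding d_def using bdd that by (intro cInf_lower) auto
  have d0: "0 \<le> d"
    unfolding d_def using X(2) by (intro cInf_greatest) (auto simp: \<delta>_def)
  have "\<exists>f\<in>X. \<delta> f < sqrt (d\<^sup>2 + 1 / real (Suc n))" for n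
  proof -
    have "d = sqrt (d\<^sup>2)" using d0 by simp
    also have "\<dots> < sqrt (d\<^sup>2 + 1 / real (Suc n))" by (rule real_sqrt_less_mono) simp
    finally have "Inf (\<delta> ` X) < sqrt (d\<^sup>2 + 1 / real (Suc n))" by (simp add: d_def)
    then show ?thesis using cInf_lessD[of "\<delta> ` X"] X(2) by auto
  qed
  then obtain s where s: "\<And>n. s n \<in> X" and s_lt: "\<And>n. \<delta> (s n) < sqrt (d\<^sup>2 + 1 / real (Suc n))"
    by metis
  have sL2: "s n \<in> L2 M" for n using s X by auto
  have sq: "(\<delta> (s n))\<^sup>2 \<le> d\<^sup>2 + 1 / real (Suc n)" for n
    using s_lt[of n] real_sqrt_le_iff[of "(\<delta> (s n))\<^sup>2" "d\<^sup>2 + 1 / real (Suc n)"]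
    by (simp add: \<delta>_def)
  have dist: "(L2_norm M (\<lambda>x. s m x - s n x))\<^sup>2 \<le> 2 / real (Suc m) + 2 / real (Suc n)" for m n
  proof -
    let ?u = "\<lambda>x. F x - s m x" and ?v = "\<lambda>x. F x - s n x"
    have mid: "(\<lambda>x. (1/2) * (s m x + s n x)) \<in> X"
      by (intro scale add s)
    have "(\<lambda>x. ?u x + ?v x) = (\<lambda>x. 2 * (F x - (1/2) * (s m x + s n x)))"
      by (auto simp: field_simps)
    then have "L2_norm M (\<lambda>x. ?u x + ?v x) = 2 * \<delta> (\<lambda>x. (1/2) * (s m x + s n x))"
      unfolding \<delta>_def by (simp only: L2_norm_scale) simp
    then have "2 * d \<le> L2_norm M (\<lambda>x. ?u x + ?v x)"
      using d_le[OF mid] by simp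
    then have "(2 * d)\<^sup>2 \<le> (L2_norm M (\<lambda>x. ?u x + ?v x))\<^sup>2"
      using d0 by (intro power_mono) auto
    moreover have "L2_norm M (\<lambda>x. ?u x - ?v x) = L2_norm M (\<lambda>x. s m x - s n x)"
      using L2_norm_minus_commute[of M "s n" "s m"] by simp
    ultimately show ?thesis
      using L2_parallelogram[OF L2_diff[OF F sL2[of m]] L2_diff[OF F sL2[of n]]] sq[of m] sq[of n]
      by (simp add: \<delta>_def)
  qed
  have "\<exists>K. \<forall>m\<ge>K. \<forall>n\<ge>K. L2_norm M (\<lambda>x. s m x - s n x) < e" if "e > 0" for e
  proof -
    have "0 < e\<^sup>2 / 4" using that by simp
    then obtain K where K: "inverse (real (Suc K)) < e\<^sup>2 / 4"
      using reals_Archimedean by blast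
    have "L2_norm M (\<lambda>x. s m x - s n x) < e" if mn: "m \<ge> K" "n \<ge> K" for m n
    proof (rule power2_less_imp_less)
      have "1 / real (Suc m) \<le> 1 / real (Suc K)" "1 / real (Suc n) \<le> 1 / real (Suc K)"
        using mn by (intro divide_left_mono; simp)+
      then show "(L2_norm M (\<lambda>x. s m x - s n x))\<^sup>2 < e\<^sup>2"
        using dist[of m n] K by (simp add: inverse_eq_divide)
    qed (use \<open>e > 0\<close> in simp)
    then show ?thesis by blast
  qed
  from closed[of s, OF s this]
  obtain P where P: "P \<in> X" and lim: "(\<lambda>n. L2_norm M (\<lambda>x. s n x - P x)) \<longlonglongrightarrow> 0"
    by blast
  have PL2: "P \<in> L2 M" using P X by auto
  have le: "\<delta> P \<le> d"
  proof (rule LIMSEQ_le_const)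
    have "(\<lambda>n. sqrt (d\<^sup>2 + 1 / real (Suc n)) + L2_norm M (\<lambda>x. s n x - P x)) \<longlonglongrightarrow> sqrt (d\<^sup>2 + 0) + 0"
      by (intro tendsto_intros lim LIMSEQ_Suc[OF lim_1_over_n])
    then show "(\<lambda>n. sqrt (d\<^sup>2 + 1 / real (Suc n)) + L2_norm M (\<lambda>x. s n x - P x)) \<longlonglongrightarrow> d"
      using d0 by simp
    have "\<delta> P \<le> sqrt (d\<^sup>2 + 1 / real (Suc n)) + L2_norm M (\<lambda>x. s n x - P x)" for n
      using L2_norm_diff_triangle[OF F sL2[of n] PL2] s_lt[of n] by (simp add: \<delta>_def)
    then show "\<exists>N. \<forall>n\<ge>N. \<delta> P \<le> sqrt (d\<^sup>2 + 1 / real (Suc n)) + L2_norm M (\<lambda>x. s n x - P x)"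
      by blast
  qed
  have "L2_inner M (\<lambda>x. F x - P x) h = 0" if h: "h \<in> X" for h
  proof (cases "L2_norm M h = 0")
    case True
    then show ?thesis
      using cmod_L2_inner_le[OF L2_diff[OF F PL2], of h] h X by auto
  next
    case False
    define w where "w = L2_inner M (\<lambda>x. F x - P x) h"
    \<comment> \<open>The coefficient that minimises \<open>\<parallel>F - P + c h\<parallel>\<close>.\<close>
    define c where "c = - w / complex_of_real ((L2_norm M h)\<^sup>2)"
    have hL2: "h \<in> L2 M" using h X by auto
    have "d \<le> \<delta> (\<lambda>x. P x + (- c) * h x)"
      by (intro d_le add scale P h)
    also have "(\<lambda>x. F x - (P x + (- c) * h x)) = (\<lambda>x. (F x - P x) + c * h x)"
      by auto
    then have "\<delta> (\<lambda>x. P x + (- c) * h x) = L2_norm M (\<lambda>x. (F x - P x) + c * h x)"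
      by (simp add: \<delta>_def)
    finally have "\<delta> P \<le> L2_norm M (\<lambda>x. (F x - P x) + c * h x)"
      using le by simp
    then have "(\<delta> P)\<^sup>2 \<le> (L2_norm M (\<lambda>x. (F x - P x) + c * h x))\<^sup>2"
      by (intro power_mono) (auto simp: \<delta>_def)
    moreover have "L2_inner M (\<lambda>x. F x - P x) (\<lambda>x. c * h x) = cnj c * w"
      using L2_inner_scale_left[of M c h "\<lambda>x. F x - P x"] L2_inner_cnj[of M "\<lambda>x. F x - P x" "\<lambda>x. c * h x"]
        L2_inner_cnj[of M "\<lambda>x. F x - P x" h]
      by (simp add: w_def)
    ultimately have "0 \<le> (cmod c * L2_norm M h)\<^sup>2 + 2 * Re (cnj c * w)"
      using L2_norm_add_square[OF L2_diff[OF F PL2] L2_scale[OF hL2, of c]]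
      by (simp add: \<delta>_def L2_norm_scale)
    moreover have "cnj c * w = - complex_of_real ((cmod w)\<^sup>2 / (L2_norm M h)\<^sup>2)"
      using complex_norm_square[of w] by (simp add: c_def mult.commute)
    moreover have "(cmod c * L2_norm M h)\<^sup>2 = (cmod w)\<^sup>2 / (L2_norm M h)\<^sup>2"
      using False by (simp add: c_def norm_divide norm_mult power_mult_distrib power_divide
          power2_eq_square)
    ultimately have "(cmod w)\<^sup>2 / (L2_norm M h)\<^sup>2 \<le> 0"
      by simp
    moreover have "(L2_norm M h)\<^sup>2 > 0" using False by simp
    ultimately have "(cmod w)\<^sup>2 \<le> 0" by (simp add: divide_le_0_iff)
    then show ?thesis by (simp add: w_def)
  qed
  with P show ?thesis by (intro bexI[of _ P] ballI)
qed

section \<open>Coordinatewise affine substitutions\<close>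

definition diag_map :: "('a::euclidean_space \<Rightarrow> real) \<Rightarrow> 'a \<Rightarrow> 'a" where
  "diag_map c x = (\<Sum>j\<in>Basis. (c j * (x \<bullet> j)) *\<^sub>R j)"

lemma diag_map_measurable [measurable]: "diag_map c \<in> borel_measurable borel"
  unfolding diag_map_def by measurable

lemma inner_diag_map_Basis [simp]: "j \<in> Basis \<Longrightarrow> diag_map c x \<bullet> j = c j * (x \<bullet> j)"
  by (simp add: diag_map_def)

lemma inner_diag_map: "diag_map c x \<bullet> y = x \<bullet> diag_map c y"
  by (subst (1 2) euclidean_inner) (simp add: ac_simps)

lemma diag_map_const: "diag_map (\<lambda>_. d) x = d *\<^sub>R x"
  by (rule euclidean_eqI) simp

lemma nn_integral_lborel_affine:
  fixes c :: "'a::euclidean_space \<Rightarrow> real" and t :: 'a and g :: "'a \<Rightarrow> ennreal"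
  assumes c: "\<And>j. j \<in> Basis \<Longrightarrow> c j \<noteq> 0" and [measurable]: "g \<in> borel_measurable borel"
  shows "(\<integral>\<^sup>+x. g x \<partial>lborel) =
    ennreal (\<Prod>j\<in>Basis. \<bar>c j\<bar>) * (\<integral>\<^sup>+x. g (t + diag_map c x) \<partial>lborel)"
proof -
  let ?T = "\<lambda>x. t + diag_map c x" and ?K = "\<Prod>j\<in>Basis. \<bar>c j\<bar>"
  have [measurable]: "?T \<in> borel_measurable borel" by measurable
  have "integral\<^sup>N lborel g = integral\<^sup>N (density (distr lborel borel ?T) (\<lambda>_. ennreal ?K)) g"
    using lborel_affine_euclidean[where c=c and t=t, OF c, folded diag_map_def] by (rule arg_cong)
  also have "\<dots> = (\<integral>\<^sup>+x. ennreal ?K * g x \<partial>distr lborel borel ?T)"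
    by (rule nn_integral_density) measurable
  also have "\<dots> = (\<integral>\<^sup>+x. ennreal ?K * g (?T x) \<partial>lborel)"
    by (rule nn_integral_distr) measurable
  also have "\<dots> = ennreal ?K * (\<integral>\<^sup>+x. g (?T x) \<partial>lborel)"
    by (rule nn_integral_cmult) measurable
  finally show ?thesis .
qed

lemma integrable_lborel_affine:
  fixes c :: "'a::euclidean_space \<Rightarrow> real" and t :: 'a and g :: "'a \<Rightarrow> 'b::{banach, second_countable_topology}"
  assumes c: "\<And>j. j \<in> Basis \<Longrightarrow> c j \<noteq> 0" and g: "integrable lborel g"
  shows "integrable lborel (\<lambda>x. g (t + diag_map c x))"
proof -
  have [measurable]: "g \<in> borel_measurable borel"
    using g by (auto dest: borel_measurable_integrable)
  have "(\<integral>\<^sup>+x. ennreal (norm (g x)) \<partial>lborel) < \<infinity>"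
    using g by (simp add: integrable_iff_bounded)
  then show ?thesis
    using c by (subst (asm) nn_integral_lborel_affine[where c=c and t=t, OF c])
      (auto simp: integrable_iff_bounded ennreal_mult_less_top prod_nonneg prod_zero_iff)
qed

lemma integral_lborel_affine:
  fixes c :: "'a::euclidean_space \<Rightarrow> real" and t :: 'a and g :: "'a \<Rightarrow> 'b::{banach, second_countable_topology}"
  assumes c: "\<And>j. j \<in> Basis \<Longrightarrow> c j \<noteq> 0" and [measurable]: "g \<in> borel_measurable borel"
  shows "(LINT x|lborel. g x) =
    (\<Prod>j\<in>Basis. \<bar>c j\<bar>) *\<^sub>R (LINT x|lborel. g (t + diag_map c x))"
proof -
  let ?T = "\<lambda>x. t + diag_map c x" and ?K = "\<Prod>j\<in>Basis. \<bar>c j\<bar>"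
  have [measurable]: "?T \<in> borel_measurable borel" by measurable
  have "integral\<^sup>L lborel g = integral\<^sup>L (density (distr lborel borel ?T) (\<lambda>_. ennreal ?K)) g"
    using lborel_affine_euclidean[where c=c and t=t, OF c, folded diag_map_def] by (rule arg_cong)
  also have "\<dots> = (LINT x|distr lborel borel ?T. ?K *\<^sub>R g x)"
    by (rule integral_density) (auto intro!: AE_I2 prod_nonneg)
  also have "\<dots> = (LINT x|lborel. ?K *\<^sub>R g (?T x))"
    by (rule integral_distr) measurable
  also have "\<dots> = ?K *\<^sub>R (LINT x|lborel. g (?T x))"
    by (rule integral_scaleR_right)
  finally show ?thesis .
qed

lemma integrable_lborel_scaleR:
  fixes t :: "'a::euclidean_space" and g :: "'a \<Rightarrow> 'b::{banach, second_countable_topology}"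
  assumes "d \<noteq> 0" "integrable lborel g"
  shows "integrable lborel (\<lambda>x. g (t + d *\<^sub>R x))"
  using integrable_lborel_affine[where c="\<lambda>_. d" and g=g and t=t] assms
  by (simp add: diag_map_const)

lemma integral_lborel_scaleR:
  fixes t :: "'a::euclidean_space" and g :: "'a \<Rightarrow> 'b::{banach, second_countable_topology}"
  assumes "d \<noteq> 0" "g \<in> borel_measurable borel"
  shows "(LINT x|lborel. g x) = \<bar>d\<bar> ^ DIM('a) *\<^sub>R (LINT x|lborel. g (t + d *\<^sub>R x))"
  using integral_lborel_affine[where c="\<lambda>_. d" and g=g and t=t] assms
  by (simp add: diag_map_const)

lemma nn_integral_lborel_shift:
  fixes t :: "'a::euclidean_space" and g :: "'a \<Rightarrow> ennreal"
  assumes "g \<in> borel_measurable borel"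
  shows "(\<integral>\<^sup>+x. g (x + t) \<partial>lborel) = (\<integral>\<^sup>+x. g x \<partial>lborel)"
  using nn_integral_lborel_affine[where c="\<lambda>_. 1" and g=g and t=t] assms
  by (simp add: diag_map_const add.commute)

section \<open>The Fourier integral\<close>

lemma borel_measurable_cis [measurable (raw)]:
  "f \<in> borel_measurable M \<Longrightarrow> (\<lambda>x. cis (f x)) \<in> borel_measurable M"
  unfolding cis_conv_exp by measurable

definition ft :: "('a::euclidean_space \<Rightarrow> complex) \<Rightarrow> 'a \<Rightarrow> complex" where
  "ft f \<xi> = (LINT x|lborel. f x * cis (- (x \<bullet> \<xi>)))"

lemma ft_measurable [measurable]:
  assumes [measurable]: "f \<in> borel_measurable borel"
  shows "ft f \<in> borel_measurable borel"
  unfolding ft_def by measurable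

lemma integrable_mult_unimodular:
  fixes f k :: "'a \<Rightarrow> complex"
  assumes "integrable M f" "k \<in> borel_measurable M" "\<And>x. cmod (k x) \<le> 1"
  shows "integrable M (\<lambda>x. f x * k x)"
  by (rule Bochner_Integration.integrable_bound[OF assms(1)])
     (use assms in \<open>auto simp: norm_mult intro!: mult_left_le\<close>)

lemma integrable_ft_integrand:
  "integrable lborel f \<Longrightarrow> integrable lborel (\<lambda>x. f x * cis (- (x \<bullet> \<xi>)))"
  by (rule integrable_mult_unimodular) auto

lemma cmod_ft_le: "cmod (ft f \<xi>) \<le> (LINT x|lborel. cmod (f x))"
  unfolding ft_def using integral_norm_bound[of lborel "\<lambda>x. f x * cis (- (x \<bullet> \<xi>))"]
  by (simp add: norm_mult)

lemma ft_diff: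
  assumes "integrable lborel f" "integrable lborel g"
  shows "ft (\<lambda>x. f x - g x) \<xi> = ft f \<xi> - ft g \<xi>"
  using assms by (simp add: ft_def left_diff_distrib integrable_ft_integrand)

lemma integrable_pair_mult:
  fixes f :: "'a::euclidean_space \<Rightarrow> complex" and g :: "'b::euclidean_space \<Rightarrow> complex"
  assumes f: "integrable lborel f" and g: "integrable lborel g"
    and k[measurable]: "case_prod k \<in> borel_measurable (lborel \<Otimes>\<^sub>M lborel)" "\<And>x y. cmod (k x y) \<le> 1"
  shows "integrable (lborel \<Otimes>\<^sub>M lborel) (\<lambda>(x, y). f x * g y * k x y)"
proof -
  have [measurable]: "f \<in> borel_measurable borel" "g \<in> borel_measurable borel"
    using f g by (auto dest: borel_measurable_integrable)
  have "integrable (lborel \<Otimes>\<^sub>M lborel) (\<lambda>(x, y). f x * g y)"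
    by (rule lborel_pair.Fubini_integrable)
       (use f g in \<open>auto simp: norm_mult split_beta' intro!: integrable_norm\<close>)
  then have "integrable (lborel \<Otimes>\<^sub>M lborel) (\<lambda>z. (case z of (x, y) \<Rightarrow> f x * g y) * (case z of (x, y) \<Rightarrow> k x y))"
    by (rule integrable_mult_unimodular) (use k in auto)
  then show ?thesis by (simp add: split_beta')
qed

text \<open>
  Fubini for the kernel \<open>cis (- (x \<bullet> \<xi>))\<close>, which is symmetric in \<open>x\<close> and \<open>\<xi>\<close>. The
  Gaussian computations below apply it with a Gaussian factor in \<open>u\<close>.
\<close>

lemma ft_multiplication_formula:
  fixes f u :: "'a::euclidean_space \<Rightarrow> complex"
  assumes f: "integrable lborel f" and u: "integrable lborel u"
  shows "(LINT \<xi>|lborel. ft f \<xi> * u \<xi>) = (LINT x|lborel. f x * ft u x)"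
proof -
  have [measurable]: "f \<in> borel_measurable borel" "u \<in> borel_measurable borel"
    using f u by (auto dest: borel_measurable_integrable)
  have "integrable (lborel \<Otimes>\<^sub>M lborel) (\<lambda>(x, y). f x * u y * cis (- (x \<bullet> y)))"
    by (rule integrable_pair_mult[OF f u]) auto
  from lborel_pair.Fubini_integral[OF this]
  have "(LINT y|lborel. LINT x|lborel. f x * u y * cis (- (x \<bullet> y))) =
      (LINT x|lborel. LINT y|lborel. f x * u y * cis (- (x \<bullet> y)))"
    by simp
  moreover have "ft f y * u y = (LINT x|lborel. f x * u y * cis (- (x \<bullet> y)))" for y
    unfolding ft_def by (subst integral_mult_left_zero[symmetric]) (simp add: ac_simps)
  moreover have "f x * ft u x = (LINT y|lborel. f x * u y * cis (- (x \<bullet> y)))" for x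
    unfolding ft_def by (subst integral_mult_right_zero[symmetric]) (simp add: ac_simps inner_commute)
  ultimately show ?thesis by simp
qed

section \<open>Gaussian regularisation and the Bessel inequality\<close>

text \<open>
  The density of the standard normal distribution on the whole space.
\<close>

definition gauss :: "'a::euclidean_space \<Rightarrow> real" where
  "gauss x = exp (- (norm x)\<^sup>2 / 2) / sqrt (2 * pi) ^ DIM('a)"

text \<open>
  The Gaussian factors over the coordinates; this reduces its Fourier transform to the characteristic
  function of the standard normal distribution on the line.
\<close>

lemma exp_norm_square_eq_prod:
  fixes x :: "'a::euclidean_space"
  shows "exp (- (norm x)\<^sup>2 / 2) = (\<Prod>b\<in>Basis. exp (- (x \<bullet> b)\<^sup>2 / 2))"
proof -
  have "(norm x)\<^sup>2 = (\<Sum>b\<in>Basis. (x \<bullet> b)\<^sup>2)"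
    by (subst power2_norm_eq_inner, subst euclidean_inner) (simp add: power2_eq_square)
  then show ?thesis
    by (simp add: exp_sum[symmetric] sum_negf sum_divide_distrib)
qed

lemma gauss_eq_prod: "gauss x = (\<Prod>b\<in>Basis. std_normal_density (x \<bullet> b))"
  using exp_norm_square_eq_prod[of x]
  by (simp add: gauss_def std_normal_density_def prod_dividef prod.distrib power_divide)

lemma gauss_measurable [measurable]: "gauss \<in> borel_measurable borel"
  unfolding gauss_def by measurable

lemma gauss_nonneg [simp]: "0 \<le> gauss x"
  by (simp add: gauss_def)

lemma
  fixes f :: "'a::euclidean_space \<Rightarrow> real \<Rightarrow> complex"
  assumes f: "\<And>b. b \<in> Basis \<Longrightarrow> integrable lborel (f b)"
  shows integral_lborel_prod: "(LINT x|lborel. (\<Prod>b\<in>Basis. f b (x \<bullet> b))) = (\<Prod>b\<in>Basis. (LINT x|lborel. f b x))"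
    and integrable_lborel_prod: "integrable lborel (\<lambda>x. (\<Prod>b\<in>Basis. f b (x \<bullet> b)))"
proof -
  interpret product_sigma_finite "\<lambda>_::'a. lborel :: real measure" ..
  have [measurable]: "f b \<in> borel_measurable borel" if "b \<in> Basis" for b
    using f[OF that] by (auto dest: borel_measurable_integrable)
  have lb: "lborel = distr (\<Pi>\<^sub>M b\<in>(Basis :: 'a set). (lborel :: real measure)) borel (\<lambda>g. \<Sum>b\<in>Basis. g b *\<^sub>R b)"
    by (subst lborel_def) (simp add: lborel_eq_real)
  show "(LINT x|lborel. (\<Prod>b\<in>Basis. f b (x \<bullet> b))) = (\<Prod>b\<in>Basis. (LINT x|lborel. f b x))"
    by (subst lb) (simp add: integral_distr product_integral_prod f)
  show "integrable lborel (\<lambda>x. (\<Prod>b\<in>Basis. f b (x \<bullet> b)))"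
    by (subst lb) (simp add: integrable_distr_eq product_integrable_prod f)
qed

lemma
  fixes \<xi> :: "'a::euclidean_space"
  shows integrable_gauss: "integrable lborel (gauss :: 'a \<Rightarrow> real)"
    and ft_gauss: "ft (\<lambda>x. complex_of_real (gauss x)) \<xi> = complex_of_real (exp (- (norm \<xi>)\<^sup>2 / 2))"
proof -
  have one: "integrable lborel (\<lambda>s. complex_of_real (std_normal_density s) * cis (- (s * t)))" for t
    by (rule integrable_mult_unimodular) (auto intro: integrable_normal_density)
  have char: "(LINT s|lborel. complex_of_real (std_normal_density s) * cis (- (s * t))) =
      complex_of_real (exp (- t\<^sup>2 / 2))" for t
  proof -
    have "(LINT s|lborel. complex_of_real (std_normal_density s) * cis (- (s * t))) = char std_normal_distribution (- t)"
      unfolding char_def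
      by (subst integral_density) (auto simp: normal_density_nonneg cis_conv_exp scaleR_conv_of_real ac_simps)
    then show ?thesis by (simp add: char_std_normal_distribution)
  qed
  have prod: "complex_of_real (gauss x) * cis (- (x \<bullet> t)) =
      (\<Prod>b\<in>Basis. complex_of_real (std_normal_density (x \<bullet> b)) * cis (- ((x \<bullet> b) * (t \<bullet> b))))" for x t :: 'a
  proof -
    have "cis (- (x \<bullet> t)) = (\<Prod>b\<in>Basis. cis (- ((x \<bullet> b) * (t \<bullet> b))))"
      unfolding cis_conv_exp
      by (subst exp_sum[symmetric]) (simp_all add: euclidean_inner[of x t] sum_negf sum_distrib_left)
    then show ?thesis by (simp add: gauss_eq_prod prod.distrib)
  qed
  have "integrable lborel (\<lambda>x::'a. complex_of_real (gauss x) * cis (- (x \<bullet> 0)))"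
    unfolding prod by (intro integrable_lborel_prod one)
  then show "integrable lborel (gauss :: 'a \<Rightarrow> real)"
    by (simp add: complex_of_real_integrable_eq)
  have "ft (\<lambda>x. complex_of_real (gauss x)) \<xi> =
      (\<Prod>b\<in>Basis. complex_of_real (exp (- (\<xi> \<bullet> b)\<^sup>2 / 2)))"
    unfolding ft_def prod by (subst integral_lborel_prod) (auto intro: one simp: char simp del: of_real_exp)
  also have "\<dots> = complex_of_real (exp (- (norm \<xi>)\<^sup>2 / 2))"
    by (simp only: exp_norm_square_eq_prod of_real_prod)
  finally show "ft (\<lambda>x. complex_of_real (gauss x)) \<xi> = complex_of_real (exp (- (norm \<xi>)\<^sup>2 / 2))" .
qed

text \<open>
  The Gaussian normalised to the value one at the origin. Along \<open>gauss_window (d \<xi>)\<close> with \<open>d \<rightarrow> 0\<close> it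
  increases to one and serves as a convergence factor on the frequency side.
\<close>

definition gauss_window :: "'a::euclidean_space \<Rightarrow> real" where
  "gauss_window \<xi> = exp (- (norm \<xi>)\<^sup>2 / 2)"

lemma gauss_window_eq: "gauss_window (\<xi>::'a::euclidean_space) = sqrt (2 * pi) ^ DIM('a) * gauss \<xi>"
  by (simp add: gauss_window_def gauss_def)

lemma gauss_window_measurable [measurable]: "gauss_window \<in> borel_measurable borel"
  unfolding gauss_window_def by measurable

lemma gauss_window_nonneg [simp]: "0 \<le> gauss_window \<xi>"
  by (simp add: gauss_window_def)

lemma integrable_gauss_window:
  assumes "d \<noteq> 0"
  shows "integrable lborel (\<lambda>\<xi>::'a::euclidean_space. gauss_window (d *\<^sub>R \<xi>))"
  using integrable_lborel_scaleR[of d "gauss :: 'a \<Rightarrow> real" 0] assms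
  unfolding gauss_window_eq by (intro integrable_mult_right) (simp add: integrable_gauss)

text \<open>
  The inverse Fourier transform of the window of width \<open>1/d\<close> is a normal density of width \<open>d\<close>, up to
  the factor \<open>(2 \<pi>)\<^sup>n\<close>: an approximate identity centred at \<open>x\<close>.
\<close>

lemma ft_modulated_gauss_window:
  fixes x y :: "'a::euclidean_space"
  assumes d: "d > 0"
  shows "ft (\<lambda>\<xi>. cis (x \<bullet> \<xi>) * complex_of_real (gauss_window (d *\<^sub>R \<xi>))) y =
    complex_of_real ((2 * pi) ^ DIM('a) / d ^ DIM('a) * gauss ((1 / d) *\<^sub>R (y - x)))"
proof -
  let ?z = "(1 / d) *\<^sub>R (y - x)"
  define h where "h \<xi> = complex_of_real (gauss_window (d *\<^sub>R \<xi>)) * cis (- (\<xi> \<bullet> (y - x)))" for \<xi>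
  have [measurable]: "h \<in> borel_measurable borel"
    unfolding h_def by measurable
  have "cis (x \<bullet> \<xi>) * complex_of_real (gauss_window (d *\<^sub>R \<xi>)) * cis (- (\<xi> \<bullet> y)) = h \<xi>" for \<xi>
  proof -
    have "cis (- (\<xi> \<bullet> (y - x))) = cis (x \<bullet> \<xi>) * cis (- (\<xi> \<bullet> y))"
      by (simp add: cis_mult inner_diff_right inner_commute)
    then show ?thesis by (simp add: h_def ac_simps)
  qed
  then have "ft (\<lambda>\<xi>. cis (x \<bullet> \<xi>) * complex_of_real (gauss_window (d *\<^sub>R \<xi>))) y = (LINT \<xi>|lborel. h \<xi>)"
    by (simp add: ft_def)
  also have "\<dots> = \<bar>1 / d\<bar> ^ DIM('a) *\<^sub>R (LINT \<xi>|lborel. h (0 + (1 / d) *\<^sub>R \<xi>))"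
    using d by (intro integral_lborel_scaleR) auto
  also have "(\<lambda>\<xi>. h (0 + (1 / d) *\<^sub>R \<xi>)) =
      (\<lambda>\<xi>. complex_of_real (sqrt (2 * pi) ^ DIM('a)) * (complex_of_real (gauss \<xi>) * cis (- (\<xi> \<bullet> ?z))))"
    using d by (auto simp: h_def gauss_window_eq fun_eq_iff)
  also have "(LINT \<xi>|lborel. complex_of_real (sqrt (2 * pi) ^ DIM('a)) * (complex_of_real (gauss \<xi>) * cis (- (\<xi> \<bullet> ?z)))) =
     complex_of_real (sqrt (2 * pi) ^ DIM('a)) * complex_of_real (gauss_window ?z)"
    by (simp only: integral_mult_right_zero ft_gauss[unfolded ft_def, folded gauss_window_def])
  also have "\<dots> = complex_of_real ((2 * pi) ^ DIM('a) * gauss ?z)"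
    unfolding gauss_window_eq of_real_mult[symmetric] mult.assoc[symmetric] power_mult_distrib[symmetric] by simp
  finally show ?thesis
    using d by (simp add: scaleR_conv_of_real power_divide)
qed

text \<open>
  Fourier inversion with a convergence factor recovers the average of \<open>f\<close> near \<open>x\<close> against a normal
  density of width \<open>d\<close>. This is the multiplication formula for \<open>f\<close> and the modulated window.
\<close>

lemma gauss_weighted_inversion:
  fixes f :: "'a::euclidean_space \<Rightarrow> complex"
  assumes f: "integrable lborel f" and d: "d > 0"
  shows "(LINT \<xi>|lborel. ft f \<xi> * (cis (x \<bullet> \<xi>) * complex_of_real (gauss_window (d *\<^sub>R \<xi>)))) =
    (2 * pi) ^ DIM('a) * (LINT w|lborel. f (x + d *\<^sub>R w) * complex_of_real (gauss w))"
proof -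
  have [measurable]: "f \<in> borel_measurable borel"
    using f by (auto dest: borel_measurable_integrable)
  have "integrable lborel (\<lambda>\<xi>. complex_of_real (gauss_window (d *\<^sub>R \<xi>)) * cis (x \<bullet> \<xi>))"
    using d by (intro integrable_mult_unimodular integrable_of_real integrable_gauss_window) auto
  then have u: "integrable lborel (\<lambda>\<xi>. cis (x \<bullet> \<xi>) * complex_of_real (gauss_window (d *\<^sub>R \<xi>)))"
    by (simp add: mult.commute)
  let ?g = "\<lambda>y. f y * complex_of_real ((2 * pi) ^ DIM('a) / d ^ DIM('a) * gauss ((1 / d) *\<^sub>R (y - x)))"
  have "(LINT \<xi>|lborel. ft f \<xi> * (cis (x \<bullet> \<xi>) * complex_of_real (gauss_window (d *\<^sub>R \<xi>)))) = (LINT y|lborel. ?g y)"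
    using ft_multiplication_formula[OF f u] by (simp only: ft_modulated_gauss_window[OF d])
  also have "\<dots> = \<bar>d\<bar> ^ DIM('a) *\<^sub>R (LINT w|lborel. ?g (x + d *\<^sub>R w))"
    using d by (intro integral_lborel_scaleR) auto
  also have "(\<lambda>w. ?g (x + d *\<^sub>R w)) =
      (\<lambda>w. complex_of_real ((2 * pi) ^ DIM('a) / d ^ DIM('a)) * (f (x + d *\<^sub>R w) * complex_of_real (gauss w)))"
    using d by (auto simp: fun_eq_iff)
  also have "(LINT w|lborel. complex_of_real ((2 * pi) ^ DIM('a) / d ^ DIM('a)) * (f (x + d *\<^sub>R w) * complex_of_real (gauss w))) =
      complex_of_real ((2 * pi) ^ DIM('a) / d ^ DIM('a)) * (LINT w|lborel. f (x + d *\<^sub>R w) * complex_of_real (gauss w))"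
    by (rule integral_mult_right_zero)
  finally show ?thesis
    using d by (simp add: scaleR_conv_of_real)
qed

text \<open>
  The multiplication formula once more, now for \<open>f\<close> and \<open>cnj (ft f)\<close> times the window, expresses the
  regularised energy of \<open>ft f\<close> by \<open>f\<close> and its Gaussian averages.
\<close>

lemma gauss_weighted_energy:
  fixes f :: "'a::euclidean_space \<Rightarrow> complex"
  assumes f: "integrable lborel f" and d: "d > 0"
  shows "integrable lborel (\<lambda>\<xi>. (cmod (ft f \<xi>))\<^sup>2 * gauss_window (d *\<^sub>R \<xi>))"
    and "complex_of_real (LINT \<xi>|lborel. (cmod (ft f \<xi>))\<^sup>2 * gauss_window (d *\<^sub>R \<xi>)) =
      (2 * pi) ^ DIM('a) * (LINT x|lborel. f x * cnj (LINT w|lborel. f (x + d *\<^sub>R w) * complex_of_real (gauss w)))"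
proof -
  have [measurable]: "f \<in> borel_measurable borel"
    using f by (auto dest: borel_measurable_integrable)
  define B where "B = (LINT x|lborel. cmod (f x))"
  have B: "cmod (ft f \<xi>) \<le> B" for \<xi>
    unfolding B_def by (rule cmod_ft_le)
  have B0: "0 \<le> B" by (simp add: B_def)
  define v where "v \<xi> = cnj (ft f \<xi>) * complex_of_real (gauss_window (d *\<^sub>R \<xi>))" for \<xi>
  have dom: "integrable lborel (\<lambda>\<xi>::'a. C * gauss_window (d *\<^sub>R \<xi>))" for C
    using d by (intro integrable_mult_right integrable_gauss_window) auto
  have v: "integrable lborel v"
    unfolding v_def using B B0
    by (intro Bochner_Integration.integrable_bound[OF dom[of B]])
       (auto simp: norm_mult abs_mult intro!: mult_right_mono)
  have [measurable]: "v \<in> borel_measurable borel"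
    using v by (auto dest: borel_measurable_integrable)
  show "integrable lborel (\<lambda>\<xi>. (cmod (ft f \<xi>))\<^sup>2 * gauss_window (d *\<^sub>R \<xi>))"
    using B B0
    by (intro Bochner_Integration.integrable_bound[OF dom[of "B\<^sup>2"]])
       (auto simp: abs_mult intro!: mult_right_mono power_mono)
  have ft_v: "ft v x = (2 * pi) ^ DIM('a) * cnj (LINT w|lborel. f (x + d *\<^sub>R w) * complex_of_real (gauss w))" for x
  proof -
    have "v \<xi> * cis (- (\<xi> \<bullet> x)) = cnj (ft f \<xi> * (cis (x \<bullet> \<xi>) * complex_of_real (gauss_window (d *\<^sub>R \<xi>))))" for \<xi>
      by (simp add: v_def cis_cnj inner_commute)
    then have "ft v x = cnj (LINT \<xi>|lborel. ft f \<xi> * (cis (x \<bullet> \<xi>) * complex_of_real (gauss_window (d *\<^sub>R \<xi>))))"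
      unfolding ft_def[of v] by (simp only: Bochner_Integration.integral_cnj)
    then show ?thesis
      by (simp only: gauss_weighted_inversion[OF f d] complex_cnj_mult complex_cnj_power complex_cnj_numeral
          complex_cnj_complex_of_real)
  qed
  have "complex_of_real (LINT \<xi>|lborel. (cmod (ft f \<xi>))\<^sup>2 * gauss_window (d *\<^sub>R \<xi>)) = (LINT \<xi>|lborel. ft f \<xi> * v \<xi>)"
    unfolding v_def by (subst integral_complex_of_real[symmetric]) (simp only: of_real_mult complex_norm_square mult.assoc)
  also have "\<dots> = (LINT x|lborel. f x * ft v x)"
    by (rule ft_multiplication_formula[OF f v])
  also have "\<dots> =
      (LINT x|lborel. (2 * pi) ^ DIM('a) * (f x * cnj (LINT w|lborel. f (x + d *\<^sub>R w) * complex_of_real (gauss w))))"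
    by (simp only: ft_v mult.left_commute)
  also have "\<dots> = (2 * pi) ^ DIM('a) * (LINT x|lborel. f x * cnj (LINT w|lborel. f (x + d *\<^sub>R w) * complex_of_real (gauss w)))"
    by (rule integral_mult_right_zero)
  finally show "complex_of_real (LINT \<xi>|lborel. (cmod (ft f \<xi>))\<^sup>2 * gauss_window (d *\<^sub>R \<xi>)) =
      (2 * pi) ^ DIM('a) * (LINT x|lborel. f x * cnj (LINT w|lborel. f (x + d *\<^sub>R w) * complex_of_real (gauss w)))" .
qed

lemma nn_integral_gauss: "(\<integral>\<^sup>+w. ennreal (gauss w) \<partial>lborel) = 1"
proof -
  have "complex_of_real (LINT w|lborel. gauss w) = 1"
    using ft_gauss[of 0] by (simp add: ft_def)
  then have "(LINT w|lborel. gauss w) = 1" by (simp only: of_real_eq_1_iff)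
  then show ?thesis
    by (subst nn_integral_eq_integral) (auto simp: integrable_gauss)
qed

lemma nn_integral_autocorrelation_le:
  fixes f :: "'a::euclidean_space \<Rightarrow> complex"
  assumes f: "f \<in> L2 lborel"
  shows "(\<integral>\<^sup>+x. ennreal (cmod (f x) * cmod (f (x + t))) \<partial>lborel) \<le> ennreal ((L2_norm lborel f)\<^sup>2)"
proof -
  have [measurable]: "f \<in> borel_measurable borel"
    using L2_measurable[OF f] by simp
  have "(\<integral>\<^sup>+x. ennreal (cmod (f x) * cmod (f (x + t))) \<partial>lborel) \<le>
      (\<integral>\<^sup>+x. ennreal ((cmod (f x))\<^sup>2 / 2) + ennreal ((cmod (f (x + t)))\<^sup>2 / 2) \<partial>lborel)"
  proof (intro nn_integral_mono)
    fix x
    have "cmod (f x) * cmod (f (x + t)) \<le> (cmod (f x))\<^sup>2 / 2 + (cmod (f (x + t)))\<^sup>2 / 2"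
      using sum_squares_bound[of "cmod (f x)" "cmod (f (x + t))"] by simp
    then show "ennreal (cmod (f x) * cmod (f (x + t))) \<le>
        ennreal ((cmod (f x))\<^sup>2 / 2) + ennreal ((cmod (f (x + t)))\<^sup>2 / 2)"
      by (simp add: ennreal_leI flip: ennreal_plus)
  qed
  also have "\<dots> = (\<integral>\<^sup>+x. ennreal ((cmod (f x))\<^sup>2 / 2) \<partial>lborel) + (\<integral>\<^sup>+x. ennreal ((cmod (f (x + t)))\<^sup>2 / 2) \<partial>lborel)"
    by (rule nn_integral_add) auto
  also have "(\<integral>\<^sup>+x. ennreal ((cmod (f (x + t)))\<^sup>2 / 2) \<partial>lborel) = (\<integral>\<^sup>+x. ennreal ((cmod (f x))\<^sup>2 / 2) \<partial>lborel)"
    by (rule nn_integral_lborel_shift) measurable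
  also have "(\<integral>\<^sup>+x. ennreal ((cmod (f x))\<^sup>2 / 2) \<partial>lborel) = ennreal ((L2_norm lborel f)\<^sup>2 / 2)"
    using f by (subst nn_integral_eq_integral) (auto simp: L2_norm_square L2_integrable)
  also have "ennreal ((L2_norm lborel f)\<^sup>2 / 2) + ennreal ((L2_norm lborel f)\<^sup>2 / 2) = ennreal ((L2_norm lborel f)\<^sup>2)"
    by (subst ennreal_plus[symmetric]) auto
  finally show ?thesis .
qed

text \<open>
  The right-hand side of the energy identity is an average of autocorrelations of \<open>f\<close>, each of which is
  at most \<open>\<parallel>f\<parallel>\<^sup>2\<close>; the bound does not depend on the width \<open>d\<close>.
\<close>

lemma gauss_weighted_energy_le:
  fixes f :: "'a::euclidean_space \<Rightarrow> complex"
  assumes f1: "integrable lborel f" and f2: "f \<in> L2 lborel" and d: "d > 0"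
  shows "(LINT \<xi>|lborel. (cmod (ft f \<xi>))\<^sup>2 * gauss_window (d *\<^sub>R \<xi>)) \<le> (2 * pi) ^ DIM('a) * (L2_norm lborel f)\<^sup>2"
proof -
  have [measurable]: "f \<in> borel_measurable borel"
    using L2_measurable[OF f2] by simp
  let ?G = "\<lambda>x. LINT w|lborel. f (x + d *\<^sub>R w) * complex_of_real (gauss w)"
  have "ennreal (cmod (LINT x|lborel. f x * cnj (?G x))) \<le> (\<integral>\<^sup>+x. ennreal (cmod (f x * cnj (?G x))) \<partial>lborel)"
  proof (cases "integrable lborel (\<lambda>x. f x * cnj (?G x))")
    case True
    then show ?thesis by (rule integral_norm_bound_ennreal)
  next
    case False
    then show ?thesis by (simp add: not_integrable_integral_eq)
  qed
  also have "\<dots> \<le> (\<integral>\<^sup>+x. \<integral>\<^sup>+w. ennreal (cmod (f x) * cmod (f (x + d *\<^sub>R w))) * ennreal (gauss w) \<partial>lborel \<partial>lborel)"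
  proof (intro nn_integral_mono)
    fix x
    have "ennreal (cmod (?G x)) \<le> (\<integral>\<^sup>+w. ennreal (cmod (f (x + d *\<^sub>R w) * complex_of_real (gauss w))) \<partial>lborel)"
    proof (cases "integrable lborel (\<lambda>w. f (x + d *\<^sub>R w) * complex_of_real (gauss w))")
      case True
      then show ?thesis by (rule integral_norm_bound_ennreal)
    next
      case False
      then show ?thesis by (simp add: not_integrable_integral_eq)
    qed
    then have "ennreal (cmod (f x)) * ennreal (cmod (?G x)) \<le>
        ennreal (cmod (f x)) * (\<integral>\<^sup>+w. ennreal (cmod (f (x + d *\<^sub>R w) * complex_of_real (gauss w))) \<partial>lborel)"
      by (rule mult_left_mono) simp
    also have "\<dots> = (\<integral>\<^sup>+w. ennreal (cmod (f x)) * ennreal (cmod (f (x + d *\<^sub>R w) * complex_of_real (gauss w))) \<partial>lborel)"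
      by (rule nn_integral_cmult[symmetric]) measurable
    finally show "ennreal (cmod (f x * cnj (?G x))) \<le>
        (\<integral>\<^sup>+w. ennreal (cmod (f x) * cmod (f (x + d *\<^sub>R w))) * ennreal (gauss w) \<partial>lborel)"
      by (simp add: norm_mult ennreal_mult mult.assoc)
  qed
  also have "\<dots> = (\<integral>\<^sup>+w. \<integral>\<^sup>+x. ennreal (cmod (f x) * cmod (f (x + d *\<^sub>R w))) * ennreal (gauss w) \<partial>lborel \<partial>lborel)"
    by (rule lborel_pair.Fubini') measurable
  also have "\<dots> \<le> (\<integral>\<^sup>+(w::'a). ennreal ((L2_norm lborel f)\<^sup>2) * ennreal (gauss w) \<partial>lborel)"
  proof (intro nn_integral_mono)
    fix w
    have "(\<integral>\<^sup>+x. ennreal (cmod (f x) * cmod (f (x + d *\<^sub>R w))) * ennreal (gauss w) \<partial>lborel) =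
        (\<integral>\<^sup>+x. ennreal (cmod (f x) * cmod (f (x + d *\<^sub>R w))) \<partial>lborel) * ennreal (gauss w)"
      by (rule nn_integral_multc) measurable
    then show "(\<integral>\<^sup>+x. ennreal (cmod (f x) * cmod (f (x + d *\<^sub>R w))) * ennreal (gauss w) \<partial>lborel) \<le>
        ennreal ((L2_norm lborel f)\<^sup>2) * ennreal (gauss w)"
      using nn_integral_autocorrelation_le[OF f2, of "d *\<^sub>R w"] by (simp add: mult_right_mono)
  qed
  also have "\<dots> = ennreal ((L2_norm lborel f)\<^sup>2)"
    by (subst nn_integral_cmult) (auto simp: nn_integral_gauss)
  finally have "cmod (LINT x|lborel. f x * cnj (?G x)) \<le> (L2_norm lborel f)\<^sup>2"
    by (simp add: ennreal_le_iff)
  then have "cmod ((2 * pi) ^ DIM('a) * (LINT x|lborel. f x * cnj (?G x))) \<le> (2 * pi) ^ DIM('a) * (L2_norm lborel f)\<^sup>2"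
    by (simp add: norm_mult norm_power mult_left_mono)
  moreover have "0 \<le> (LINT \<xi>|lborel. (cmod (ft f \<xi>))\<^sup>2 * gauss_window (d *\<^sub>R \<xi>))"
    by (intro Bochner_Integration.integral_nonneg) auto
  ultimately show ?thesis
    unfolding gauss_weighted_energy(2)[OF f1 d, symmetric] norm_of_real by linarith
qed

lemma gauss_window_tendsto:
  "(\<lambda>n. gauss_window ((1 / real (Suc n)) *\<^sub>R \<xi>)) \<longlonglongrightarrow> 1"
proof -
  have "(\<lambda>n. gauss_window ((1 / real (Suc n)) *\<^sub>R \<xi>)) \<longlonglongrightarrow> exp (- (norm (0 *\<^sub>R \<xi>))\<^sup>2 / 2)"
    unfolding gauss_window_def by (intro tendsto_intros LIMSEQ_Suc[OF lim_1_over_n]) auto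
  then show ?thesis by simp
qed

text \<open>
  Fatou's lemma for the windows \<open>gauss_window (\<xi> / (n + 1))\<close>, which tend to one.
\<close>

lemma ft_Bessel:
  fixes f :: "'a::euclidean_space \<Rightarrow> complex"
  assumes f1: "integrable lborel f" and f2: "f \<in> L2 lborel"
  shows "ft f \<in> L2 lborel" and "L2_norm lborel (ft f) \<le> sqrt ((2 * pi) ^ DIM('a)) * L2_norm lborel f"
proof -
  have [measurable]: "f \<in> borel_measurable borel"
    using L2_measurable[OF f2] by simp
  let ?K = "(2 * pi) ^ DIM('a) * (L2_norm lborel f)\<^sup>2"
  let ?e = "\<lambda>n \<xi>. ennreal ((cmod (ft f \<xi>))\<^sup>2 * gauss_window ((1 / real (Suc n)) *\<^sub>R \<xi>))"
  have "(\<integral>\<^sup>+\<xi>. ennreal ((cmod (ft f \<xi>))\<^sup>2) \<partial>lborel) = (\<integral>\<^sup>+\<xi>. liminf (\<lambda>n. ?e n \<xi>) \<partial>lborel)"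
  proof (intro nn_integral_cong)
    fix \<xi>
    have "(\<lambda>n. ?e n \<xi>) \<longlonglongrightarrow> ennreal ((cmod (ft f \<xi>))\<^sup>2 * 1)"
      by (intro tendsto_ennrealI tendsto_mult gauss_window_tendsto tendsto_const)
    then show "ennreal ((cmod (ft f \<xi>))\<^sup>2) = liminf (\<lambda>n. ?e n \<xi>)"
      using lim_imp_Liminf[OF sequentially_bot] by fastforce
  qed
  also have "\<dots> \<le> liminf (\<lambda>n. \<integral>\<^sup>+\<xi>. ?e n \<xi> \<partial>lborel)"
    by (rule nn_integral_liminf) measurable
  also have "\<dots> \<le> liminf (\<lambda>n::nat. ennreal ?K)"
  proof (intro Liminf_mono always_eventually allI)
    fix n
    have "(\<integral>\<^sup>+\<xi>. ?e n \<xi> \<partial>lborel) = ennreal (LINT \<xi>|lborel. (cmod (ft f \<xi>))\<^sup>2 * gauss_window ((1 / real (Suc n)) *\<^sub>R \<xi>))"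
      by (intro nn_integral_eq_integral gauss_weighted_energy(1) f1) auto
    also have "\<dots> \<le> ennreal ?K"
      by (intro ennreal_leI gauss_weighted_energy_le f1 f2) auto
    finally show "(\<integral>\<^sup>+\<xi>. ?e n \<xi> \<partial>lborel) \<le> ennreal ?K" .
  qed
  also have "\<dots> = ennreal ?K" by (simp add: Liminf_const)
  finally have le: "(\<integral>\<^sup>+\<xi>. ennreal ((cmod (ft f \<xi>))\<^sup>2) \<partial>lborel) \<le> ennreal ?K" .
  then show mem: "ft f \<in> L2 lborel"
    unfolding L2_def by (auto simp: integrable_iff_bounded intro: le_less_trans)
  have "(L2_norm lborel (ft f))\<^sup>2 \<le> (sqrt ((2 * pi) ^ DIM('a)) * L2_norm lborel f)\<^sup>2"
    using le mem by (simp add: ennreal_L2_norm_square power_mult_distrib)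
  then show "L2_norm lborel (ft f) \<le> sqrt ((2 * pi) ^ DIM('a)) * L2_norm lborel f"
    by (rule power2_le_imp_le) simp
qed

section \<open>The Plancherel identity\<close>

lemma L2_norm_tendsto_0_dominated:
  assumes [measurable]: "\<And>n. s n \<in> borel_measurable M" "f \<in> borel_measurable M"
    and lim: "AE x in M. (\<lambda>n. s n x) \<longlonglongrightarrow> f x"
    and w: "integrable M w" and dom: "\<And>n. AE x in M. (cmod (s n x - f x))\<^sup>2 \<le> w x"
  shows "(\<lambda>n. L2_norm M (\<lambda>x. s n x - f x)) \<longlonglongrightarrow> 0"
proof -
  have "(\<lambda>n. LINT x|M. (cmod (s n x - f x))\<^sup>2) \<longlonglongrightarrow> (LINT x|M. 0)"
  proof (rule integral_dominated_convergence[where w=w])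
    show "AE x in M. (\<lambda>n. (cmod (s n x - f x))\<^sup>2) \<longlonglongrightarrow> 0"
      using lim
    proof eventually_elim
      case (elim x)
      then have "(\<lambda>n. (cmod (s n x - f x))\<^sup>2) \<longlonglongrightarrow> (cmod (f x - f x))\<^sup>2"
        by (intro tendsto_intros)
      then show ?case by simp
    qed
  qed (use w dom in auto)
  then have "(\<lambda>n. sqrt (LINT x|M. (cmod (s n x - f x))\<^sup>2)) \<longlonglongrightarrow> sqrt 0"
    by (intro tendsto_real_sqrt) simp
  then show ?thesis by (simp add: L2_norm_def)
qed

lemma bounded_integrable_in_L2:
  assumes f: "integrable M f" and B: "\<And>x. cmod (f x) \<le> B"
  shows "f \<in> L2 M"
proof (rule L2_bounded_by)
  show "integrable M (\<lambda>x. B * cmod (f x))"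
    using f by auto
  show "AE x in M. (cmod (f x))\<^sup>2 \<le> B * cmod (f x)"
    unfolding power2_eq_square by (intro AE_I2 mult_right_mono B norm_ge_zero)
qed (use f in auto)

text \<open>
  For bounded continuous \<open>f\<close> both sides of the energy identity converge as the width tends to zero: the
  Gaussian averages of \<open>f\<close> tend to \<open>f\<close> pointwise by continuity, dominated by the bound of \<open>f\<close>, and
  the energy of \<open>ft f\<close> is dominated because of the Bessel inequality.
\<close>

lemma Plancherel_continuous:
  fixes f :: "'a::euclidean_space \<Rightarrow> complex"
  assumes f: "integrable lborel f" and cont: "continuous_on UNIV f" and B: "\<And>x. cmod (f x) \<le> B"
  shows "L2_norm lborel (ft f) = sqrt ((2 * pi) ^ DIM('a)) * L2_norm lborel f"
proof -
  have [measurable]: "f \<in> borel_measurable borel"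
    using f by (auto dest: borel_measurable_integrable)
  have B0: "0 \<le> B" using B[of 0] norm_ge_zero order_trans by blast
  have fL2: "f \<in> L2 lborel"
    using f B by (rule bounded_integrable_in_L2)
  have ftL2: "ft f \<in> L2 lborel"
    by (rule ft_Bessel[OF f fL2])
  have g1: "(LINT w|lborel. gauss (w::'a)) = 1"
    using ft_gauss[of "0::'a"] by (simp add: ft_def)
  define G where "G n x = (LINT w|lborel. f (x + (1 / real (Suc n)) *\<^sub>R w) * complex_of_real (gauss w))" for n x
  have [measurable]: "G n \<in> borel_measurable borel" for n
    unfolding G_def by measurable
  have Glim: "(\<lambda>n. G n x) \<longlonglongrightarrow> f x" for x
  proof -
    have "(\<lambda>n. LINT w|lborel. f (x + (1 / real (Suc n)) *\<^sub>R w) * complex_of_real (gauss w)) \<longlonglongrightarrow>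
        (LINT w|lborel. f x * complex_of_real (gauss (w::'a)))"
    proof (rule integral_dominated_convergence[where w="\<lambda>w. B * gauss w"])
      show "AE w in lborel. (\<lambda>n. f (x + (1 / real (Suc n)) *\<^sub>R w) * complex_of_real (gauss w))
          \<longlonglongrightarrow> f x * complex_of_real (gauss w)"
      proof (intro AE_I2 tendsto_mult tendsto_const)
        fix w
        have "(\<lambda>n. x + (1 / real (Suc n)) *\<^sub>R w) \<longlonglongrightarrow> x + 0 *\<^sub>R w"
          by (intro tendsto_intros LIMSEQ_Suc[OF lim_1_over_n])
        then show "(\<lambda>n. f (x + (1 / real (Suc n)) *\<^sub>R w)) \<longlonglongrightarrow> f x"
          using continuous_on_tendsto_compose[OF cont] by simp
      qed
      show "AE w in lborel. norm (f (x + (1 / real (Suc n)) *\<^sub>R w) * complex_of_real (gauss w)) \<le> B * gauss w" for n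
        using B by (auto simp: norm_mult intro!: mult_right_mono)
    qed (auto simp: integrable_gauss)
    then show ?thesis by (simp add: G_def g1)
  qed
  have Gbd: "cmod (G n x) \<le> B" for n x
  proof -
    have "cmod (G n x) \<le> (LINT w|lborel. B * gauss (w::'a))"
      unfolding G_def
    proof (rule Bochner_Integration.integral_norm_bound_integral)
      show "integrable lborel (\<lambda>w. f (x + (1 / real (Suc n)) *\<^sub>R w) * complex_of_real (gauss w))"
        using B B0
        by (intro Bochner_Integration.integrable_bound[OF integrable_mult_right[OF integrable_gauss, of B]])
           (auto simp: norm_mult abs_mult intro!: mult_right_mono)
    qed (use B integrable_gauss in \<open>auto simp: norm_mult intro!: mult_right_mono\<close>)
    also have "(LINT w|lborel. B * gauss (w::'a)) = B"
      using g1 by simp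
    finally show ?thesis .
  qed
  have "(\<lambda>n. LINT x|lborel. f x * cnj (G n x)) \<longlonglongrightarrow> (LINT x|lborel. f x * cnj (f x))"
  proof (rule integral_dominated_convergence[where w="\<lambda>x. B * cmod (f x)"])
    show "AE x in lborel. (\<lambda>n. f x * cnj (G n x)) \<longlonglongrightarrow> f x * cnj (f x)"
      by (intro AE_I2 tendsto_intros Glim)
    show "AE x in lborel. norm (f x * cnj (G n x)) \<le> B * cmod (f x)" for n
      using mult_right_mono[OF Gbd, of "cmod (f x)" n x for x] by (auto simp: norm_mult mult.commute)
  qed (use f in auto)
  also have "(LINT x|lborel. f x * cnj (f x)) = complex_of_real ((L2_norm lborel f)\<^sup>2)"
    using L2_inner_self[of lborel f] by (simp only: L2_inner_def)
  finally have "(\<lambda>n. (2 * pi) ^ DIM('a) * (LINT x|lborel. f x * cnj (G n x))) \<longlonglongrightarrow>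
      (2 * pi) ^ DIM('a) * complex_of_real ((L2_norm lborel f)\<^sup>2)"
    by (intro tendsto_mult tendsto_const)
  moreover have "(\<lambda>n. (2 * pi) ^ DIM('a) * (LINT x|lborel. f x * cnj (G n x))) =
      (\<lambda>n. complex_of_real (LINT \<xi>|lborel. (cmod (ft f \<xi>))\<^sup>2 * gauss_window ((1 / real (Suc n)) *\<^sub>R \<xi>)))"
    unfolding G_def by (intro ext gauss_weighted_energy(2)[symmetric, OF f]) simp
  ultimately have "(\<lambda>n. complex_of_real (LINT \<xi>|lborel. (cmod (ft f \<xi>))\<^sup>2 * gauss_window ((1 / real (Suc n)) *\<^sub>R \<xi>))) \<longlonglongrightarrow>
      complex_of_real ((2 * pi) ^ DIM('a) * (L2_norm lborel f)\<^sup>2)"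
    by (simp only: of_real_mult[of "(2 * pi) ^ DIM('a)" "(L2_norm lborel f)\<^sup>2"])
  then have lim1: "(\<lambda>n. LINT \<xi>|lborel. (cmod (ft f \<xi>))\<^sup>2 * gauss_window ((1 / real (Suc n)) *\<^sub>R \<xi>)) \<longlonglongrightarrow>
      (2 * pi) ^ DIM('a) * (L2_norm lborel f)\<^sup>2"
    by (simp only: tendsto_of_real_iff)
  have lim2: "(\<lambda>n. LINT \<xi>|lborel. (cmod (ft f \<xi>))\<^sup>2 * gauss_window ((1 / real (Suc n)) *\<^sub>R \<xi>)) \<longlonglongrightarrow>
      (LINT \<xi>|lborel. (cmod (ft f \<xi>))\<^sup>2)"
  proof (rule integral_dominated_convergence[where w="\<lambda>\<xi>. (cmod (ft f \<xi>))\<^sup>2"])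
    show "AE \<xi> in lborel. (\<lambda>n. (cmod (ft f \<xi>))\<^sup>2 * gauss_window ((1 / real (Suc n)) *\<^sub>R \<xi>)) \<longlonglongrightarrow> (cmod (ft f \<xi>))\<^sup>2"
      using tendsto_mult[OF tendsto_const gauss_window_tendsto] by (intro AE_I2) simp
    have "gauss_window x \<le> 1" for x :: 'a by (simp add: gauss_window_def)
    then show "AE \<xi> in lborel. norm ((cmod (ft f \<xi>))\<^sup>2 * gauss_window ((1 / real (Suc n)) *\<^sub>R \<xi>)) \<le> (cmod (ft f \<xi>))\<^sup>2" for n
      by (auto simp: abs_mult intro!: mult_left_le)
  qed (use ftL2 in \<open>auto dest: L2_integrable\<close>)
  have "(L2_norm lborel (ft f))\<^sup>2 = (sqrt ((2 * pi) ^ DIM('a)) * L2_norm lborel f)\<^sup>2"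
    using LIMSEQ_unique[OF lim1 lim2] by (simp add: L2_norm_square power_mult_distrib)
  then show ?thesis
    by (rule power2_eq_imp_eq) auto
qed

text \<open>
  A measurable function is almost everywhere a limit of continuous functions; truncating these in value
  and cutting them off outside the ball of radius \<open>R + 1\<close> makes dominated convergence applicable.
\<close>

lemma bounded_compact_support_approx:
  fixes f :: "'a::euclidean_space \<Rightarrow> complex"
  assumes [measurable]: "f \<in> borel_measurable borel"
    and k: "k > 0" "\<And>x. cmod (f x) \<le> k" and R: "\<And>x. norm x > R \<Longrightarrow> f x = 0" and e: "e > 0"
  shows "\<exists>h. continuous_on UNIV h \<and> (\<forall>x. cmod (h x) \<le> k) \<and> integrable lborel h \<and>
    L2_norm lborel (\<lambda>x. h x - f x) < e"
proof -
  have "f \<in> borel_measurable lebesgue"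
    by (rule measurable_completion) simp
  then have "f measurable_on UNIV"
    by (intro lebesgue_measurable_imp_measurable_on) auto
  then obtain N g where N: "negligible N" and g: "\<And>n. continuous_on UNIV (g n)"
      and glim: "\<And>x. x \<notin> N \<Longrightarrow> (\<lambda>n. g n x) \<longlonglongrightarrow> f x"
    by (auto simp: measurable_on_def)
  have "AE x in lebesgue. x \<notin> N"
    using N by (intro AE_not_in) (simp add: negligible_iff_null_sets)
  then have AE_N: "AE x in lborel. x \<notin> N"
    by (simp add: AE_completion_iff)
  \<comment> \<open>Radial retraction to the disc of radius \<open>k\<close>, and a cut-off that is one on the ball of radius \<open>R\<close>.\<close>
  define trunc where "trunc z = complex_of_real (k / max k (cmod z)) * z" for z
  define cut where "cut x = max 0 (min 1 (R + 1 - norm (x::'a)))" for x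
  define h where "h n x = complex_of_real (cut x) * trunc (g n x)" for n x
  have maxk: "max k (cmod z) > 0" for z using k by auto
  have trunc_cont: "continuous_on UNIV trunc"
    unfolding trunc_def using maxk
    by (intro continuous_intros) (auto simp: less_imp_neq[symmetric] dest: less_imp_neq)
  have trunc_le: "cmod (trunc z) \<le> k" for z
  proof -
    have "cmod (trunc z) = k * (cmod z / max k (cmod z))"
      using k(1) maxk[of z] unfolding trunc_def norm_mult norm_of_real by simp
    also have "\<dots> \<le> k * 1"
      using k maxk[of z] by (intro mult_left_mono) (auto simp: divide_le_eq)
    finally show ?thesis by simp
  qed
  have trunc_id: "trunc z = z" if "cmod z \<le> k" for z
    using that k by (simp add: trunc_def max_absorb1)
  have cut01: "0 \<le> cut x" "cut x \<le> 1" for x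
    by (auto simp: cut_def)
  have h_cont: "continuous_on UNIV (h n)" for n
    unfolding h_def cut_def
    by (intro continuous_intros continuous_on_compose2[OF trunc_cont g]) auto
  have [measurable]: "h n \<in> borel_measurable borel" for n
    by (rule borel_measurable_continuous_onI[OF h_cont])
  have h_le: "cmod (h n x) \<le> k * indicator (cball 0 (R + 1)) x" for n x
  proof (cases "norm x \<le> R + 1")
    case True
    then show ?thesis
      using cut01[of x] trunc_le[of "g n x"] k mult_mono[of "cut x" 1 "cmod (trunc (g n x))" k]
      by (simp add: h_def norm_mult indicator_def)
  next
    case False
    then show ?thesis by (simp add: h_def cut_def indicator_def)
  qed
  have f_le: "cmod (f x) \<le> k * indicator (cball 0 (R + 1)) x" for x
    using k R[of x] by (auto simp: indicator_def)
  have ball: "integrable lborel (\<lambda>x::'a. c * indicator (cball 0 (R + 1)) x :: real)" for c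
    by (intro integrable_mult_right integrable_real_indicator emeasure_bounded_finite) auto
  have lim: "(\<lambda>n. L2_norm lborel (\<lambda>x. h n x - f x)) \<longlonglongrightarrow> 0"
  proof (rule L2_norm_tendsto_0_dominated)
    show "AE x in lborel. (\<lambda>n. h n x) \<longlonglongrightarrow> f x"
      using AE_N
    proof eventually_elim
      case (elim x)
      have "(\<lambda>n. h n x) \<longlonglongrightarrow> complex_of_real (cut x) * trunc (f x)"
        unfolding h_def
        by (intro tendsto_intros continuous_on_tendsto_compose[OF trunc_cont] glim elim) auto
      also have "complex_of_real (cut x) * trunc (f x) = f x"
        using R[of x] k(1) trunc_id[OF k(2)] by (cases "norm x > R") (auto simp: cut_def trunc_def)
      finally show ?case .
    qed
    show "integrable lborel (\<lambda>x::'a. (2 * k)\<^sup>2 * indicator (cball 0 (R + 1)) x :: real)"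
      by (rule ball)
    show "AE x in lborel. (cmod (h n x - f x))\<^sup>2 \<le> (2 * k)\<^sup>2 * indicator (cball 0 (R + 1)) x" for n
    proof (intro AE_I2)
      fix x
      have "cmod (h n x - f x) \<le> 2 * k * indicator (cball 0 (R + 1)) x"
        using norm_triangle_ineq4[of "h n x" "f x"] h_le[of n x] f_le[of x] by linarith
      then have "(cmod (h n x - f x))\<^sup>2 \<le> (2 * k * indicator (cball 0 (R + 1)) x)\<^sup>2"
        by (rule power_mono) simp
      then show "(cmod (h n x - f x))\<^sup>2 \<le> (2 * k)\<^sup>2 * indicator (cball 0 (R + 1)) x"
        by (auto simp: indicator_def split: if_splits)
    qed
  qed auto
  obtain n where n: "L2_norm lborel (\<lambda>x. h n x - f x) < e"
    using LIMSEQ_D[OF lim e] by auto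
  have "integrable lborel (h n)"
    using h_le[of n] by (intro Bochner_Integration.integrable_bound[OF ball[of k]]) (auto intro: order_trans[OF _ abs_ge_self])
  moreover have "cmod (h n x) \<le> k" for x
    using h_le[of n x] k(1) by (cases "x \<in> cball 0 (R + 1)") auto
  ultimately show ?thesis
    using h_cont n by (intro exI[of _ "h n"]) auto
qed

lemma L2_dense_continuous:
  fixes f :: "'a::euclidean_space \<Rightarrow> complex"
  assumes f: "f \<in> L2 lborel" and e: "e > 0"
  shows "\<exists>h B. continuous_on UNIV h \<and> (\<forall>x. cmod (h x) \<le> B) \<and> integrable lborel h \<and>
    L2_norm lborel (\<lambda>x. h x - f x) < e"
proof -
  have [measurable]: "f \<in> borel_measurable borel"
    using L2_measurable[OF f] by simp
  define s where "s n x = (if cmod (f x) \<le> real n \<and> norm x \<le> real n then f x else 0)" for n :: nat and x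
  have [measurable]: "s n \<in> borel_measurable borel" for n
    unfolding s_def by measurable
  have s_le: "cmod (s n x) \<le> real n" for n x
    by (simp add: s_def)
  have "(\<lambda>n. L2_norm lborel (\<lambda>x. s n x - f x)) \<longlonglongrightarrow> 0"
  proof (rule L2_norm_tendsto_0_dominated)
    show "AE x in lborel. (\<lambda>n. s n x) \<longlonglongrightarrow> f x"
    proof (intro AE_I2 tendsto_eventually)
      fix x
      obtain m :: nat where "max (cmod (f x)) (norm x) \<le> real m"
        using real_arch_simple by blast
      then show "\<forall>\<^sub>F n in sequentially. s n x = f x"
        by (intro eventually_mono[OF eventually_ge_at_top[of m]]) (simp add: s_def)
    qed
    show "AE x in lborel. (cmod (s n x - f x))\<^sup>2 \<le> (cmod (f x))\<^sup>2" for n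
      by (auto simp: s_def)
  qed (use f in \<open>auto dest: L2_integrable\<close>)
  then obtain n0 where n0: "\<And>n. n \<ge> n0 \<Longrightarrow> L2_norm lborel (\<lambda>x. s n x - f x) < e / 2"
    using LIMSEQ_D[of "\<lambda>n. L2_norm lborel (\<lambda>x. s n x - f x)" 0 "e / 2"] e by auto
  \<comment> \<open>The successor makes the bound \<open>n\<close> positive.\<close>
  define n where "n = Suc n0"
  have "\<exists>h. continuous_on UNIV h \<and> (\<forall>x. cmod (h x) \<le> real n) \<and> integrable lborel h \<and>
      L2_norm lborel (\<lambda>x. h x - s n x) < e / 2"
  proof (rule bounded_compact_support_approx[where R="real n"])
    show "s n x = 0" if "norm x > real n" for x
      using that by (simp add: s_def)
  qed (use s_le e in \<open>simp_all add: n_def del: of_nat_Suc\<close>)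
  then obtain h where h: "continuous_on UNIV h" "\<forall>x. cmod (h x) \<le> real n" "integrable lborel h"
      "L2_norm lborel (\<lambda>x. h x - s n x) < e / 2"
    by blast
  have sL2: "s n \<in> L2 lborel"
    by (rule L2_mono_norm(1)[OF f]) (auto simp: s_def)
  have hL2: "h \<in> L2 lborel"
    using h by (intro bounded_integrable_in_L2) auto
  have "L2_norm lborel (\<lambda>x. h x - f x) < e"
    using L2_norm_diff_triangle[OF hL2 sL2 f] h(4) n0[of n] by (simp add: n_def)
  with h show ?thesis by (intro exI[of _ h] exI[of _ "real n"]) auto
qed

lemma L2_approx_by_L1:
  fixes f :: "'a::euclidean_space \<Rightarrow> complex"
  assumes "f \<in> L2 lborel"
  obtains s B where "\<And>n :: nat. integrable lborel (s n)" "\<And>n. s n \<in> L2 lborel"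
    "\<And>n. continuous_on UNIV (s n)" "\<And>n x. cmod (s n x) \<le> B n"
    "(\<lambda>n. L2_norm lborel (\<lambda>x. s n x - f x)) \<longlonglongrightarrow> 0"
proof -
  have "\<forall>n. \<exists>h B. continuous_on UNIV h \<and> (\<forall>x. cmod (h x) \<le> B) \<and> integrable lborel h \<and>
      L2_norm lborel (\<lambda>x. h x - f x) < 1 / real (Suc n)"
    using L2_dense_continuous[OF assms] by simp
  then obtain s B where s: "\<And>n. continuous_on UNIV (s n)" "\<And>n x. cmod (s n x) \<le> B n"
      "\<And>n. integrable lborel (s n)" "\<And>n. L2_norm lborel (\<lambda>x. s n x - f x) < 1 / real (Suc n)"
    by metis
  have "(\<lambda>n. L2_norm lborel (\<lambda>x. s n x - f x)) \<longlonglongrightarrow> 0"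
    by (rule tendsto_sandwich[OF _ _ tendsto_const LIMSEQ_Suc[OF lim_1_over_n]])
       (use s(4) in \<open>auto intro!: always_eventually less_imp_le\<close>)
  moreover have "s n \<in> L2 lborel" for n
    using s by (intro bounded_integrable_in_L2)
  ultimately show ?thesis using s that by blast
qed

text \<open>
  Both sides are continuous in \<open>f\<close> with respect to the norm, the left one by the Bessel inequality, and
  agree on a dense set.
\<close>

theorem Plancherel:
  fixes f :: "'a::euclidean_space \<Rightarrow> complex"
  assumes f1: "integrable lborel f" and f2: "f \<in> L2 lborel"
  shows "L2_norm lborel (ft f) = sqrt ((2 * pi) ^ DIM('a)) * L2_norm lborel f"
proof -
  let ?K = "sqrt ((2 * pi) ^ DIM('a))"
  obtain s B where s: "\<And>n :: nat. integrable lborel (s n)" "\<And>n. s n \<in> L2 lborel"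
      "\<And>n. continuous_on UNIV (s n)" "\<And>n x. cmod (s n x) \<le> B n"
      and lim: "(\<lambda>n. L2_norm lborel (\<lambda>x. s n x - f x)) \<longlonglongrightarrow> 0"
    using L2_approx_by_L1[OF f2] by blast
  have le: "L2_norm lborel (\<lambda>\<xi>. ft (s n) \<xi> - ft f \<xi>) \<le> ?K * L2_norm lborel (\<lambda>x. s n x - f x)" for n
    using ft_Bessel(2)[OF Bochner_Integration.integrable_diff[OF s(1) f1] L2_diff[OF s(2) f2], of n]
    by (simp add: ft_diff[OF s(1) f1, abs_def])
  have "(\<lambda>n. ?K * L2_norm lborel (\<lambda>x. s n x - f x)) \<longlonglongrightarrow> 0"
    using tendsto_mult[OF tendsto_const lim, of ?K] by simp
  then have "(\<lambda>n. L2_norm lborel (\<lambda>\<xi>. ft (s n) \<xi> - ft f \<xi>)) \<longlonglongrightarrow> 0"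
    by (rule tendsto_sandwich[OF _ _ tendsto_const, rotated 2])
       (use le in \<open>auto intro!: always_eventually simp del: power_mult_distrib\<close>)
  then have "(\<lambda>n. L2_norm lborel (ft (s n))) \<longlonglongrightarrow> L2_norm lborel (ft f)"
    by (intro L2_norm_tendsto ft_Bessel s f1 f2)
  moreover have "(\<lambda>n. L2_norm lborel (ft (s n))) = (\<lambda>n. ?K * L2_norm lborel (s n))"
    by (intro ext Plancherel_continuous[OF s(1,3,4)])
  moreover have "(\<lambda>n. ?K * L2_norm lborel (s n)) \<longlonglongrightarrow> ?K * L2_norm lborel f"
    by (intro tendsto_intros L2_norm_tendsto s f2 lim)
  ultimately show ?thesis
    using LIMSEQ_unique by metis
qed

section \<open>The Fourier transform of square-integrable functions\<close>

lemma ft_add: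
  assumes "integrable lborel f" "integrable lborel g"
  shows "ft (\<lambda>x. f x + g x) \<xi> = ft f \<xi> + ft g \<xi>"
  using assms by (simp add: ft_def distrib_right integrable_ft_integrand)

lemma ft_scale: "ft (\<lambda>x. c * f x) \<xi> = c * ft f \<xi>"
  by (simp add: ft_def mult.assoc)

text \<open>
  The Fourier transform on the space of square-integrable functions, as a relation: its second argument
  is determined by the first only up to null sets. With a relation, linearity and the affine rule become
  closure properties, and no representative has to be chosen.
\<close>

definition fourier_pair :: "('a::euclidean_space \<Rightarrow> complex) \<Rightarrow> ('a \<Rightarrow> complex) \<Rightarrow> bool" where
  "fourier_pair f g \<longleftrightarrow> f \<in> L2 lborel \<and> g \<in> L2 lborel \<and>
    (\<exists>s. (\<forall>n. integrable lborel (s n) \<and> s n \<in> L2 lborel) \<and>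
       (\<lambda>n. L2_norm lborel (\<lambda>x. s n x - f x)) \<longlonglongrightarrow> 0 \<and>
       (\<lambda>n. L2_norm lborel (\<lambda>\<xi>. ft (s n) \<xi> - g \<xi>)) \<longlonglongrightarrow> 0)"

lemma L2_norm_sum_tendsto_0:
  assumes "\<And>n. s n \<in> L2 M" "\<And>n. t n \<in> L2 M" "(\<lambda>n. L2_norm M (s n)) \<longlonglongrightarrow> 0" "(\<lambda>n. L2_norm M (t n)) \<longlonglongrightarrow> 0"
  shows "(\<lambda>n. L2_norm M (\<lambda>x. s n x + t n x)) \<longlonglongrightarrow> 0"
proof (rule tendsto_sandwich[OF _ _ tendsto_const])
  show "(\<lambda>n. L2_norm M (s n) + L2_norm M (t n)) \<longlonglongrightarrow> 0"
    using tendsto_add[OF assms(3,4)] by simp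
qed (use assms(1,2) in \<open>auto intro!: always_eventually L2_norm_triangle\<close>)

lemma L2_limit_unique:
  assumes s: "\<And>n. s n \<in> L2 M" and f: "f \<in> L2 M" and g: "g \<in> L2 M"
    and "(\<lambda>n. L2_norm M (\<lambda>x. s n x - f x)) \<longlonglongrightarrow> 0" "(\<lambda>n. L2_norm M (\<lambda>x. s n x - g x)) \<longlonglongrightarrow> 0"
  shows "AE x in M. f x = g x"
proof -
  have "(\<lambda>n. L2_norm M (\<lambda>x. (f x - s n x) + (s n x - g x))) \<longlonglongrightarrow> 0"
    using assms by (intro L2_norm_sum_tendsto_0 L2_diff) (simp_all add: L2_norm_minus_commute[of M f])
  then have "L2_norm M (\<lambda>x. f x - g x) = 0"
    by (simp add: LIMSEQ_const_iff)
  then show ?thesis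
    using L2_norm_eq_0_iff[OF L2_diff[OF f g]] by simp
qed

lemma L2_norm_ft_diff:
  fixes s t :: "'a::euclidean_space \<Rightarrow> complex"
  assumes "integrable lborel s" "s \<in> L2 lborel" "integrable lborel t" "t \<in> L2 lborel"
  shows "L2_norm lborel (\<lambda>\<xi>. ft s \<xi> - ft t \<xi>) = sqrt ((2 * pi) ^ DIM('a)) * L2_norm lborel (\<lambda>x. s x - t x)"
  using Plancherel[OF Bochner_Integration.integrable_diff[OF assms(1,3)] L2_diff[OF assms(2,4)]]
  by (simp add: ft_diff[OF assms(1,3), abs_def])

lemma fourier_pair_exists:
  fixes f :: "'a::euclidean_space \<Rightarrow> complex"
  assumes f: "f \<in> L2 lborel"
  shows "\<exists>g. fourier_pair f g"
proof -
  let ?K = "sqrt ((2 * pi) ^ DIM('a))"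
  have K: "?K > 0" by simp
  obtain s B where s: "\<And>n :: nat. integrable lborel (s n)" "\<And>n. s n \<in> L2 lborel"
      "\<And>n. continuous_on UNIV (s n)" "\<And>n x. cmod (s n x) \<le> B n"
      and lim: "(\<lambda>n. L2_norm lborel (\<lambda>x. s n x - f x)) \<longlonglongrightarrow> 0"
    using L2_approx_by_L1[OF f] by blast
  have ftL2: "ft (s n) \<in> L2 lborel" for n by (rule ft_Bessel[OF s(1,2)])
  have "\<exists>g\<in>L2 lborel. (\<lambda>n. L2_norm lborel (\<lambda>x. ft (s n) x - g x)) \<longlonglongrightarrow> 0"
  proof (rule L2_complete[OF ftL2])
    fix e :: real assume e: "e > 0"
    then have "e / ?K / 2 > 0" using K by simp
    then obtain N where N: "\<And>n. n \<ge> N \<Longrightarrow> L2_norm lborel (\<lambda>x. s n x - f x) < e / ?K / 2"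
      using LIMSEQ_D[OF lim] by fastforce
    have "L2_norm lborel (\<lambda>x. ft (s m) x - ft (s n) x) < e" if "m \<ge> N" "n \<ge> N" for m n
    proof -
      have "L2_norm lborel (\<lambda>x. s m x - s n x) < e / ?K"
        using L2_norm_diff_triangle[OF s(2) f s(2), of m n] L2_norm_minus_commute[of lborel f "s n"]
          N[OF that(1)] N[OF that(2)] by simp
      then show ?thesis
        unfolding L2_norm_ft_diff[OF s(1,2) s(1,2)] using K by (simp only: pos_less_divide_eq mult.commute)
    qed
    then show "\<exists>K. \<forall>m\<ge>K. \<forall>n\<ge>K. L2_norm lborel (\<lambda>x. ft (s m) x - ft (s n) x) < e" by blast
  qed
  then obtain g where "g \<in> L2 lborel" "(\<lambda>n. L2_norm lborel (\<lambda>x. ft (s n) x - g x)) \<longlonglongrightarrow> 0"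
    by blast
  then show ?thesis
    unfolding fourier_pair_def using f s lim by (intro exI[of _ g] conjI exI[of _ s]) auto
qed

lemma fourier_pair_L2:
  assumes "fourier_pair f g"
  shows "f \<in> L2 lborel" "g \<in> L2 lborel"
  using assms by (auto simp: fourier_pair_def)

lemma fourier_pair_norm:
  fixes f g :: "'a::euclidean_space \<Rightarrow> complex"
  assumes "fourier_pair f g"
  shows "L2_norm lborel g = sqrt ((2 * pi) ^ DIM('a)) * L2_norm lborel f"
proof -
  let ?K = "sqrt ((2 * pi) ^ DIM('a))"
  obtain s where s: "\<And>n. integrable lborel (s n)" "\<And>n. s n \<in> L2 lborel"
      "(\<lambda>n. L2_norm lborel (\<lambda>x. s n x - f x)) \<longlonglongrightarrow> 0"
      "(\<lambda>n. L2_norm lborel (\<lambda>\<xi>. ft (s n) \<xi> - g \<xi>)) \<longlonglongrightarrow> 0"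
    using assms by (auto simp: fourier_pair_def)
  note fg = fourier_pair_L2[OF assms]
  have "(\<lambda>n. L2_norm lborel (ft (s n))) \<longlonglongrightarrow> L2_norm lborel g"
    by (intro L2_norm_tendsto ft_Bessel s fg)
  moreover have "(\<lambda>n. L2_norm lborel (ft (s n))) = (\<lambda>n. ?K * L2_norm lborel (s n))"
    by (intro ext Plancherel s)
  moreover have "(\<lambda>n. ?K * L2_norm lborel (s n)) \<longlonglongrightarrow> ?K * L2_norm lborel f"
    by (intro tendsto_intros L2_norm_tendsto s fg)
  ultimately show ?thesis using LIMSEQ_unique by metis
qed

text \<open>
  The approximating sequence in the definition may be replaced by any other one, because two such
  sequences have Fourier integrals that approach each other by Plancherel.
\<close>

lemma fourier_pair_ft_tendsto:
  fixes f g :: "'a::euclidean_space \<Rightarrow> complex"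
  assumes fg: "fourier_pair f g"
    and t: "\<And>n. integrable lborel (t n)" "\<And>n. t n \<in> L2 lborel"
    and lim: "(\<lambda>n. L2_norm lborel (\<lambda>x. t n x - f x)) \<longlonglongrightarrow> 0"
  shows "(\<lambda>n. L2_norm lborel (\<lambda>\<xi>. ft (t n) \<xi> - g \<xi>)) \<longlonglongrightarrow> 0"
proof -
  let ?K = "sqrt ((2 * pi) ^ DIM('a))"
  obtain s where s: "\<And>n. integrable lborel (s n)" "\<And>n. s n \<in> L2 lborel"
      "(\<lambda>n. L2_norm lborel (\<lambda>x. s n x - f x)) \<longlonglongrightarrow> 0"
      "(\<lambda>n. L2_norm lborel (\<lambda>\<xi>. ft (s n) \<xi> - g \<xi>)) \<longlonglongrightarrow> 0"
    using fg by (auto simp: fourier_pair_def)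
  note fgL2 = fourier_pair_L2[OF fg]
  have "(\<lambda>n. L2_norm lborel (\<lambda>x. (t n x - f x) + (f x - s n x))) \<longlonglongrightarrow> 0"
    using s(3) by (intro L2_norm_sum_tendsto_0 L2_diff t s fgL2 lim) (simp add: L2_norm_minus_commute[of lborel f])
  then have "(\<lambda>n. ?K * L2_norm lborel (\<lambda>x. t n x - s n x)) \<longlonglongrightarrow> ?K * 0"
    by (intro tendsto_mult tendsto_const) simp
  then have "(\<lambda>n. L2_norm lborel (\<lambda>\<xi>. ft (t n) \<xi> - ft (s n) \<xi>)) \<longlonglongrightarrow> 0"
    by (simp only: L2_norm_ft_diff[OF t(1) t(2) s(1) s(2)] mult_zero_right)
  then have "(\<lambda>n. L2_norm lborel (\<lambda>\<xi>. (ft (t n) \<xi> - ft (s n) \<xi>) + (ft (s n) \<xi> - g \<xi>))) \<longlonglongrightarrow> 0"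
    by (intro L2_norm_sum_tendsto_0 L2_diff ft_Bessel t s fgL2)
  then show ?thesis by simp
qed

lemma fourier_pair_add:
  assumes "fourier_pair f1 g1" "fourier_pair f2 g2"
  shows "fourier_pair (\<lambda>x. f1 x + f2 x) (\<lambda>x. g1 x + g2 x)"
proof -
  obtain s where s: "\<And>n. integrable lborel (s n)" "\<And>n. s n \<in> L2 lborel"
      "(\<lambda>n. L2_norm lborel (\<lambda>x. s n x - f1 x)) \<longlonglongrightarrow> 0"
      "(\<lambda>n. L2_norm lborel (\<lambda>\<xi>. ft (s n) \<xi> - g1 \<xi>)) \<longlonglongrightarrow> 0"
    using assms(1) by (auto simp: fourier_pair_def)
  obtain t where t: "\<And>n. integrable lborel (t n)" "\<And>n. t n \<in> L2 lborel"
      "(\<lambda>n. L2_norm lborel (\<lambda>x. t n x - f2 x)) \<longlonglongrightarrow> 0"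
      "(\<lambda>n. L2_norm lborel (\<lambda>\<xi>. ft (t n) \<xi> - g2 \<xi>)) \<longlonglongrightarrow> 0"
    using assms(2) by (auto simp: fourier_pair_def)
  note L = fourier_pair_L2[OF assms(1)] fourier_pair_L2[OF assms(2)]
  have "(\<lambda>n. L2_norm lborel (\<lambda>x. (s n x - f1 x) + (t n x - f2 x))) \<longlonglongrightarrow> 0"
    by (intro L2_norm_sum_tendsto_0 L2_diff s t L)
  moreover have "(\<lambda>n. L2_norm lborel (\<lambda>x. (ft (s n) x - g1 x) + (ft (t n) x - g2 x))) \<longlonglongrightarrow> 0"
    by (intro L2_norm_sum_tendsto_0 L2_diff s t L ft_Bessel)
  ultimately show ?thesis
    unfolding fourier_pair_def
    by (intro conjI exI[of _ "\<lambda>n x. s n x + t n x"] L2_add L allI Bochner_Integration.integrable_add s t)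
       (simp_all add: ft_add[OF s(1) t(1)] add_diff_add)
qed

lemma fourier_pair_scale:
  assumes "fourier_pair f g"
  shows "fourier_pair (\<lambda>x. c * f x) (\<lambda>x. c * g x)"
proof -
  obtain s where s: "\<And>n. integrable lborel (s n)" "\<And>n. s n \<in> L2 lborel"
      "(\<lambda>n. L2_norm lborel (\<lambda>x. s n x - f x)) \<longlonglongrightarrow> 0"
      "(\<lambda>n. L2_norm lborel (\<lambda>\<xi>. ft (s n) \<xi> - g \<xi>)) \<longlonglongrightarrow> 0"
    using assms by (auto simp: fourier_pair_def)
  note L = fourier_pair_L2[OF assms]
  show ?thesis
    unfolding fourier_pair_def
    using tendsto_mult[OF tendsto_const s(3), of "cmod c"] tendsto_mult[OF tendsto_const s(4), of "cmod c"]
    by (intro conjI exI[of _ "\<lambda>n x. c * s n x"] L2_scale L allI integrable_mult_right s)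
       (simp_all add: ft_scale right_diff_distrib[symmetric] L2_norm_scale)
qed

theorem Parseval:
  fixes f1 g1 f2 g2 :: "'a::euclidean_space \<Rightarrow> complex"
  assumes 1: "fourier_pair f1 g1" and 2: "fourier_pair f2 g2"
  shows "L2_inner lborel g1 g2 = complex_of_real ((2 * pi) ^ DIM('a)) * L2_inner lborel f1 f2"
proof -
  note L = fourier_pair_L2[OF 1] fourier_pair_L2[OF 2]
  have sq: "(L2_norm lborel g)\<^sup>2 = (2 * pi) ^ DIM('a) * (L2_norm lborel f)\<^sup>2" if "fourier_pair f g"
    for f g :: "'a \<Rightarrow> complex"
    using fourier_pair_norm[OF that] by (simp add: power_mult_distrib)
  show ?thesis
    unfolding L2_inner_polarization[OF L(2,4)] L2_inner_polarization[OF L(1,3)]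
      sq[OF 1] sq[OF 2] sq[OF fourier_pair_add[OF 1 2]]
      sq[OF fourier_pair_add[OF 1 fourier_pair_scale[OF 2, of \<i>]]]
    by (simp add: field_simps)
qed

section \<open>Coordinatewise products and dilations\<close>

definition vmult :: "'a::euclidean_space \<Rightarrow> 'a \<Rightarrow> 'a" where
  "vmult a x = (\<Sum>j\<in>Basis. ((a \<bullet> j) * (x \<bullet> j)) *\<^sub>R j)"

definition vdiv :: "'a::euclidean_space \<Rightarrow> 'a \<Rightarrow> 'a" where
  "vdiv x a = (\<Sum>j\<in>Basis. ((x \<bullet> j) / (a \<bullet> j)) *\<^sub>R j)"

definition vol :: "'a::euclidean_space \<Rightarrow> real" where
  "vol a = (\<Prod>j\<in>Basis. \<bar>a \<bullet> j\<bar>)"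

lemma vmult_measurable [measurable (raw)]:
  "f \<in> borel_measurable M \<Longrightarrow> g \<in> borel_measurable M \<Longrightarrow> (\<lambda>x. vmult (f x) (g x)) \<in> borel_measurable M"
  unfolding vmult_def by (intro borel_measurable_sum borel_measurable_scaleR borel_measurable_times borel_measurable_divide
      borel_measurable_inner borel_measurable_const)

lemma vdiv_measurable [measurable (raw)]:
  "f \<in> borel_measurable M \<Longrightarrow> g \<in> borel_measurable M \<Longrightarrow> (\<lambda>x. vdiv (f x) (g x)) \<in> borel_measurable M"
  unfolding vdiv_def by (intro borel_measurable_sum borel_measurable_scaleR borel_measurable_times borel_measurable_divide
      borel_measurable_inner borel_measurable_const)

lemma vol_measurable [measurable (raw)]:
  "f \<in> borel_measurable M \<Longrightarrow> (\<lambda>x. vol (f x)) \<in> borel_measurable M"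
  unfolding vol_def by (intro borel_measurable_prod borel_measurable_abs borel_measurable_inner borel_measurable_const)

lemma vmult_Basis [simp]: "j \<in> Basis \<Longrightarrow> vmult a x \<bullet> j = (a \<bullet> j) * (x \<bullet> j)"
  by (simp add: vmult_def)

lemma vdiv_Basis [simp]: "j \<in> Basis \<Longrightarrow> vdiv x a \<bullet> j = (x \<bullet> j) / (a \<bullet> j)"
  by (simp add: vdiv_def)

lemma vmult_eq_diag_map: "vmult a = diag_map (\<lambda>j. a \<bullet> j)"
  by (simp add: vmult_def diag_map_def fun_eq_iff)

lemma vol_nonneg [simp]: "0 \<le> vol a"
  by (simp add: vol_def prod_nonneg)

lemma vol_eq_0_iff: "vol a = 0 \<longleftrightarrow> (\<exists>j\<in>Basis. a \<bullet> j = 0)"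
  by (simp add: vol_def)

lemma vol_vmult: "vol (vmult a x) = vol a * vol x"
  by (simp add: vol_def abs_mult prod.distrib)

lemma vmult_commute: "vmult a x = vmult x a"
  by (simp add: vmult_def mult.commute)

lemma inner_vmult: "vmult a x \<bullet> y = x \<bullet> vmult a y"
  by (simp add: vmult_eq_diag_map inner_diag_map)

lemma vdiv_vmult:
  assumes "vol a \<noteq> 0"
  shows "vdiv (vmult a x) a = x"
  using assms by (auto intro!: euclidean_eqI[where 'a='a] simp: vol_eq_0_iff)

text \<open>
  The exceptional set is a finite union of coordinate hyperplanes.
\<close>

lemma AE_vol_nonzero: "AE x::'a::euclidean_space in lborel. vol x \<noteq> 0"
proof -
  have "AE x::'a in lborel. x \<bullet> j \<noteq> 0" if j: "j \<in> Basis" for j :: 'a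
  proof -
    have "negligible {x. x \<bullet> j = 0}"
      using negligible_standard_hyperplane[OF j, of 0] by simp
    then have "AE x in lebesgue. x \<notin> {x. x \<bullet> j = 0}"
      by (intro AE_not_in) (simp add: negligible_iff_null_sets)
    then show ?thesis by (simp add: AE_completion_iff)
  qed
  then have "AE x::'a in lborel. \<forall>j\<in>Basis. x \<bullet> j \<noteq> 0"
    by (intro AE_finite_allI) auto
  then show ?thesis by eventually_elim (simp add: vol_eq_0_iff)
qed

lemma nn_integral_vmult:
  assumes "vol a \<noteq> 0" "g \<in> borel_measurable borel"
  shows "(\<integral>\<^sup>+x. g x \<partial>lborel) = ennreal (vol a) * (\<integral>\<^sup>+x. g (b + vmult a x) \<partial>lborel)"
  using nn_integral_lborel_affine[where c="\<lambda>j. a \<bullet> j" and g=g and t=b] assms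
  by (simp add: vmult_eq_diag_map vol_eq_0_iff vol_def[symmetric])

lemma integral_vmult:
  fixes g :: "'a::euclidean_space \<Rightarrow> complex"
  assumes "vol a \<noteq> 0" "g \<in> borel_measurable borel"
  shows "(LINT x|lborel. g x) = complex_of_real (vol a) * (LINT x|lborel. g (b + vmult a x))"
  using integral_lborel_affine[where c="\<lambda>j. a \<bullet> j" and g=g and t=b] assms
  by (simp add: vmult_eq_diag_map vol_eq_0_iff vol_def[symmetric] scaleR_conv_of_real)

lemma integrable_vmult:
  fixes g :: "'a::euclidean_space \<Rightarrow> 'b::{banach, second_countable_topology}"
  assumes "vol a \<noteq> 0" "integrable lborel g"
  shows "integrable lborel (\<lambda>x. g (b + vmult a x))"
  using integrable_lborel_affine[where c="\<lambda>j. a \<bullet> j" and g=g and t=b] assms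
  by (simp add: vmult_eq_diag_map vol_eq_0_iff)

lemma L2_vmult:
  assumes "vol a \<noteq> 0" "f \<in> L2 lborel"
  shows "(\<lambda>x. f (b + vmult a x)) \<in> L2 lborel"
    and "L2_norm lborel f = sqrt (vol a) * L2_norm lborel (\<lambda>x. f (b + vmult a x))"
proof -
  have [measurable]: "f \<in> borel_measurable borel"
    using L2_measurable[OF assms(2)] by simp
  show mem: "(\<lambda>x. f (b + vmult a x)) \<in> L2 lborel"
    using integrable_vmult[OF assms(1) L2_integrable[OF assms(2)], of b] by (simp add: L2_def)
  have "ennreal ((L2_norm lborel f)\<^sup>2) = ennreal (vol a) * ennreal ((L2_norm lborel (\<lambda>x. f (b + vmult a x)))\<^sup>2)"
    unfolding ennreal_L2_norm_square[OF assms(2), symmetric] ennreal_L2_norm_square[OF mem, symmetric]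
    by (rule nn_integral_vmult[OF assms(1)]) measurable
  then have "(L2_norm lborel f)\<^sup>2 = (sqrt (vol a) * L2_norm lborel (\<lambda>x. f (b + vmult a x)))\<^sup>2"
    by (simp add: ennreal_mult[symmetric] power_mult_distrib)
  then show "L2_norm lborel f = sqrt (vol a) * L2_norm lborel (\<lambda>x. f (b + vmult a x))"
    by (rule power2_eq_imp_eq) auto
qed

text \<open>
  Writes the substitution of the wavelet transform in the form of the affine rules above. The parameters
  are \<open>- b / a\<close> and \<open>1 / a\<close>, the latter being \<open>vdiv One a\<close>.
\<close>

lemma vdiv_shift_eq:
  "vdiv (t - b) a = vdiv (- b) a + vmult (vdiv One a) t"
  by (auto intro!: euclidean_eqI[where 'a='a] simp: inner_simps diff_divide_distrib)

lemma vol_vdiv_One: "vol a \<noteq> 0 \<Longrightarrow> vol (vdiv One a) = 1 / vol a"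
  by (simp add: vol_def prod_dividef)

lemma ft_affine:
  fixes s :: "'a::euclidean_space \<Rightarrow> complex"
  assumes a: "vol a \<noteq> 0" and [measurable]: "s \<in> borel_measurable borel"
  shows "ft (\<lambda>t. s (vdiv (t - b) a)) \<xi> = complex_of_real (vol a) * (cis (- (b \<bullet> \<xi>)) * ft s (vmult a \<xi>))"
proof -
  have "ft (\<lambda>t. s (vdiv (t - b) a)) \<xi> =
      complex_of_real (vol a) * (LINT x|lborel. s (vdiv (b + vmult a x - b) a) * cis (- ((b + vmult a x) \<bullet> \<xi>)))"
    unfolding ft_def by (rule integral_vmult[OF a]) measurable
  also have "(\<lambda>x. s (vdiv (b + vmult a x - b) a) * cis (- ((b + vmult a x) \<bullet> \<xi>))) =
      (\<lambda>x. cis (- (b \<bullet> \<xi>)) * (s x * cis (- (x \<bullet> vmult a \<xi>))))"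
  proof
    fix x
    have "cis (- ((b + vmult a x) \<bullet> \<xi>)) = cis (- (b \<bullet> \<xi>)) * cis (- (x \<bullet> vmult a \<xi>))"
      by (simp add: cis_mult inner_add_left inner_vmult)
    then show "s (vdiv (b + vmult a x - b) a) * cis (- ((b + vmult a x) \<bullet> \<xi>)) =
        cis (- (b \<bullet> \<xi>)) * (s x * cis (- (x \<bullet> vmult a \<xi>)))"
      using a by (simp add: vdiv_vmult)
  qed
  finally show ?thesis by (simp add: ft_def)
qed

lemma L2_norm_unimodular:
  assumes "\<And>x. cmod (k x) = 1"
  shows "L2_norm M (\<lambda>x. k x * f x) = L2_norm M f"
  using assms by (simp add: L2_norm_def norm_mult)

lemma L2_unimodular:
  assumes "f \<in> L2 M" "k \<in> borel_measurable M" "\<And>x. cmod (k x) = 1"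
  shows "(\<lambda>x. k x * f x) \<in> L2 M"
  using assms by (intro L2_mono_norm(1)[OF assms(1)]) (auto simp: norm_mult dest: L2_measurable)

lemma fourier_pair_affine:
  fixes f g :: "'a::euclidean_space \<Rightarrow> complex"
  assumes fg: "fourier_pair f g" and a: "vol a \<noteq> 0"
  shows "fourier_pair (\<lambda>t. f (vdiv (t - b) a)) (\<lambda>\<xi>. complex_of_real (vol a) * (cis (- (b \<bullet> \<xi>)) * g (vmult a \<xi>)))"
proof -
  obtain s where s: "\<And>n. integrable lborel (s n)" "\<And>n. s n \<in> L2 lborel"
      "(\<lambda>n. L2_norm lborel (\<lambda>x. s n x - f x)) \<longlonglongrightarrow> 0"
      "(\<lambda>n. L2_norm lborel (\<lambda>\<xi>. ft (s n) \<xi> - g \<xi>)) \<longlonglongrightarrow> 0"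
    using fg by (auto simp: fourier_pair_def)
  note L = fourier_pair_L2[OF fg]
  have a': "vol (vdiv One a) \<noteq> 0" using a by (simp add: vol_vdiv_One)
  have L2a: "(\<lambda>t. h (vdiv (t - b) a)) \<in> L2 lborel" and norma: "L2_norm lborel (\<lambda>t. h (vdiv (t - b) a)) = sqrt (vol a) * L2_norm lborel h"
    if "h \<in> L2 lborel" for h
    using L2_vmult[OF a' that, of "vdiv (- b) a"] a
    by (simp_all add: vdiv_shift_eq vol_vdiv_One real_sqrt_divide)
  have L2m: "(\<lambda>\<xi>. h (vmult a \<xi>)) \<in> L2 lborel" and normm: "L2_norm lborel (\<lambda>\<xi>. h (vmult a \<xi>)) = L2_norm lborel h / sqrt (vol a)"
    if "h \<in> L2 lborel" for h
    using L2_vmult[OF a that, of 0] a by simp_all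
  have int: "integrable lborel (\<lambda>t. s n (vdiv (t - b) a))" for n
    unfolding vdiv_shift_eq by (rule integrable_vmult[OF a' s(1)])
  have "(\<lambda>n. L2_norm lborel (\<lambda>t. s n (vdiv (t - b) a) - f (vdiv (t - b) a))) \<longlonglongrightarrow> 0"
    using tendsto_mult[OF tendsto_const s(3), of "sqrt (vol a)"] norma[OF L2_diff[OF s(2) L(1)]]
    by simp
  moreover have "(\<lambda>n. L2_norm lborel (\<lambda>\<xi>. ft (\<lambda>t. s n (vdiv (t - b) a)) \<xi> -
      complex_of_real (vol a) * (cis (- (b \<bullet> \<xi>)) * g (vmult a \<xi>)))) \<longlonglongrightarrow> 0"
  proof -
    have "L2_norm lborel (\<lambda>\<xi>. ft (\<lambda>t. s n (vdiv (t - b) a)) \<xi> -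
        complex_of_real (vol a) * (cis (- (b \<bullet> \<xi>)) * g (vmult a \<xi>))) =
        vol a * (L2_norm lborel (\<lambda>\<xi>. ft (s n) \<xi> - g \<xi>) / sqrt (vol a))" for n
    proof -
      have [measurable]: "s n \<in> borel_measurable borel" using L2_measurable[OF s(2)] by simp
      have "(\<lambda>\<xi>. ft (\<lambda>t. s n (vdiv (t - b) a)) \<xi> - complex_of_real (vol a) * (cis (- (b \<bullet> \<xi>)) * g (vmult a \<xi>))) =
        (\<lambda>\<xi>. complex_of_real (vol a) * (cis (- (b \<bullet> \<xi>)) * (ft (s n) (vmult a \<xi>) - g (vmult a \<xi>))))"
        using a by (simp add: fun_eq_iff ft_affine right_diff_distrib)
      then show ?thesis
        using normm[OF L2_diff[OF ft_Bessel(1)[OF s(1,2)] L(2)], of n]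
        by (simp add: L2_norm_scale L2_norm_unimodular)
    qed
    then show ?thesis
      using tendsto_mult[OF tendsto_const tendsto_divide[OF s(4) tendsto_const, of "sqrt (vol a)"], of "vol a"] a
      by simp
  qed
  ultimately show ?thesis
    unfolding fourier_pair_def
    by (intro conjI exI[of _ "\<lambda>n t. s n (vdiv (t - b) a)"] allI L2a L s int L2_scale L2_unimodular L2m) auto
qed

section \<open>The isometry of the continuous wavelet transform\<close>

text \<open>
  The classical continuous wavelet transform, without the normalising factor \<open>1 / sqrt (vol a)\<close>.
\<close>

definition cwt :: "('a::euclidean_space \<Rightarrow> complex) \<Rightarrow> ('a \<Rightarrow> complex) \<Rightarrow> 'a \<Rightarrow> 'a \<Rightarrow> complex" where
  "cwt f p a b = (LINT t|lborel. f t * cnj (p (vdiv (t - b) a)))"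

lemma cwt_measurable:
  assumes [measurable]: "f \<in> borel_measurable borel" "p \<in> borel_measurable borel"
  shows "(\<lambda>z. cwt f p (fst z) (snd z)) \<in> borel_measurable (lborel \<Otimes>\<^sub>M lborel)"
  unfolding cwt_def by measurable

text \<open>
  Parseval together with the affine rule. The product under \<open>ft\<close> is integrable for every \<open>a\<close>, being a
  product of two square-integrable functions, so that \<open>ft\<close> is a genuine integral here.
\<close>

lemma cwt_eq_ft:
  fixes f F p g :: "'a::euclidean_space \<Rightarrow> complex"
  assumes f: "fourier_pair f F" and p: "fourier_pair p g" and a: "vol a \<noteq> 0"
  shows "cwt f p a b =
    complex_of_real (vol a / (2 * pi) ^ DIM('a)) * ft (\<lambda>\<xi>. F \<xi> * cnj (g (vmult a \<xi>))) (- b)"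
proof -
  have "complex_of_real ((2 * pi) ^ DIM('a)) * cwt f p a b =
      L2_inner lborel F (\<lambda>\<xi>. complex_of_real (vol a) * (cis (- (b \<bullet> \<xi>)) * g (vmult a \<xi>)))"
    unfolding Parseval[OF f fourier_pair_affine[OF p a, of b]] by (simp add: L2_inner_def cwt_def)
  also have "\<dots> = (LINT \<xi>|lborel. complex_of_real (vol a) * (F \<xi> * cnj (g (vmult a \<xi>)) * cis (- (\<xi> \<bullet> (- b)))))"
    unfolding L2_inner_def by (simp add: cis_cnj ac_simps inner_commute)
  also have "\<dots> = complex_of_real (vol a) * ft (\<lambda>\<xi>. F \<xi> * cnj (g (vmult a \<xi>))) (- b)"
    unfolding ft_def by (rule integral_mult_right_zero)
  finally show ?thesis by (simp add: field_simps)
qed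

lemma nn_integral_lborel_uminus:
  fixes g :: "'a::euclidean_space \<Rightarrow> ennreal"
  assumes "g \<in> borel_measurable borel"
  shows "(\<integral>\<^sup>+x. g (- x) \<partial>lborel) = (\<integral>\<^sup>+x. g x \<partial>lborel)"
  using nn_integral_lborel_affine[where c="\<lambda>_. -1" and g=g and t=0] assms
  by (simp add: diag_map_const)

text \<open>
  Plancherel in the translation parameter. It needs the product \<open>F(\<xi>) cnj (g (a \<xi>))\<close> to be
  square-integrable, which admissibility of \<open>g\<close> gives for almost every \<open>a\<close>.
\<close>

lemma nn_integral_cwt_translations:
  fixes f F p g :: "'a::euclidean_space \<Rightarrow> complex"
  assumes f: "fourier_pair f F" and p: "fourier_pair p g" and a: "vol a \<noteq> 0"
    and h: "(\<lambda>\<xi>. F \<xi> * cnj (g (vmult a \<xi>))) \<in> L2 lborel"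
  shows "(\<integral>\<^sup>+b. ennreal ((cmod (cwt f p a b))\<^sup>2) \<partial>lborel) =
    ennreal ((vol a)\<^sup>2 / (2 * pi) ^ DIM('a)) * (\<integral>\<^sup>+\<xi>. ennreal ((cmod (F \<xi>))\<^sup>2 * (cmod (g (vmult a \<xi>)))\<^sup>2) \<partial>lborel)"
proof -
  let ?h = "\<lambda>\<xi>. F \<xi> * cnj (g (vmult a \<xi>))" and ?D = "(2 * pi) ^ DIM('a)"
  have h1: "integrable lborel ?h"
    using L2_times_integrable[OF fourier_pair_L2(2)[OF f] L2_vmult(1)[OF a fourier_pair_L2(2)[OF p], of 0]] by simp
  have [measurable]: "?h \<in> borel_measurable borel"
    using L2_measurable[OF h] by simp
  have pos: "(2 * pi) ^ DIM('a) > 0" by simp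
  have "(\<integral>\<^sup>+b. ennreal ((cmod (cwt f p a b))\<^sup>2) \<partial>lborel) =
      (\<integral>\<^sup>+b. ennreal ((vol a / ?D)\<^sup>2) * ennreal ((cmod (ft ?h (- b)))\<^sup>2) \<partial>lborel)"
    unfolding cwt_eq_ft[OF f p a] norm_mult norm_of_real power_mult_distrib power2_abs
    by (simp add: ennreal_mult)
  also have "\<dots> = ennreal ((vol a / ?D)\<^sup>2) * (\<integral>\<^sup>+b. ennreal ((cmod (ft ?h (- b)))\<^sup>2) \<partial>lborel)"
    by (rule nn_integral_cmult) measurable
  also have "(\<integral>\<^sup>+b. ennreal ((cmod (ft ?h (- b)))\<^sup>2) \<partial>lborel) = (\<integral>\<^sup>+b. ennreal ((cmod (ft ?h b))\<^sup>2) \<partial>lborel)"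
    by (rule nn_integral_lborel_uminus) measurable
  also have "\<dots> = ennreal ((L2_norm lborel (ft ?h))\<^sup>2)"
    by (intro ennreal_L2_norm_square ft_Bessel h1 h)
  also have "\<dots> = ennreal (?D * (L2_norm lborel ?h)\<^sup>2)"
    unfolding Plancherel[OF h1 h] by (simp add: power_mult_distrib)
  also have "\<dots> = ennreal ?D * (\<integral>\<^sup>+\<xi>. ennreal ((cmod (?h \<xi>))\<^sup>2) \<partial>lborel)"
    unfolding ennreal_L2_norm_square[OF h] by (simp add: ennreal_mult)
  finally have "(\<integral>\<^sup>+b. ennreal ((cmod (cwt f p a b))\<^sup>2) \<partial>lborel) =
      (ennreal ((vol a / ?D)\<^sup>2) * ennreal ?D) * (\<integral>\<^sup>+\<xi>. ennreal ((cmod (?h \<xi>))\<^sup>2) \<partial>lborel)"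
    by (simp only: mult.assoc)
  also have "ennreal ((vol a / ?D)\<^sup>2) * ennreal ?D = ennreal ((vol a / ?D)\<^sup>2 * ?D)"
    by (rule ennreal_mult[symmetric]) auto
  also have "(vol a / ?D)\<^sup>2 * ?D = (vol a)\<^sup>2 / ?D"
    using pos by (simp add: power2_eq_square del: power_mult_distrib)
  finally show ?thesis by (simp add: norm_mult power_mult_distrib)
qed

text \<open>
  The measure \<open>da / vol a\<close> is the Haar measure of the group of coordinatewise dilations. Division by
  zero yields zero, so the integrals are over the group \<open>vol a \<noteq> 0\<close>.
\<close>

lemma nn_integral_vol_scale_invariant:
  fixes G :: "'a::euclidean_space \<Rightarrow> real"
  assumes [measurable]: "G \<in> borel_measurable borel" and \<xi>: "vol \<xi> \<noteq> 0"
  shows "(\<integral>\<^sup>+a. ennreal (G (vmult a \<xi>) / vol a) \<partial>lborel) = (\<integral>\<^sup>+u. ennreal (G u / vol u) \<partial>lborel)"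
proof -
  have pos: "vol \<xi> > 0" using \<xi> vol_nonneg[of \<xi>] by linarith
  have "(\<integral>\<^sup>+u. ennreal (G u / vol u) \<partial>lborel) =
      ennreal (vol \<xi>) * (\<integral>\<^sup>+a. ennreal (G (0 + vmult \<xi> a) / vol (0 + vmult \<xi> a)) \<partial>lborel)"
    by (rule nn_integral_vmult[OF \<xi>]) measurable
  also have "\<dots> = (\<integral>\<^sup>+a. ennreal (vol \<xi>) * ennreal (G (0 + vmult \<xi> a) / vol (0 + vmult \<xi> a)) \<partial>lborel)"
    by (rule nn_integral_cmult[symmetric]) measurable
  also have "\<dots> = (\<integral>\<^sup>+a. ennreal (G (vmult a \<xi>) / vol a) \<partial>lborel)"
    using pos by (intro nn_integral_cong)
      (simp add: ennreal_mult'[symmetric] vol_vmult vmult_commute[of \<xi>])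
  finally show ?thesis ..
qed

text \<open>
  The exponent 3 collects the two powers of the invariant measure \<open>da db / vol a ^ 2\<close> and one from the
  square of the omitted factor \<open>1 / sqrt (vol a)\<close>. Tonelli and the scale invariance first show that the integral of
  \<open>E a / vol a\<close> is finite, where \<open>E a\<close> is the squared norm of \<open>F(\<xi>) cnj (g (a \<xi>))\<close>. Hence \<open>E a\<close> is
  finite for almost every \<open>a\<close>, and this is what the Plancherel step in \<open>b\<close> requires.
\<close>

theorem cwt_isometry:
  fixes f F p g :: "'a::euclidean_space \<Rightarrow> complex"
  assumes f: "fourier_pair f F" and p: "fourier_pair p g"
    and adm: "(\<integral>\<^sup>+u. ennreal ((cmod (g u))\<^sup>2 / vol u) \<partial>lborel) < \<infinity>"
  shows "(\<integral>\<^sup>+a. \<integral>\<^sup>+b. ennreal ((cmod (cwt f p a b))\<^sup>2 / vol a ^ 3) \<partial>lborel \<partial>lborel) =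
    (\<integral>\<^sup>+u. ennreal ((cmod (g u))\<^sup>2 / vol u) \<partial>lborel) * ennreal ((L2_norm lborel f)\<^sup>2)"
proof -
  note L = fourier_pair_L2[OF f] fourier_pair_L2[OF p]
  have [measurable]: "f \<in> borel_measurable borel" "F \<in> borel_measurable borel"
      "p \<in> borel_measurable borel" "g \<in> borel_measurable borel"
    using L[THEN L2_measurable] by auto
  let ?D = "(2 * pi) ^ DIM('a)"
  have Dpos: "?D > 0" by simp
  define C where "C = (\<integral>\<^sup>+u. ennreal ((cmod (g u))\<^sup>2 / vol u) \<partial>lborel)"
  define E where "E a = (\<integral>\<^sup>+\<xi>. ennreal ((cmod (F \<xi>))\<^sup>2 * (cmod (g (vmult a \<xi>)))\<^sup>2) \<partial>lborel)" for a
  have [measurable]: "E \<in> borel_measurable borel"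
    unfolding E_def by measurable
  have "(\<integral>\<^sup>+a. ennreal (1 / vol a) * E a \<partial>lborel) =
      (\<integral>\<^sup>+a. \<integral>\<^sup>+\<xi>. ennreal (1 / vol a) * ennreal ((cmod (F \<xi>))\<^sup>2 * (cmod (g (vmult a \<xi>)))\<^sup>2) \<partial>lborel \<partial>lborel)"
    unfolding E_def by (intro nn_integral_cong nn_integral_cmult[symmetric]) measurable
  also have "\<dots> = (\<integral>\<^sup>+\<xi>. \<integral>\<^sup>+a. ennreal (1 / vol a) * ennreal ((cmod (F \<xi>))\<^sup>2 * (cmod (g (vmult a \<xi>)))\<^sup>2) \<partial>lborel \<partial>lborel)"
    by (rule lborel_pair.Fubini'[symmetric]) measurable
  also have "\<dots> = (\<integral>\<^sup>+\<xi>. ennreal ((cmod (F \<xi>))\<^sup>2) * C \<partial>lborel)"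
  proof (rule nn_integral_cong_AE)
    show "AE \<xi> in lborel. (\<integral>\<^sup>+a. ennreal (1 / vol a) * ennreal ((cmod (F \<xi>))\<^sup>2 * (cmod (g (vmult a \<xi>)))\<^sup>2) \<partial>lborel) =
        ennreal ((cmod (F \<xi>))\<^sup>2) * C"
      using AE_vol_nonzero
    proof eventually_elim
      case (elim \<xi>)
      have "(\<integral>\<^sup>+a. ennreal (1 / vol a) * ennreal ((cmod (F \<xi>))\<^sup>2 * (cmod (g (vmult a \<xi>)))\<^sup>2) \<partial>lborel) =
          (\<integral>\<^sup>+a. ennreal ((cmod (F \<xi>))\<^sup>2) * ennreal ((cmod (g (vmult a \<xi>)))\<^sup>2 / vol a) \<partial>lborel)"
        by (intro nn_integral_cong) (simp add: ennreal_mult'[symmetric])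
      also have "\<dots> = ennreal ((cmod (F \<xi>))\<^sup>2) * (\<integral>\<^sup>+a. ennreal ((cmod (g (vmult a \<xi>)))\<^sup>2 / vol a) \<partial>lborel)"
        by (rule nn_integral_cmult) measurable
      also have "(\<integral>\<^sup>+a. ennreal ((cmod (g (vmult a \<xi>)))\<^sup>2 / vol a) \<partial>lborel) = C"
        unfolding C_def by (rule nn_integral_vol_scale_invariant[OF _ elim]) measurable
      finally show ?case .
    qed
  qed
  also have "\<dots> = (\<integral>\<^sup>+\<xi>. ennreal ((cmod (F \<xi>))\<^sup>2) \<partial>lborel) * C"
    by (rule nn_integral_multc) measurable
  also have "(\<integral>\<^sup>+\<xi>. ennreal ((cmod (F \<xi>))\<^sup>2) \<partial>lborel) = ennreal (?D * (L2_norm lborel f)\<^sup>2)"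
    unfolding ennreal_L2_norm_square[OF L(2)] fourier_pair_norm[OF f] by (simp add: power_mult_distrib)
  finally have total: "(\<integral>\<^sup>+a. ennreal (1 / vol a) * E a \<partial>lborel) = ennreal (?D * (L2_norm lborel f)\<^sup>2) * C" .
  have fin: "AE a in lborel. ennreal (1 / vol a) * E a \<noteq> \<infinity>"
  proof (rule nn_integral_noteq_infinite)
    show "(\<integral>\<^sup>+a. ennreal (1 / vol a) * E a \<partial>lborel) \<noteq> \<infinity>"
      unfolding total using adm by (simp add: C_def ennreal_mult_eq_top_iff)
  qed measurable
  have "(\<integral>\<^sup>+a. \<integral>\<^sup>+b. ennreal ((cmod (cwt f p a b))\<^sup>2 / vol a ^ 3) \<partial>lborel \<partial>lborel) =
      (\<integral>\<^sup>+a. ennreal (1 / ?D) * (ennreal (1 / vol a) * E a) \<partial>lborel)"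
  proof (rule nn_integral_cong_AE)
    show "AE a in lborel. (\<integral>\<^sup>+b. ennreal ((cmod (cwt f p a b))\<^sup>2 / vol a ^ 3) \<partial>lborel) =
        ennreal (1 / ?D) * (ennreal (1 / vol a) * E a)"
      using AE_vol_nonzero fin
    proof eventually_elim
      case (elim a)
      have pos: "vol a > 0" using elim(1) vol_nonneg[of a] by linarith
      have "E a < \<infinity>"
        using elim(2) pos by (auto simp: ennreal_mult_eq_top_iff less_top)
      then have h: "(\<lambda>\<xi>. F \<xi> * cnj (g (vmult a \<xi>))) \<in> L2 lborel"
        unfolding L2_def E_def by (auto simp: integrable_iff_bounded norm_mult power_mult_distrib)
      have [measurable]: "(\<lambda>b. cwt f p a b) \<in> borel_measurable borel"
        unfolding cwt_def by measurable
      have "(\<integral>\<^sup>+b. ennreal ((cmod (cwt f p a b))\<^sup>2 / vol a ^ 3) \<partial>lborel) =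
          (\<integral>\<^sup>+b. ennreal (1 / vol a ^ 3) * ennreal ((cmod (cwt f p a b))\<^sup>2) \<partial>lborel)"
        by (intro nn_integral_cong) (simp add: ennreal_mult'[symmetric])
      also have "\<dots> = ennreal (1 / vol a ^ 3) * (\<integral>\<^sup>+b. ennreal ((cmod (cwt f p a b))\<^sup>2) \<partial>lborel)"
        by (rule nn_integral_cmult) measurable
      also have "\<dots> = ennreal (1 / vol a ^ 3) * ennreal ((vol a)\<^sup>2 / ?D) * E a"
        unfolding nn_integral_cwt_translations[OF f p elim(1) h] E_def by (simp only: mult.assoc)
      also have "ennreal (1 / vol a ^ 3) * ennreal ((vol a)\<^sup>2 / ?D) = ennreal (1 / vol a ^ 3 * ((vol a)\<^sup>2 / ?D))"
        by (rule ennreal_mult[symmetric]) auto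
      also have "1 / vol a ^ 3 * ((vol a)\<^sup>2 / ?D) = 1 / ?D * (1 / vol a)"
        using pos by (simp add: power2_eq_square power3_eq_cube)
      also have "ennreal (1 / ?D * (1 / vol a)) = ennreal (1 / ?D) * ennreal (1 / vol a)"
        by (rule ennreal_mult) auto
      finally show ?case by (simp only: mult.assoc)
    qed
  qed
  also have "\<dots> = ennreal (1 / ?D) * (ennreal (?D * (L2_norm lborel f)\<^sup>2) * C)"
    unfolding total[symmetric] by (rule nn_integral_cmult) measurable
  also have "\<dots> = (ennreal (1 / ?D) * ennreal (?D * (L2_norm lborel f)\<^sup>2)) * C"
    by (simp only: mult.assoc)
  also have "ennreal (1 / ?D) * ennreal (?D * (L2_norm lborel f)\<^sup>2) = ennreal (1 / ?D * (?D * (L2_norm lborel f)\<^sup>2))"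
    by (rule ennreal_mult[symmetric]) auto
  also have "1 / ?D * (?D * (L2_norm lborel f)\<^sup>2) = (L2_norm lborel f)\<^sup>2"
    using Dpos by (simp del: power_mult_distrib)
  finally show ?thesis unfolding C_def by (simp only: mult.commute)
qed

section \<open>Borel representatives of Lebesgue measurable functions\<close>

text \<open>
  Products of Lebesgue sigma-algebras are smaller than the Lebesgue sigma-algebra of the product, so
  Fubini arguments are carried out with Borel functions. The lemmas of this section transfer them to
  Lebesgue measurable functions, which agree with Borel ones almost everywhere.
\<close>

lemma completion_ex_borel_measurable_complex:
  fixes f :: "'a \<Rightarrow> complex"
  assumes "f \<in> borel_measurable (completion M)"
  shows "\<exists>g\<in>borel_measurable M. AE x in M. f x = g x"
proof -
  have "(\<lambda>x. Re (f x)) \<in> borel_measurable (completion M)" "(\<lambda>x. Im (f x)) \<in> borel_measurable (completion M)"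
    using assms by measurable
  then obtain u v where uv: "u \<in> borel_measurable M" "AE x in M. Re (f x) = u x"
     "v \<in> borel_measurable M" "AE x in M. Im (f x) = v x"
    using completion_ex_borel_measurable_real by metis
  have "(\<lambda>x. Complex (u x) (v x)) \<in> borel_measurable M"
    unfolding Complex_eq using uv by measurable
  moreover have "AE x in M. f x = Complex (u x) (v x)"
    using uv(2,4) by eventually_elim (simp add: complex_eq_iff)
  ultimately show ?thesis by (intro bexI[of _ "\<lambda>x. Complex (u x) (v x)"])
qed

lemma lebesgue_measurable_if_AE_borel:
  fixes f g :: "'a::euclidean_space \<Rightarrow> complex"
  assumes "g \<in> borel_measurable borel" "AE x in lborel. f x = g x"
  shows "f \<in> borel_measurable lebesgue"
proof (rule borel_measurable_AE)
  show "g \<in> borel_measurable lebesgue"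
    using assms(1) by (intro measurable_completion) simp
  show "AE x in lebesgue. g x = f x"
    using assms(2) by (auto simp: AE_completion_iff eq_commute)
qed

lemma integral_lebesgue_eq_AE:
  fixes f g :: "'a::euclidean_space \<Rightarrow> complex"
  assumes "g \<in> borel_measurable borel" "AE x in lborel. f x = g x"
  shows "(LINT x|lebesgue. f x) = (LINT x|lborel. g x)"
proof -
  have g': "g \<in> borel_measurable lebesgue"
    using assms(1) by (intro measurable_completion) simp
  have "(LINT x|lebesgue. f x) = (LINT x|lebesgue. g x)"
    using assms(2) lebesgue_measurable_if_AE_borel[OF assms] g'
    by (intro integral_cong_AE) (auto simp: AE_completion_iff)
  then show ?thesis using assms(1) by (simp add: integral_completion)
qed

lemma integrable_lebesgue_iff_AE:
  fixes f g :: "'a::euclidean_space \<Rightarrow> complex"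
  assumes "g \<in> borel_measurable borel" "AE x in lborel. f x = g x"
  shows "integrable lebesgue f \<longleftrightarrow> integrable lborel g"
proof -
  have g': "g \<in> borel_measurable lebesgue"
    using assms(1) by (intro measurable_completion) simp
  have "integrable lebesgue f \<longleftrightarrow> integrable lebesgue g"
    using assms(2) lebesgue_measurable_if_AE_borel[OF assms] g'
    by (intro integrable_cong_AE) (auto simp: AE_completion_iff)
  then show ?thesis using assms(1) by (simp add: integrable_completion)
qed

lemma L2_lebesgue_AE:
  fixes f g :: "'a::euclidean_space \<Rightarrow> complex"
  assumes g: "g \<in> borel_measurable borel" and ae: "AE x in lborel. f x = g x"
  shows "f \<in> L2 lebesgue \<longleftrightarrow> g \<in> L2 lborel" and "L2_norm lebesgue f = L2_norm lborel g"
proof -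
  have f: "f \<in> borel_measurable lebesgue" by (rule lebesgue_measurable_if_AE_borel[OF assms])
  have g': "g \<in> borel_measurable lebesgue" using g by (intro measurable_completion) simp
  have ae': "AE x in lebesgue. (cmod (f x))\<^sup>2 = (cmod (g x))\<^sup>2"
    using ae by (auto simp: AE_completion_iff)
  have "integrable lebesgue (\<lambda>x. (cmod (f x))\<^sup>2) \<longleftrightarrow> integrable lebesgue (\<lambda>x. (cmod (g x))\<^sup>2)"
    using f g' ae' by (intro integrable_cong_AE) auto
  then show "f \<in> L2 lebesgue \<longleftrightarrow> g \<in> L2 lborel"
    using f g by (simp add: L2_def integrable_completion)
  have "(LINT x|lebesgue. (cmod (f x))\<^sup>2) = (LINT x|lebesgue. (cmod (g x))\<^sup>2)"
    using f g' ae' by (intro integral_cong_AE) auto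
  then show "L2_norm lebesgue f = L2_norm lborel g"
    using g by (simp add: L2_norm_def integral_completion)
qed

lemma L2_lebesgue_borel_version:
  fixes f :: "'a::euclidean_space \<Rightarrow> complex"
  assumes "f \<in> L2 lebesgue"
  obtains g where "g \<in> L2 lborel" "AE x in lborel. f x = g x"
proof -
  obtain g where g: "g \<in> borel_measurable borel" "AE x in lborel. f x = g x"
    using completion_ex_borel_measurable_complex[OF L2_measurable[OF assms]] by auto
  then show ?thesis using that L2_lebesgue_AE(1)[OF g] assms by blast
qed

lemma AE_vmult:
  fixes P :: "'a::euclidean_space \<Rightarrow> bool"
  assumes a: "vol a \<noteq> 0" and P: "AE x in lborel. P x"
  shows "AE x in lborel. P (b + vmult a x)"
proof -
  obtain N where N: "N \<in> sets lborel" "emeasure lborel N = 0" "{x. \<not> P x} \<subseteq> N"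
    using P unfolding eventually_ae_filter by (auto simp: null_sets_def)
  have [measurable]: "N \<in> sets borel" using N(1) by simp
  have "0 = ennreal (vol a) * (\<integral>\<^sup>+x. indicator N (b + vmult a x) \<partial>lborel)"
    using N(2) nn_integral_vmult[OF a, of "indicator N" b] by simp
  then have "(\<integral>\<^sup>+x. indicator N (b + vmult a x) \<partial>lborel) = 0"
    using a vol_nonneg[of a] by (auto simp: ennreal_eq_0_iff)
  then have "AE x in lborel. indicator N (b + vmult a x) = (0::ennreal)"
    by (subst (asm) nn_integral_0_iff_AE) auto
  then show ?thesis
    by eventually_elim (use N(3) in \<open>auto split: split_indicator_asm\<close>)
qed

section \<open>The fractional Fourier transform as a chirped Fourier transform\<close>

lemma Basis_vec_eq_axis: "(Basis :: (real ^ 'n::finite) set) = (\<lambda>k. axis k 1) ` UNIV"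
  by (auto simp: Basis_vec_def)

lemma vol_eq_mabs:
  fixes a :: "real ^ 'n"
  shows "vol a = mabs a"
proof -
  have "inj (\<lambda>k::'n. axis k (1::real))"
    by (auto simp: inj_on_def axis_eq_axis)
  then show ?thesis
    by (simp add: vol_def mabs_def Basis_vec_eq_axis prod.reindex abs_prod inner_axis)
qed

lemma vmult_nth:
  fixes a x :: "real ^ 'n"
  shows "vmult a x $ k = a $ k * x $ k"
  using vmult_Basis[of "axis k 1" a x] by (simp add: Basis_vec_eq_axis inner_axis)

lemma vdiv_nth:
  fixes a x :: "real ^ 'n"
  shows "vdiv x a $ k = x $ k / a $ k"
  using vdiv_Basis[of "axis k 1" x a] by (simp add: Basis_vec_eq_axis inner_axis)

lemma in_R0_iff: "a \<in> R0 \<longleftrightarrow> vol a \<noteq> 0"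
  by (simp add: R0_def vol_eq_mabs)

lemma cmod_chirp [simp]: "cmod (chirp \<alpha> s x) = 1"
  by (simp add: chirp_def)

lemma chirp_nonzero [simp]: "chirp \<alpha> s x \<noteq> 0"
  by (simp add: chirp_def)

lemma cnj_chirp: "cnj (chirp \<alpha> s x) = chirp \<alpha> (- s) x"
  by (simp add: chirp_def exp_cnj)

lemma chirp_measurable [measurable (raw)]:
  assumes [measurable]: "f \<in> borel_measurable M"
  shows "(\<lambda>x. chirp \<alpha> s (f x)) \<in> borel_measurable M"
  unfolding chirp_def cart_eq_inner_axis by measurable

text \<open>
  The vector \<open>\<kappa>\<close> for which the oscillating factor of the fractional kernel is \<open>cis (- (x \<bullet> \<kappa> \<xi>))\<close>.
\<close>

definition freq_scale :: "real ^ 'n \<Rightarrow> real \<Rightarrow> real ^ 'n" where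
  "freq_scale \<alpha> l = (\<chi> k. l\<^sup>2 / sin (\<alpha> $ k))"

definition norm_const :: "real ^ 'n \<Rightarrow> complex" where
  "norm_const \<alpha> = c_prod \<alpha> / complex_of_real (sqrt (2 * pi) ^ CARD('n))"

lemma mfrft_kernel_eq:
  "mfrft_kernel \<alpha> l x \<xi> = norm_const \<alpha> * chirp \<alpha> (l\<^sup>2) x * chirp \<alpha> (l\<^sup>2) \<xi> * cis (- (x \<bullet> vmult (freq_scale \<alpha> l) \<xi>))"
proof -
  have "x \<bullet> vmult (freq_scale \<alpha> l) \<xi> = l\<^sup>2 * (\<Sum>k\<in>UNIV. x $ k * \<xi> $ k * (1 / sin (\<alpha> $ k)))"
    by (simp add: inner_vec_def vmult_nth freq_scale_def sum_distrib_left ac_simps)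
  then show ?thesis
    by (simp add: mfrft_kernel_def norm_const_def cis_conv_exp)
qed

lemma mfrft_integral_eq_ft:
  fixes s s' :: "real ^ 'n \<Rightarrow> complex"
  assumes [measurable]: "s' \<in> borel_measurable borel" and ae: "AE x in lborel. s x = s' x"
  shows "mfrft_integral \<alpha> l s \<xi> =
    norm_const \<alpha> * (chirp \<alpha> (l\<^sup>2) \<xi> * ft (\<lambda>x. chirp \<alpha> (l\<^sup>2) x * s' x) (vmult (freq_scale \<alpha> l) \<xi>))"
proof -
  have "mfrft_integral \<alpha> l s \<xi> = (LINT x|lborel. s' x * mfrft_kernel \<alpha> l x \<xi>)"
    unfolding mfrft_integral_def mfrft_kernel_eq
    by (rule integral_lebesgue_eq_AE) (use ae in auto)
  also have "\<dots> = (LINT x|lborel. (norm_const \<alpha> * chirp \<alpha> (l\<^sup>2) \<xi>) *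
      (chirp \<alpha> (l\<^sup>2) x * s' x * cis (- (x \<bullet> vmult (freq_scale \<alpha> l) \<xi>))))"
    unfolding mfrft_kernel_eq by (simp only: ac_simps)
  also have "\<dots> = (norm_const \<alpha> * chirp \<alpha> (l\<^sup>2) \<xi>) * ft (\<lambda>x. chirp \<alpha> (l\<^sup>2) x * s' x) (vmult (freq_scale \<alpha> l) \<xi>)"
    unfolding ft_def by (rule integral_mult_right_zero)
  finally show ?thesis by (simp only: mult.assoc)
qed

text \<open>
  The multiplication by chirps and the dilation by \<open>\<kappa>\<close> are bounded on square-integrable functions, so the
  convergence of Fourier integrals carries over to the fractional integrals.
\<close>

lemma is_mfrft_if_fourier_pair:
  fixes \<psi> \<psi>' g :: "real ^ 'n \<Rightarrow> complex"
  assumes \<psi>': "\<psi>' \<in> L2 lborel" and ae: "AE x in lborel. \<psi> x = \<psi>' x"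
    and pair: "fourier_pair (\<lambda>x. chirp \<alpha> (l\<^sup>2) x * \<psi>' x) g"
    and k: "vol (freq_scale \<alpha> l) \<noteq> 0"
  shows "is_mfrft \<alpha> l \<psi> (\<lambda>\<xi>. norm_const \<alpha> * (chirp \<alpha> (l\<^sup>2) \<xi> * g (vmult (freq_scale \<alpha> l) \<xi>)))"
    (is "is_mfrft _ _ _ ?G")
proof -
  let ?e = "chirp \<alpha> (l\<^sup>2)" and ?k = "freq_scale \<alpha> l"
  have L2_bl: "h \<in> L2 lebesgue" "L2_norm lebesgue h = L2_norm lborel h" if "h \<in> L2 lborel" for h :: "real ^ 'n \<Rightarrow> complex"
    using L2_lebesgue_AE[of h h] that L2_measurable[OF that] by auto
  have mod: "(\<lambda>x. ?e x * h x) \<in> L2 lborel" if "h \<in> L2 lborel" for h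
    by (rule L2_unimodular[OF that]) auto
  have dil: "(\<lambda>\<xi>. norm_const \<alpha> * (?e \<xi> * h (vmult ?k \<xi>))) \<in> L2 lborel" if "h \<in> L2 lborel" for h
    using L2_vmult(1)[OF k that, of 0] by (intro L2_scale mod) simp
  have dil_norm: "L2_norm lborel (\<lambda>\<xi>. norm_const \<alpha> * (?e \<xi> * h (vmult ?k \<xi>))) =
      cmod (norm_const \<alpha>) * (L2_norm lborel h / sqrt (vol ?k))" if "h \<in> L2 lborel" for h
    using L2_vmult(2)[OF k that, of 0] k by (simp add: L2_norm_scale L2_norm_unimodular)
  have G: "?G \<in> L2 lborel" by (rule dil[OF fourier_pair_L2(2)[OF pair]])
  have \<psi>: "\<psi> \<in> L2 lebesgue"
    using L2_lebesgue_AE(1)[OF _ ae] \<psi>' L2_measurable[OF \<psi>'] by simp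
  have "L2_tendsto lebesgue (\<lambda>n. mfrft_integral \<alpha> l (s n)) ?G"
    if s: "\<And>n. integrable lebesgue (s n)" "\<And>n. s n \<in> L2 lebesgue" and lim: "L2_tendsto lebesgue s \<psi>" for s
  proof -
    have "\<exists>t. t \<in> L2 lborel \<and> (AE x in lborel. s n x = t x)" for n
      using L2_lebesgue_borel_version[OF s(2)] by blast
    then obtain t where t: "\<And>n. t n \<in> L2 lborel" "\<And>n. AE x in lborel. s n x = t n x"
      by metis
    have [measurable]: "t n \<in> borel_measurable borel" for n using L2_measurable[OF t(1)] by simp
    have [measurable]: "\<psi>' \<in> borel_measurable borel" using L2_measurable[OF \<psi>'] by simp
    have t1: "integrable lborel (t n)" for n
      using integrable_lebesgue_iff_AE[OF _ t(2)] s(1) by simp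
    have "L2_norm lebesgue (\<lambda>x. s n x - \<psi> x) = L2_norm lborel (\<lambda>x. t n x - \<psi>' x)" for n
    proof (rule L2_lebesgue_AE(2))
      show "AE x in lborel. s n x - \<psi> x = t n x - \<psi>' x"
        using t(2)[of n] ae by eventually_elim simp
    qed measurable
    then have "(\<lambda>n. L2_norm lborel (\<lambda>x. t n x - \<psi>' x)) \<longlonglongrightarrow> 0"
      using lim L2_tendsto_iff_norm[OF s(2) \<psi>] by simp
    then have "(\<lambda>n. L2_norm lborel (\<lambda>x. ?e x * t n x - ?e x * \<psi>' x)) \<longlonglongrightarrow> 0"
      by (simp add: right_diff_distrib[symmetric] L2_norm_unimodular)
    moreover have et: "integrable lborel (\<lambda>x. ?e x * t n x)" for n
      using integrable_mult_unimodular[OF t1, of ?e n] by (simp add: mult.commute)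
    ultimately have ftlim: "(\<lambda>n. L2_norm lborel (\<lambda>\<xi>. ft (\<lambda>x. ?e x * t n x) \<xi> - g \<xi>)) \<longlonglongrightarrow> 0"
      by (intro fourier_pair_ft_tendsto[OF pair] mod t)
    have ftL2: "ft (\<lambda>x. ?e x * t n x) \<in> L2 lborel" for n
      by (rule ft_Bessel(1)[OF et mod[OF t(1)]])
    have eq: "mfrft_integral \<alpha> l (s n) =
        (\<lambda>\<xi>. norm_const \<alpha> * (?e \<xi> * ft (\<lambda>x. ?e x * t n x) (vmult ?k \<xi>)))" for n
      by (intro ext mfrft_integral_eq_ft t(2)) measurable
    have mem: "mfrft_integral \<alpha> l (s n) \<in> L2 lborel" for n
      unfolding eq by (rule dil[OF ftL2])
    have "L2_norm lebesgue (\<lambda>\<xi>. mfrft_integral \<alpha> l (s n) \<xi> - ?G \<xi>) =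
        cmod (norm_const \<alpha>) * (L2_norm lborel (\<lambda>\<xi>. ft (\<lambda>x. ?e x * t n x) \<xi> - g \<xi>) / sqrt (vol ?k))" for n
      using dil_norm[OF L2_diff[OF ftL2 fourier_pair_L2(2)[OF pair]], of n] L2_bl(2)[OF L2_diff[OF mem G], of n]
      by (simp add: eq right_diff_distrib)
    then have "(\<lambda>n. L2_norm lebesgue (\<lambda>\<xi>. mfrft_integral \<alpha> l (s n) \<xi> - ?G \<xi>)) \<longlonglongrightarrow> 0"
      using tendsto_mult[OF tendsto_const tendsto_divide[OF ftlim tendsto_const, of "sqrt (vol ?k)"], of "cmod (norm_const \<alpha>)"] k
      by simp
    then show ?thesis
      using L2_tendsto_iff_norm[OF L2_bl(1)[OF mem] L2_bl(1)[OF G]] by simp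
  qed
  then show ?thesis
    unfolding is_mfrft_def using L2_bl(1)[OF G] by blast
qed

text \<open>
  The value of \<open>mfrft\<close> is some function with the defining limit property. By the previous lemma one such
  function is known, and the limit along an approximating sequence is unique up to null sets.
\<close>

lemma mfrft_AE_eq:
  fixes \<psi> \<psi>' g :: "real ^ 'n \<Rightarrow> complex"
  assumes \<psi>': "\<psi>' \<in> L2 lborel" and ae: "AE x in lborel. \<psi> x = \<psi>' x"
    and pair: "fourier_pair (\<lambda>x. chirp \<alpha> (l\<^sup>2) x * \<psi>' x) g"
    and k: "vol (freq_scale \<alpha> l) \<noteq> 0"
  shows "AE \<xi> in lborel. mfrft \<alpha> l \<psi> \<xi> = norm_const \<alpha> * (chirp \<alpha> (l\<^sup>2) \<xi> * g (vmult (freq_scale \<alpha> l) \<xi>))"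
    (is "AE \<xi> in _. _ = ?G \<xi>")
proof -
  have G: "is_mfrft \<alpha> l \<psi> ?G" by (rule is_mfrft_if_fourier_pair[OF assms])
  then have M: "is_mfrft \<alpha> l \<psi> (mfrft \<alpha> l \<psi>)"
    unfolding mfrft_def by (rule someI[of "is_mfrft \<alpha> l \<psi>"])
  obtain s B where s: "\<And>n :: nat. integrable lborel (s n)" "\<And>n. s n \<in> L2 lborel"
      "\<And>n. continuous_on UNIV (s n)" "\<And>n x. cmod (s n x) \<le> B n"
      and lim: "(\<lambda>n. L2_norm lborel (\<lambda>x. s n x - \<psi>' x)) \<longlonglongrightarrow> 0"
    using L2_approx_by_L1[OF \<psi>'] by blast
  have [measurable]: "s n \<in> borel_measurable borel" for n using L2_measurable[OF s(2)] by simp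
  have [measurable]: "\<psi>' \<in> borel_measurable borel" using L2_measurable[OF \<psi>'] by simp
  have s': "integrable lebesgue (s n)" "s n \<in> L2 lebesgue" for n
    using integrable_lebesgue_iff_AE[of "s n" "s n"] L2_lebesgue_AE(1)[of "s n" "s n"] s(1,2)[of n] by auto
  have \<psi>: "\<psi> \<in> L2 lebesgue"
    using L2_lebesgue_AE(1)[OF _ ae] \<psi>' by simp
  have "L2_norm lebesgue (\<lambda>x. s n x - \<psi> x) = L2_norm lborel (\<lambda>x. s n x - \<psi>' x)" for n
  proof (rule L2_lebesgue_AE(2))
    show "AE x in lborel. s n x - \<psi> x = s n x - \<psi>' x"
      using ae by eventually_elim simp
  qed measurable
  then have "L2_tendsto lebesgue s \<psi>"
    using lim L2_tendsto_iff_norm[OF s'(2) \<psi>] by simp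
  then have t: "L2_tendsto lebesgue (\<lambda>n. mfrft_integral \<alpha> l (s n)) ?G"
      "L2_tendsto lebesgue (\<lambda>n. mfrft_integral \<alpha> l (s n)) (mfrft \<alpha> l \<psi>)"
    using G M s' unfolding is_mfrft_def by blast+
  have mem: "?G \<in> L2 lebesgue" "mfrft \<alpha> l \<psi> \<in> L2 lebesgue"
    using G M unfolding is_mfrft_def by blast+
  have int: "mfrft_integral \<alpha> l (s n) \<in> L2 lebesgue" for n
  proof -
    let ?e = "chirp \<alpha> (l\<^sup>2)"
    have eq: "mfrft_integral \<alpha> l (s n) =
        (\<lambda>\<xi>. norm_const \<alpha> * (?e \<xi> * ft (\<lambda>x. ?e x * s n x) (vmult (freq_scale \<alpha> l) \<xi>)))"
      by (intro ext mfrft_integral_eq_ft) auto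
    have "integrable lborel (\<lambda>x. ?e x * s n x)"
      using integrable_mult_unimodular[OF s(1), of ?e n] by (simp add: mult.commute)
    then have "ft (\<lambda>x. ?e x * s n x) \<in> L2 lborel"
      by (rule ft_Bessel(1)) (intro L2_unimodular s, auto)
    from L2_vmult(1)[OF k this, of 0] have "mfrft_integral \<alpha> l (s n) \<in> L2 lborel"
      unfolding eq by (intro L2_scale L2_unimodular) auto
    then show ?thesis
      using L2_lebesgue_AE(1)[of "mfrft_integral \<alpha> l (s n)"] L2_measurable by fastforce
  qed
  have "AE \<xi> in lebesgue. mfrft \<alpha> l \<psi> \<xi> = ?G \<xi>"
    using t unfolding L2_tendsto_iff_norm[OF int mem(1)] L2_tendsto_iff_norm[OF int mem(2)]
    by (intro L2_limit_unique[OF int mem(2) mem(1)])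
  then show ?thesis by (simp add: AE_completion_iff)
qed

text \<open>
  The dilation by \<open>\<kappa>\<close> leaves the admissibility integral unchanged by scale invariance.
\<close>

lemma nn_integral_mfrft_over_vol:
  fixes \<psi> \<psi>' g :: "real ^ 'n \<Rightarrow> complex"
  assumes "\<psi>' \<in> L2 lborel" "AE x in lborel. \<psi> x = \<psi>' x"
    and pair: "fourier_pair (\<lambda>x. chirp \<alpha> (l\<^sup>2) x * \<psi>' x) g"
    and k: "vol (freq_scale \<alpha> l) \<noteq> 0"
  shows "(\<integral>\<^sup>+u\<in>R0. ennreal ((cmod (mfrft \<alpha> l \<psi> u))\<^sup>2 / mabs u) \<partial>lebesgue) =
    ennreal ((cmod (norm_const \<alpha>))\<^sup>2) * (\<integral>\<^sup>+u. ennreal ((cmod (g u))\<^sup>2 / vol u) \<partial>lborel)"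
proof -
  have [measurable]: "g \<in> borel_measurable borel"
    using L2_measurable[OF fourier_pair_L2(2)[OF pair]] by simp
  have "(\<integral>\<^sup>+u\<in>R0. ennreal ((cmod (mfrft \<alpha> l \<psi> u))\<^sup>2 / mabs u) \<partial>lebesgue) =
      (\<integral>\<^sup>+u. ennreal ((cmod (norm_const \<alpha>))\<^sup>2) * ennreal ((cmod (g (vmult u (freq_scale \<alpha> l))))\<^sup>2 / vol u) \<partial>lborel)"
    unfolding nn_integral_completion
  proof (rule nn_integral_cong_AE)
    show "AE u in lborel. ennreal ((cmod (mfrft \<alpha> l \<psi> u))\<^sup>2 / mabs u) * indicator R0 u =
        ennreal ((cmod (norm_const \<alpha>))\<^sup>2) * ennreal ((cmod (g (vmult u (freq_scale \<alpha> l))))\<^sup>2 / vol u)"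
      using mfrft_AE_eq[OF assms] AE_vol_nonzero
      by eventually_elim
        (simp add: in_R0_iff vol_eq_mabs[symmetric] norm_mult power_mult_distrib ennreal_mult'[symmetric]
          vmult_commute[of "freq_scale \<alpha> l"])
  qed
  also have "\<dots> = ennreal ((cmod (norm_const \<alpha>))\<^sup>2) * (\<integral>\<^sup>+u. ennreal ((cmod (g (vmult u (freq_scale \<alpha> l))))\<^sup>2 / vol u) \<partial>lborel)"
    by (rule nn_integral_cmult) measurable
  also have "(\<integral>\<^sup>+u. ennreal ((cmod (g (vmult u (freq_scale \<alpha> l))))\<^sup>2 / vol u) \<partial>lborel) =
      (\<integral>\<^sup>+u. ennreal ((cmod (g u))\<^sup>2 / vol u) \<partial>lborel)"
    by (rule nn_integral_vol_scale_invariant[OF _ k]) measurable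
  finally show ?thesis .
qed

section \<open>Integration against the invariant measure\<close>

lemma borel_measurable_vol_fst [measurable]:
  "(\<lambda>p :: 'a::euclidean_space \<times> 'b::euclidean_space. vol (fst p)) \<in> borel_measurable borel"
  unfolding borel_prod[symmetric] by measurable

lemma S0_borel [measurable]: "S0 \<in> sets borel"
proof -
  have "S0 = {p \<in> space borel. vol (fst p) \<noteq> 0}"
    by (auto simp: S0_def in_R0_iff)
  also have "\<dots> \<in> sets borel"
    by measurable
  finally show ?thesis .
qed

lemma mem_S0_iff: "p \<in> S0 \<longleftrightarrow> vol (fst p) \<noteq> 0"
  by (cases p) (simp add: S0_def in_R0_iff)

lemma space_S0_measure [simp]: "space S0_measure = S0"
  by (simp add: S0_measure_def space_restrict_space)

lemma S0_measure_eq: "S0_measure = density (lebesgue_on S0) (\<lambda>p. ennreal (1 / (vol (fst p))\<^sup>2))"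
  by (simp add: S0_measure_def case_prod_unfold vol_eq_mabs)

lemma borel_measurable_S0_measure_iff:
  "H \<in> borel_measurable S0_measure \<longleftrightarrow> H \<in> borel_measurable (lebesgue_on S0)"
  by (simp add: S0_measure_eq)

lemma S0_measure_measurable:
  assumes "H \<in> borel_measurable borel"
  shows "H \<in> borel_measurable S0_measure"
  unfolding borel_measurable_S0_measure_iff
  using assms by (intro measurable_restrict_space1 measurable_completion) simp

text \<open>
  The weight \<open>1 / (vol a)\<^sup>2\<close> vanishes where \<open>vol a = 0\<close>, so the iterated integral is one over \<open>S0\<close>.
\<close>

lemma nn_integral_S0_measure:
  fixes H :: "(real ^ 'n) \<times> (real ^ 'n) \<Rightarrow> ennreal"
  assumes [measurable]: "H \<in> borel_measurable borel"
  shows "(\<integral>\<^sup>+p. H p \<partial>S0_measure) =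
    (\<integral>\<^sup>+a. \<integral>\<^sup>+b. ennreal (1 / (vol a)\<^sup>2) * H (a, b) \<partial>lborel \<partial>lborel)"
proof -
  have S0_leb: "S0 \<in> sets lebesgue" by simp
  have [measurable]: "H \<in> borel_measurable (lborel \<Otimes>\<^sub>M lborel)"
    unfolding lborel_prod by simp
  have meas: "K \<in> borel_measurable (lebesgue_on S0)" if "K \<in> borel_measurable borel"
    for K :: "(real ^ 'n) \<times> (real ^ 'n) \<Rightarrow> ennreal"
    using that by (intro measurable_restrict_space1 measurable_completion) simp
  have "(\<integral>\<^sup>+p. H p \<partial>S0_measure) = (\<integral>\<^sup>+p. ennreal (1 / (vol (fst p))\<^sup>2) * H p \<partial>lebesgue_on S0)"
    unfolding S0_measure_eq
    by (intro nn_integral_density meas assms measurable_compose[OF _ measurable_ennreal]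
        borel_measurable_divide borel_measurable_power borel_measurable_const borel_measurable_vol_fst)
  also have "\<dots> = (\<integral>\<^sup>+p. ennreal (1 / (vol (fst p))\<^sup>2) * H p * indicator S0 p \<partial>lebesgue)"
    using S0_leb by (subst nn_integral_restrict_space) auto
  also have "\<dots> = (\<integral>\<^sup>+p. ennreal (1 / (vol (fst p))\<^sup>2) * H p \<partial>lborel)"
    unfolding nn_integral_completion by (intro nn_integral_cong) (auto simp: mem_S0_iff split: split_indicator)
  also have "\<dots> = (\<integral>\<^sup>+p. ennreal (1 / (vol (fst p))\<^sup>2) * H p \<partial>(lborel \<Otimes>\<^sub>M lborel))"
    by (simp add: lborel_prod)
  also have "\<dots> = (\<integral>\<^sup>+a. \<integral>\<^sup>+b. ennreal (1 / (vol (fst (a, b)))\<^sup>2) * H (a, b) \<partial>lborel \<partial>lborel)"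
    by (rule lborel.nn_integral_fst[symmetric]) measurable
  finally show ?thesis by simp
qed

text \<open>
  Fubini for a function that is merely Lebesgue measurable on the product: it is replaced by a Borel
  function, which leaves almost every inner integral unchanged.
\<close>

lemma integral_S0_measure_iterated:
  fixes H :: "(real ^ 'n) \<times> (real ^ 'n) \<Rightarrow> complex"
  assumes H: "integrable S0_measure H"
  shows "(LINT p|S0_measure. H p) =
    (LINT a:R0|lebesgue. (LINT b|lebesgue. H (a, b) / complex_of_real ((mabs a)\<^sup>2)))"
proof -
  let ?w = "\<lambda>p :: (real ^ 'n) \<times> (real ^ 'n). 1 / (vol (fst p))\<^sup>2"
  define H0 where "H0 p = indicat_real S0 p *\<^sub>R (?w p *\<^sub>R H p)" for p
  have S0_leb: "S0 \<inter> space lebesgue \<in> sets lebesgue" by simp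
  have Hm: "H \<in> borel_measurable (lebesgue_on S0)"
    using borel_measurable_integrable[OF H] by (simp add: borel_measurable_S0_measure_iff)
  have "?w \<in> borel_measurable borel"
    by (intro borel_measurable_divide borel_measurable_power borel_measurable_const borel_measurable_vol_fst)
  then have wm: "?w \<in> borel_measurable (lebesgue_on S0)"
    by (intro measurable_restrict_space1 measurable_completion) simp
  have "integrable (lebesgue_on S0) (\<lambda>p. ?w p *\<^sub>R H p)"
    using H Hm wm unfolding S0_measure_eq by (subst (asm) integrable_density) auto
  then have H0_int: "integrable lebesgue H0"
    unfolding H0_def by (subst (asm) integrable_restrict_space[OF S0_leb])
  have H0_eq: "(LINT p|S0_measure. H p) = (LINT p|lebesgue. H0 p)"
    using Hm wm S0_leb unfolding S0_measure_eq H0_def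
    by (subst integral_density) (auto simp: integral_restrict_space)
  obtain H1 where H1: "H1 \<in> borel_measurable borel" "AE p in lborel. H0 p = H1 p"
    using completion_ex_borel_measurable_complex[OF borel_measurable_integrable[OF H0_int]] by auto
  have H1_int: "integrable (lborel \<Otimes>\<^sub>M lborel) H1"
    using integrable_lebesgue_iff_AE[OF H1] H0_int by (simp add: lborel_prod)
  have H1m[measurable]: "H1 \<in> borel_measurable (lborel \<Otimes>\<^sub>M lborel)"
    using H1(1) by (simp add: lborel_prod)
  have "AE p in lborel \<Otimes>\<^sub>M lborel. H0 p = H1 p"
    using H1(2) unfolding lborel_prod .
  then have AE2: "AE a in lborel. AE b in lborel. H0 (a, b) = H1 (a, b)"
    by (rule lborel_pair.AE_pair)
  have inner: "indicat_real R0 a *\<^sub>R (LINT b|lebesgue. H (a, b) / complex_of_real ((mabs a)\<^sup>2)) = (LINT b|lebesgue. H0 (a, b))" for a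
    by (auto simp: H0_def S0_def vol_eq_mabs scaleR_conv_of_real split: split_indicator)
  have "(LINT a:R0|lebesgue. (LINT b|lebesgue. H (a, b) / complex_of_real ((mabs a)\<^sup>2))) =
      (LINT a|lebesgue. LINT b|lebesgue. H0 (a, b))"
    unfolding set_lebesgue_integral_def inner ..
  also have "\<dots> = (LINT a|lborel. LINT b|lborel. H1 (a, b))"
  proof (rule integral_lebesgue_eq_AE)
    show "AE a in lborel. (LINT b|lebesgue. H0 (a, b)) = (LINT b|lborel. H1 (a, b))"
      using AE2
    proof eventually_elim
      case (elim a)
      have "(\<lambda>b. H1 (a, b)) \<in> borel_measurable borel" by measurable
      then show ?case using elim by (rule integral_lebesgue_eq_AE)
    qed
  qed measurable
  also have "\<dots> = (LINT p|(lborel \<Otimes>\<^sub>M lborel). H1 p)"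
    by (rule lborel_pair.integral_fst'[OF H1_int])
  also have "\<dots> = (LINT p|lebesgue. H0 p)"
    unfolding lborel_prod by (rule integral_lebesgue_eq_AE[OF H1, symmetric])
  finally show ?thesis using H0_eq by simp
qed

section \<open>The fractional wavelet transform as an isometry up to a constant\<close>

lemma mfrwt_eq_L2_inner: "mfrwt \<alpha> l \<psi> f p = L2_inner lebesgue f (Psi \<alpha> l \<psi> p)"
  by (simp add: mfrwt_def L2_inner_def)

text \<open>
  The data produced by a wavelet: a Borel representative \<open>\<psi>'\<close> of \<open>\<psi>\<close>, and the Fourier transform \<open>g\<close> of
  \<open>\<psi>'\<close> times the chirp. Admissibility is expressed by \<open>g\<close>.
\<close>

locale admissible_wavelet =
  fixes \<alpha> :: "real ^ 'n" and l :: real and \<psi> \<psi>' g :: "real ^ 'n \<Rightarrow> complex"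
  assumes scale_nonzero: "vol (freq_scale \<alpha> l) \<noteq> 0"
    and \<psi>'_L2: "\<psi>' \<in> L2 lborel"
    and \<psi>_AE: "AE x in lborel. \<psi> x = \<psi>' x"
    and pair: "fourier_pair (\<lambda>x. chirp \<alpha> (l\<^sup>2) x * \<psi>' x) g"
    and adm: "(\<integral>\<^sup>+u. ennreal ((cmod (g u))\<^sup>2 / vol u) \<partial>lborel) < \<infinity>"
begin

abbreviation e :: "real ^ 'n \<Rightarrow> complex" where "e \<equiv> chirp \<alpha> (l\<^sup>2)"

lemma \<psi>'_measurable [measurable]: "\<psi>' \<in> borel_measurable borel"
  using L2_measurable[OF \<psi>'_L2] by simp

definition Psi_borel :: "(real ^ 'n) \<times> (real ^ 'n) \<Rightarrow> real ^ 'n \<Rightarrow> complex" where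
  "Psi_borel p t = (cnj (c_prod \<alpha>) * e (snd p) * complex_of_real (1 / sqrt (vol (fst p)))) *
     (chirp \<alpha> (- (l\<^sup>2)) t * (e (vdiv (t - snd p) (fst p)) * \<psi>' (vdiv (t - snd p) (fst p))))"

text \<open>
  An affine substitution preserves null sets, so the change of representative is harmless for each fixed
  pair of parameters in \<open>S0\<close>.
\<close>

lemma Psi_AE:
  assumes "p \<in> S0"
  shows "AE t in lborel. Psi \<alpha> l \<psi> p t = Psi_borel p t"
proof -
  obtain a b where p: "p = (a, b)" by (cases p)
  have a: "vol a \<noteq> 0" using assms by (simp add: p mem_S0_iff)
  have "AE t in lborel. \<psi> (vdiv (- b) a + vmult (vdiv One a) t) = \<psi>' (vdiv (- b) a + vmult (vdiv One a) t)"
    using a by (intro AE_vmult \<psi>_AE) (simp add: vol_vdiv_One)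
  then have "AE t in lborel. \<psi> (vdiv (t - b) a) = \<psi>' (vdiv (t - b) a)"
    by (simp add: vdiv_shift_eq)
  then show ?thesis
  proof eventually_elim
    case (elim t)
    have "(\<chi> k. (t $ k - b $ k) / a $ k) = vdiv (t - b) a"
      by (simp add: vec_eq_iff vdiv_nth)
    then show ?case
      using elim by (simp add: p Psi_def Psi_borel_def psi_tilde_def vol_eq_mabs ac_simps)
  qed
qed

lemma Psi_borel_L2:
  assumes "p \<in> S0"
  shows "Psi_borel p \<in> L2 lborel"
proof -
  have a: "vol (vdiv One (fst p)) \<noteq> 0" using assms by (simp add: vol_vdiv_One mem_S0_iff)
  have "(\<lambda>t. e (vdiv (t - snd p) (fst p)) * \<psi>' (vdiv (t - snd p) (fst p))) \<in> L2 lborel"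
    using L2_vmult(1)[OF a fourier_pair_L2(1)[OF pair], of "vdiv (- snd p) (fst p)"]
    by (simp add: vdiv_shift_eq)
  then show ?thesis
    unfolding Psi_borel_def by (intro L2_scale) (rule L2_unimodular, auto)
qed

lemma Psi_L2:
  assumes "p \<in> S0"
  shows "Psi \<alpha> l \<psi> p \<in> L2 lebesgue"
  using L2_lebesgue_AE(1)[OF _ Psi_AE[OF assms]] Psi_borel_L2[OF assms] L2_measurable by fastforce

text \<open>
  A Borel function on all pairs, off \<open>S0\<close> included, that gives the transform on \<open>S0\<close> when \<open>f\<close> is Borel.
  Its measurability and the classical isometry are therefore available directly.
\<close>

definition mfrwt_borel :: "(real ^ 'n \<Rightarrow> complex) \<Rightarrow> (real ^ 'n) \<times> (real ^ 'n) \<Rightarrow> complex" where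
  "mfrwt_borel f p = c_prod \<alpha> * chirp \<alpha> (- (l\<^sup>2)) (snd p) * complex_of_real (1 / sqrt (vol (fst p))) *
     cwt (\<lambda>t. e t * f t) (\<lambda>t. e t * \<psi>' t) (fst p) (snd p)"

lemma mfrwt_eq_borel:
  assumes f': "f' \<in> borel_measurable borel" and ae: "AE t in lborel. f t = f' t" and p: "p \<in> S0"
  shows "mfrwt \<alpha> l \<psi> f p = mfrwt_borel f' p"
proof -
  note [measurable] = f'
  have [measurable]: "Psi_borel p \<in> borel_measurable borel"
    using L2_measurable[OF Psi_borel_L2[OF p]] by simp
  have "mfrwt \<alpha> l \<psi> f p = (LINT t|lborel. f' t * cnj (Psi_borel p t))"
    unfolding mfrwt_def
  proof (rule integral_lebesgue_eq_AE)
    show "AE t in lborel. f t * cnj (Psi \<alpha> l \<psi> p t) = f' t * cnj (Psi_borel p t)"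
      using ae Psi_AE[OF p] by eventually_elim simp
  qed measurable
  also have "\<dots> = (LINT t|lborel. (c_prod \<alpha> * chirp \<alpha> (- (l\<^sup>2)) (snd p) * complex_of_real (1 / sqrt (vol (fst p)))) *
      (e t * f' t * cnj (e (vdiv (t - snd p) (fst p)) * \<psi>' (vdiv (t - snd p) (fst p)))))"
    unfolding Psi_borel_def by (simp add: cnj_chirp ac_simps)
  also have "\<dots> = (c_prod \<alpha> * chirp \<alpha> (- (l\<^sup>2)) (snd p) * complex_of_real (1 / sqrt (vol (fst p)))) *
      cwt (\<lambda>t. e t * f' t) (\<lambda>t. e t * \<psi>' t) (fst p) (snd p)"
    unfolding cwt_def by (rule integral_mult_right_zero)
  finally show ?thesis unfolding mfrwt_borel_def .
qed

lemma mfrwt_borel_measurable [measurable]: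
  assumes [measurable]: "f \<in> borel_measurable borel"
  shows "mfrwt_borel f \<in> borel_measurable borel"
proof -
  have "(\<lambda>z. cwt (\<lambda>t. e t * f t) (\<lambda>t. e t * \<psi>' t) (fst z) (snd z)) \<in> borel_measurable (borel \<Otimes>\<^sub>M borel)"
    using cwt_measurable[of "\<lambda>t. e t * f t" "\<lambda>t. e t * \<psi>' t"] by (simp add: lborel_prod borel_prod)
  then show ?thesis
    unfolding mfrwt_borel_def[abs_def] borel_prod[symmetric] by measurable
qed

lemma norm_const_square: "(cmod (norm_const \<alpha>))\<^sup>2 = (cmod (c_prod \<alpha>))\<^sup>2 / (2 * pi) ^ CARD('n)"
proof -
  have "(sqrt (2 * pi) ^ CARD('n))\<^sup>2 = (2 * pi) ^ CARD('n)"
    by (simp add: power_mult[symmetric] mult.commute[of _ 2]) (simp add: power_mult)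
  then show ?thesis
    by (simp add: norm_const_def norm_divide power_divide norm_power)
qed

text \<open>
  The factor \<open>(2 \<pi>)\<^sup>n\<close> in \<open>C_adm\<close> cancels the normalisation of the fractional kernel, so that the
  constant is the one of the isometry for the unnormalised Fourier transform \<open>g\<close>.
\<close>

lemma ennreal_C_adm:
  "ennreal (C_adm \<alpha> l \<psi>) =
    ennreal ((cmod (c_prod \<alpha>))\<^sup>2) * (\<integral>\<^sup>+u. ennreal ((cmod (g u))\<^sup>2 / vol u) \<partial>lborel)"
  and C_adm_nonneg: "0 \<le> C_adm \<alpha> l \<psi>"
proof -
  let ?D = "(2 * pi) ^ CARD('n)" and ?N = "(\<integral>\<^sup>+u. ennreal ((cmod (g u))\<^sup>2 / vol u) \<partial>lborel)"
  define h where "h \<xi> = norm_const \<alpha> * (e \<xi> * g (vmult (freq_scale \<alpha> l) \<xi>))" for \<xi>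
  have [measurable]: "g \<in> borel_measurable borel"
    using L2_measurable[OF fourier_pair_L2(2)[OF pair]] by simp
  have "AE \<xi> in lborel. mfrft \<alpha> l \<psi> \<xi> = h \<xi>"
    unfolding h_def by (rule mfrft_AE_eq[OF \<psi>'_L2 \<psi>_AE pair scale_nonzero])
  then have M: "mfrft \<alpha> l \<psi> \<in> borel_measurable lebesgue"
    by (rule lebesgue_measurable_if_AE_borel[rotated]) (simp add: h_def[abs_def])
  from M have Mn: "(\<lambda>u. cmod (mfrft \<alpha> l \<psi> u)) \<in> borel_measurable lebesgue"
    by measurable
  have R0: "(R0 :: (real ^ 'n) set) \<in> sets lebesgue"
  proof -
    have "(R0 :: (real ^ 'n) set) = {x \<in> space borel. vol (x :: real ^ 'n) \<noteq> 0}" by (auto simp: in_R0_iff)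
    also have "\<dots> \<in> sets borel" by measurable
    finally show ?thesis by simp
  qed
  have mabs: "mabs \<in> borel_measurable (lebesgue :: (real ^ 'n) measure)"
    using vol_measurable[of "\<lambda>x::real ^ 'n. x" borel]
    by (intro measurable_completion) (simp add: vol_eq_mabs)
  have "(LINT u:R0|lebesgue. (cmod (mfrft \<alpha> l \<psi> u))\<^sup>2 / mabs u) =
      enn2real (\<integral>\<^sup>+u. ennreal (indicator R0 u *\<^sub>R ((cmod (mfrft \<alpha> l \<psi> u))\<^sup>2 / mabs u)) \<partial>lebesgue)"
    unfolding set_lebesgue_integral_def
    by (intro integral_eq_nn_integral borel_measurable_scaleR borel_measurable_indicator
        borel_measurable_divide borel_measurable_power Mn R0 mabs)
       (auto simp: vol_eq_mabs[symmetric])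
  also have "(\<integral>\<^sup>+u. ennreal (indicator R0 u *\<^sub>R ((cmod (mfrft \<alpha> l \<psi> u))\<^sup>2 / mabs u)) \<partial>lebesgue) =
      (\<integral>\<^sup>+u\<in>R0. ennreal ((cmod (mfrft \<alpha> l \<psi> u))\<^sup>2 / mabs u) \<partial>lebesgue)"
    by (intro nn_integral_cong) (auto split: split_indicator)
  also have "\<dots> = ennreal ((cmod (norm_const \<alpha>))\<^sup>2) * ?N"
    by (rule nn_integral_mfrft_over_vol[OF \<psi>'_L2 \<psi>_AE pair scale_nonzero])
  finally have C: "C_adm \<alpha> l \<psi> = ?D * enn2real (ennreal ((cmod (norm_const \<alpha>))\<^sup>2) * ?N)"
    by (simp add: C_adm_def)
  show "0 \<le> C_adm \<alpha> l \<psi>" unfolding C by simp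
  have "C_adm \<alpha> l \<psi> = (?D * (cmod (norm_const \<alpha>))\<^sup>2) * enn2real ?N"
    unfolding C by (simp add: enn2real_mult)
  also have "?D * (cmod (norm_const \<alpha>))\<^sup>2 = (cmod (c_prod \<alpha>))\<^sup>2"
    by (simp add: norm_const_square)
  finally have "ennreal (C_adm \<alpha> l \<psi>) = ennreal ((cmod (c_prod \<alpha>))\<^sup>2) * ennreal (enn2real ?N)"
    by (simp add: ennreal_mult)
  then show "ennreal (C_adm \<alpha> l \<psi>) = ennreal ((cmod (c_prod \<alpha>))\<^sup>2) * ?N"
    using adm by (simp add: ennreal_enn2real_if)
qed

lemma nn_integral_mfrwt_borel:
  assumes f: "f \<in> L2 lborel"
  shows "(\<integral>\<^sup>+p. ennreal ((cmod (mfrwt_borel f p))\<^sup>2) \<partial>S0_measure) =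
    ennreal (C_adm \<alpha> l \<psi> * (L2_norm lborel f)\<^sup>2)"
proof -
  have [measurable]: "f \<in> borel_measurable borel" using L2_measurable[OF f] by simp
  let ?U = "cwt (\<lambda>t. e t * f t) (\<lambda>t. e t * \<psi>' t)"
  have ef: "(\<lambda>t. e t * f t) \<in> L2 lborel" by (rule L2_unimodular[OF f]) auto
  obtain F where F: "fourier_pair (\<lambda>t. e t * f t) F"
    using fourier_pair_exists[OF ef] by blast
  have Um[measurable]: "(\<lambda>z. ?U (fst z) (snd z)) \<in> borel_measurable (lborel \<Otimes>\<^sub>M lborel)"
    by (rule cwt_measurable) measurable
  have "(\<integral>\<^sup>+p. ennreal ((cmod (mfrwt_borel f p))\<^sup>2) \<partial>S0_measure) =
      (\<integral>\<^sup>+a. \<integral>\<^sup>+b. ennreal (1 / (vol a)\<^sup>2) * ennreal ((cmod (mfrwt_borel f (a, b)))\<^sup>2) \<partial>lborel \<partial>lborel)"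
    by (rule nn_integral_S0_measure) measurable
  also have "\<dots> = (\<integral>\<^sup>+a. \<integral>\<^sup>+b. ennreal ((cmod (c_prod \<alpha>))\<^sup>2) * ennreal ((cmod (?U a b))\<^sup>2 / vol a ^ 3) \<partial>lborel \<partial>lborel)"
  proof (intro nn_integral_cong)
    fix a b :: "real ^ 'n"
    have "1 / (vol a)\<^sup>2 * (cmod (mfrwt_borel f (a, b)))\<^sup>2 = (cmod (c_prod \<alpha>))\<^sup>2 * ((cmod (?U a b))\<^sup>2 / vol a ^ 3)"
      by (simp add: mfrwt_borel_def norm_mult norm_divide power_mult_distrib power_divide power3_eq_cube power2_eq_square[of "vol a"])
    then show "ennreal (1 / (vol a)\<^sup>2) * ennreal ((cmod (mfrwt_borel f (a, b)))\<^sup>2) =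
        ennreal ((cmod (c_prod \<alpha>))\<^sup>2) * ennreal ((cmod (?U a b))\<^sup>2 / vol a ^ 3)"
      by (simp only: ennreal_mult'[symmetric] zero_le_power2 zero_le_divide_1_iff)
  qed
  also have "\<dots> = (\<integral>\<^sup>+a. ennreal ((cmod (c_prod \<alpha>))\<^sup>2) * (\<integral>\<^sup>+b. ennreal ((cmod (?U a b))\<^sup>2 / vol a ^ 3) \<partial>lborel) \<partial>lborel)"
  proof (intro nn_integral_cong nn_integral_cmult)
    fix a
    have "(\<lambda>b. (\<lambda>z. ?U (fst z) (snd z)) (a, b)) \<in> borel_measurable lborel" by measurable
    then show "(\<lambda>b. ennreal ((cmod (?U a b))\<^sup>2 / vol a ^ 3)) \<in> borel_measurable lborel" by simp
  qed
  also have "\<dots> = ennreal ((cmod (c_prod \<alpha>))\<^sup>2) * (\<integral>\<^sup>+a. \<integral>\<^sup>+b. ennreal ((cmod (?U a b))\<^sup>2 / vol a ^ 3) \<partial>lborel \<partial>lborel)"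
  proof (rule nn_integral_cmult)
    have "(\<lambda>a. \<integral>\<^sup>+b. (\<lambda>z. ennreal ((cmod (?U (fst z) (snd z)))\<^sup>2 / vol (fst z) ^ 3)) (a, b) \<partial>lborel) \<in> borel_measurable lborel"
      by (rule lborel.borel_measurable_nn_integral_fst) measurable
    then show "(\<lambda>a. \<integral>\<^sup>+b. ennreal ((cmod (?U a b))\<^sup>2 / vol a ^ 3) \<partial>lborel) \<in> borel_measurable lborel" by simp
  qed
  also have "\<dots> = ennreal (C_adm \<alpha> l \<psi>) * ennreal ((L2_norm lborel f)\<^sup>2)"
    unfolding cwt_isometry[OF F pair adm] ennreal_C_adm by (simp add: L2_norm_unimodular mult.assoc)
  finally show ?thesis by (simp add: ennreal_mult C_adm_nonneg)
qed

lemma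
  assumes f: "f \<in> L2 lebesgue"
  shows mfrwt_L2: "mfrwt \<alpha> l \<psi> f \<in> L2 S0_measure"
    and mfrwt_norm: "L2_norm S0_measure (mfrwt \<alpha> l \<psi> f) = sqrt (C_adm \<alpha> l \<psi>) * L2_norm lebesgue f"
proof -
  obtain f' where f': "f' \<in> L2 lborel" and ae: "AE x in lborel. f x = f' x"
    using L2_lebesgue_borel_version[OF f] by blast
  have [measurable]: "f' \<in> borel_measurable borel" using L2_measurable[OF f'] by simp
  have eq: "mfrwt \<alpha> l \<psi> f p = mfrwt_borel f' p" if "p \<in> space S0_measure" for p
    using that by (intro mfrwt_eq_borel ae) auto
  have mem: "mfrwt_borel f' \<in> L2 S0_measure"
    unfolding L2_def using nn_integral_mfrwt_borel[OF f']
    by (auto simp: integrable_iff_bounded intro!: S0_measure_measurable)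
  then show "mfrwt \<alpha> l \<psi> f \<in> L2 S0_measure"
    using L2_cong_space[where M=S0_measure and f="mfrwt \<alpha> l \<psi> f" and g="mfrwt_borel f'", OF eq] by blast
  have "ennreal ((L2_norm S0_measure (mfrwt_borel f'))\<^sup>2) = ennreal (C_adm \<alpha> l \<psi> * (L2_norm lborel f')\<^sup>2)"
    using ennreal_L2_norm_square[OF mem] nn_integral_mfrwt_borel[OF f'] by simp
  then have "(L2_norm S0_measure (mfrwt_borel f'))\<^sup>2 = (sqrt (C_adm \<alpha> l \<psi>) * L2_norm lborel f')\<^sup>2"
    using C_adm_nonneg by (simp add: power_mult_distrib)
  then have "L2_norm S0_measure (mfrwt_borel f') = sqrt (C_adm \<alpha> l \<psi>) * L2_norm lborel f'"
    by (rule power2_eq_imp_eq) (auto simp: C_adm_nonneg)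
  then show "L2_norm S0_measure (mfrwt \<alpha> l \<psi> f) = sqrt (C_adm \<alpha> l \<psi>) * L2_norm lebesgue f"
    using L2_norm_cong_space[where M=S0_measure and f="mfrwt \<alpha> l \<psi> f" and g="mfrwt_borel f'", OF eq] L2_lebesgue_AE(2)[OF _ ae] by simp
qed

lemma mfrwt_add:
  assumes "f \<in> L2 lebesgue" "h \<in> L2 lebesgue" "p \<in> S0"
  shows "mfrwt \<alpha> l \<psi> (\<lambda>x. f x + h x) p = mfrwt \<alpha> l \<psi> f p + mfrwt \<alpha> l \<psi> h p"
  unfolding mfrwt_eq_L2_inner by (intro L2_inner_add_left assms Psi_L2)

lemma mfrwt_scale: "mfrwt \<alpha> l \<psi> (\<lambda>x. c * f x) p = c * mfrwt \<alpha> l \<psi> f p"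
  unfolding mfrwt_eq_L2_inner by (rule L2_inner_scale_left)

lemma mfrwt_diff:
  assumes "f \<in> L2 lebesgue" "h \<in> L2 lebesgue" "p \<in> S0"
  shows "mfrwt \<alpha> l \<psi> (\<lambda>x. f x - h x) p = mfrwt \<alpha> l \<psi> f p - mfrwt \<alpha> l \<psi> h p"
  unfolding mfrwt_eq_L2_inner by (intro L2_inner_diff_left assms Psi_L2)

text \<open>
  Both sides are expressed through norms by polarization, and \<open>mfrwt_norm\<close> compares the norms.
\<close>

theorem mfrwt_inner:
  assumes f: "f \<in> L2 lebesgue" and h: "h \<in> L2 lebesgue"
  shows "L2_inner S0_measure (mfrwt \<alpha> l \<psi> f) (mfrwt \<alpha> l \<psi> h) = complex_of_real (C_adm \<alpha> l \<psi>) * L2_inner lebesgue f h"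
proof -
  have sq: "(L2_norm S0_measure (mfrwt \<alpha> l \<psi> u))\<^sup>2 = C_adm \<alpha> l \<psi> * (L2_norm lebesgue u)\<^sup>2" if "u \<in> L2 lebesgue" for u
    using mfrwt_norm[OF that] C_adm_nonneg by (simp add: power_mult_distrib)
  have sum: "(L2_norm S0_measure (\<lambda>p. mfrwt \<alpha> l \<psi> f p + c * mfrwt \<alpha> l \<psi> h p))\<^sup>2 =
      C_adm \<alpha> l \<psi> * (L2_norm lebesgue (\<lambda>x. f x + c * h x))\<^sup>2" for c
  proof -
    have "L2_norm S0_measure (\<lambda>p. mfrwt \<alpha> l \<psi> f p + c * mfrwt \<alpha> l \<psi> h p) =
        L2_norm S0_measure (mfrwt \<alpha> l \<psi> (\<lambda>x. f x + c * h x))"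
      by (rule L2_norm_cong_space) (simp add: mfrwt_add[OF f L2_scale[OF h]] mfrwt_scale)
    then show ?thesis using sq[OF L2_add[OF f L2_scale[OF h]]] by simp
  qed
  show ?thesis
    unfolding L2_inner_polarization[OF mfrwt_L2[OF f] mfrwt_L2[OF h]] L2_inner_polarization[OF f h]
      sq[OF f] sq[OF h] sum[of \<i>] sum[of 1, simplified]
    by (simp add: field_simps)
qed

end

section \<open>The range as a reproducing kernel Hilbert space\<close>

context admissible_wavelet
begin

lemma mfrwt_rangeE:
  assumes "F \<in> mfrwt_range \<alpha> l \<psi>"
  obtains f where "f \<in> L2 lebesgue" "\<And>p. p \<in> S0 \<Longrightarrow> F p = mfrwt \<alpha> l \<psi> f p"
  using assms by (auto simp: mfrwt_range_def)

lemma mfrwt_rangeI: "f \<in> L2 lebesgue \<Longrightarrow> (\<And>p. p \<in> S0 \<Longrightarrow> F p = mfrwt \<alpha> l \<psi> f p) \<Longrightarrow> F \<in> mfrwt_range \<alpha> l \<psi>"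
  by (auto simp: mfrwt_range_def)

lemma mfrwt_range_L2: "mfrwt_range \<alpha> l \<psi> \<subseteq> L2 S0_measure"
proof
  fix F assume "F \<in> mfrwt_range \<alpha> l \<psi>"
  then obtain f where f: "f \<in> L2 lebesgue" "\<And>p. p \<in> S0 \<Longrightarrow> F p = mfrwt \<alpha> l \<psi> f p"
    by (rule mfrwt_rangeE) blast
  then show "F \<in> L2 S0_measure"
    using L2_cong_space[where M=S0_measure and f=F and g="mfrwt \<alpha> l \<psi> f"] mfrwt_L2[OF f(1)] by simp
qed

lemma mfrwt_range_add:
  assumes "F \<in> mfrwt_range \<alpha> l \<psi>" "G \<in> mfrwt_range \<alpha> l \<psi>"
  shows "(\<lambda>p. F p + G p) \<in> mfrwt_range \<alpha> l \<psi>"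
proof -
  obtain f h where f: "f \<in> L2 lebesgue" "\<And>p. p \<in> S0 \<Longrightarrow> F p = mfrwt \<alpha> l \<psi> f p"
    and h: "h \<in> L2 lebesgue" "\<And>p. p \<in> S0 \<Longrightarrow> G p = mfrwt \<alpha> l \<psi> h p"
    using assms by (metis mfrwt_rangeE)
  show ?thesis
    by (rule mfrwt_rangeI[OF L2_add[OF f(1) h(1)]]) (simp add: f h mfrwt_add)
qed

lemma mfrwt_range_scale:
  assumes "F \<in> mfrwt_range \<alpha> l \<psi>"
  shows "(\<lambda>p. c * F p) \<in> mfrwt_range \<alpha> l \<psi>"
proof -
  obtain f where f: "f \<in> L2 lebesgue" "\<And>p. p \<in> S0 \<Longrightarrow> F p = mfrwt \<alpha> l \<psi> f p"
    using assms by (metis mfrwt_rangeE)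
  show ?thesis
    by (rule mfrwt_rangeI[OF L2_scale[OF f(1), of c]]) (simp add: f mfrwt_scale)
qed

lemma mfrwt_range_zero: "(\<lambda>p. 0) \<in> mfrwt_range \<alpha> l \<psi>"
  using mfrwt_scale[of 0 "\<lambda>_. 0"] by (intro mfrwt_rangeI[OF L2_zero]) simp

text \<open>
  As a function of its first argument the kernel is a multiple of the transform of \<open>Psi \<alpha> l \<psi> p\<close>, hence
  an element of the range.
\<close>

lemma mfrwt_kernel_eq:
  "mfrwt_kernel \<alpha> l \<psi> q p = 1 / complex_of_real (C_adm \<alpha> l \<psi>) * mfrwt \<alpha> l \<psi> (Psi \<alpha> l \<psi> p) q"
  by (simp add: mfrwt_kernel_def mfrwt_def)

lemma mfrwt_kernel_cnj: "mfrwt_kernel \<alpha> l \<psi> q p = cnj (mfrwt_kernel \<alpha> l \<psi> p q)"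
  unfolding mfrwt_kernel_eq mfrwt_eq_L2_inner complex_cnj_mult L2_inner_cnj[of _ "Psi \<alpha> l \<psi> p" "Psi \<alpha> l \<psi> q"]
  by simp

lemma mfrwt_kernel_in_range:
  assumes "p \<in> S0"
  shows "(\<lambda>q. mfrwt_kernel \<alpha> l \<psi> q p) \<in> mfrwt_range \<alpha> l \<psi>"
  unfolding mfrwt_kernel_eq by (intro mfrwt_range_scale mfrwt_rangeI[OF Psi_L2[OF assms]]) simp

text \<open>
  On the range, distances are \<open>sqrt C\<close> times the distances of the originals, so a Cauchy sequence of
  transforms comes from a Cauchy sequence of originals.
\<close>

lemma mfrwt_range_complete:
  assumes C: "C_adm \<alpha> l \<psi> \<noteq> 0" and s: "\<And>n :: nat. s n \<in> mfrwt_range \<alpha> l \<psi>"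
    and cauchy: "\<And>\<epsilon>. \<epsilon> > 0 \<Longrightarrow> \<exists>N. \<forall>m\<ge>N. \<forall>n\<ge>N. L2_norm S0_measure (\<lambda>p. s m p - s n p) < \<epsilon>"
  shows "\<exists>F\<in>mfrwt_range \<alpha> l \<psi>. (\<lambda>n. L2_norm S0_measure (\<lambda>p. s n p - F p)) \<longlonglongrightarrow> 0"
proof -
  have Cpos: "sqrt (C_adm \<alpha> l \<psi>) > 0" using C C_adm_nonneg by simp
  have "\<forall>n. \<exists>f. f \<in> L2 lebesgue \<and> (\<forall>p\<in>S0. s n p = mfrwt \<alpha> l \<psi> f p)"
    using s by (auto simp: mfrwt_range_def)
  then obtain f where f: "\<And>n. f n \<in> L2 lebesgue" "\<And>n p. p \<in> S0 \<Longrightarrow> s n p = mfrwt \<alpha> l \<psi> (f n) p"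
    by metis
  have dist: "L2_norm S0_measure (\<lambda>p. s n p - mfrwt \<alpha> l \<psi> h p) = sqrt (C_adm \<alpha> l \<psi>) * L2_norm lebesgue (\<lambda>x. f n x - h x)"
    if h: "h \<in> L2 lebesgue" for n h
  proof -
    have "L2_norm S0_measure (\<lambda>p. s n p - mfrwt \<alpha> l \<psi> h p) = L2_norm S0_measure (mfrwt \<alpha> l \<psi> (\<lambda>x. f n x - h x))"
      by (rule L2_norm_cong_space) (simp add: f h mfrwt_diff)
    then show ?thesis using mfrwt_norm[OF L2_diff[OF f(1) h]] by simp
  qed
  have dist': "L2_norm S0_measure (\<lambda>p. s m p - s n p) = sqrt (C_adm \<alpha> l \<psi>) * L2_norm lebesgue (\<lambda>x. f m x - f n x)" for m n
  proof -
    have "L2_norm S0_measure (\<lambda>p. s m p - s n p) = L2_norm S0_measure (\<lambda>p. s m p - mfrwt \<alpha> l \<psi> (f n) p)"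
      by (rule L2_norm_cong_space) (simp add: f)
    then show ?thesis using dist[OF f(1)] by simp
  qed
  have "\<exists>h\<in>L2 lebesgue. (\<lambda>n. L2_norm lebesgue (\<lambda>x. f n x - h x)) \<longlonglongrightarrow> 0"
  proof (rule L2_complete[OF f(1)])
    fix \<epsilon> :: real assume "\<epsilon> > 0"
    then obtain N where N: "\<And>m n. m \<ge> N \<Longrightarrow> n \<ge> N \<Longrightarrow> L2_norm S0_measure (\<lambda>p. s m p - s n p) < sqrt (C_adm \<alpha> l \<psi>) * \<epsilon>"
      using cauchy[of "sqrt (C_adm \<alpha> l \<psi>) * \<epsilon>"] Cpos by (auto simp: zero_less_mult_iff)
    then have "L2_norm lebesgue (\<lambda>x. f m x - f n x) < \<epsilon>" if "m \<ge> N" "n \<ge> N" for m n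
      using N[OF that] Cpos unfolding dist' by (simp only: mult_less_cancel_left_pos)
    then show "\<exists>K. \<forall>m\<ge>K. \<forall>n\<ge>K. L2_norm lebesgue (\<lambda>x. f m x - f n x) < \<epsilon>" by blast
  qed
  then obtain h where h: "h \<in> L2 lebesgue" and lim: "(\<lambda>n. L2_norm lebesgue (\<lambda>x. f n x - h x)) \<longlonglongrightarrow> 0"
    by blast
  have "(\<lambda>n. L2_norm S0_measure (\<lambda>p. s n p - mfrwt \<alpha> l \<psi> h p)) \<longlonglongrightarrow> 0"
    unfolding dist[OF h] using tendsto_mult[OF tendsto_const lim] by simp
  then show ?thesis
    by (intro bexI[of _ "mfrwt \<alpha> l \<psi> h"] mfrwt_rangeI[OF h]) auto
qed

text \<open>
  The orthogonality relation turns the inner product with the kernel into \<open>\<langle>f, \<Psi>\<^sub>p\<rangle>\<close>, which is the value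
  of the transform of \<open>f\<close> at \<open>p\<close> by definition.
\<close>

lemma mfrwt_reproducing:
  assumes C: "C_adm \<alpha> l \<psi> \<noteq> 0" and F: "F \<in> mfrwt_range \<alpha> l \<psi>" and p: "p \<in> S0"
  shows "L2_inner S0_measure F (\<lambda>q. mfrwt_kernel \<alpha> l \<psi> q p) = F p"
proof -
  obtain f where f: "f \<in> L2 lebesgue" "\<And>p. p \<in> S0 \<Longrightarrow> F p = mfrwt \<alpha> l \<psi> f p"
    using F by (metis mfrwt_rangeE)
  let ?c = "1 / complex_of_real (C_adm \<alpha> l \<psi>)"
  have "L2_inner S0_measure F (\<lambda>q. mfrwt_kernel \<alpha> l \<psi> q p) =
      L2_inner S0_measure (mfrwt \<alpha> l \<psi> f) (\<lambda>q. ?c * mfrwt \<alpha> l \<psi> (Psi \<alpha> l \<psi> p) q)"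
    by (rule L2_inner_cong_space) (simp_all add: f mfrwt_kernel_eq)
  also have "\<dots> = cnj (?c * L2_inner S0_measure (mfrwt \<alpha> l \<psi> (Psi \<alpha> l \<psi> p)) (mfrwt \<alpha> l \<psi> f))"
    by (subst L2_inner_cnj) (simp only: L2_inner_scale_left)
  also have "\<dots> = ?c * L2_inner S0_measure (mfrwt \<alpha> l \<psi> f) (mfrwt \<alpha> l \<psi> (Psi \<alpha> l \<psi> p))"
    by (subst (2) L2_inner_cnj) simp
  also have "\<dots> = L2_inner lebesgue f (Psi \<alpha> l \<psi> p)"
    using C by (simp add: mfrwt_inner[OF f(1) Psi_L2[OF p]])
  also have "\<dots> = F p"
    using f(2)[OF p] by (simp add: mfrwt_eq_L2_inner)
  finally show ?thesis .
qed

lemma reproducing_kernel_mfrwt: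
  assumes C: "C_adm \<alpha> l \<psi> \<noteq> 0"
  shows "reproducing_kernel S0 (mfrwt_range \<alpha> l \<psi>) (L2_inner S0_measure) (mfrwt_kernel \<alpha> l \<psi>)"
proof
  note mem = subsetD[OF mfrwt_range_L2]
  show "G \<in> mfrwt_range \<alpha> l \<psi> \<and> (\<forall>h\<in>mfrwt_range \<alpha> l \<psi>. L2_inner S0_measure G h = L2_inner S0_measure F h)"
    if "F \<in> mfrwt_range \<alpha> l \<psi>" "\<And>p. p \<in> S0 \<Longrightarrow> G p = F p" for F G
  proof
    show "G \<in> mfrwt_range \<alpha> l \<psi>"
      using that by (auto simp: mfrwt_range_def)
    show "\<forall>h\<in>mfrwt_range \<alpha> l \<psi>. L2_inner S0_measure G h = L2_inner S0_measure F h"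
      using that(2) by (auto intro: L2_inner_cong_space)
  qed
  show "F p = 0" if F: "F \<in> mfrwt_range \<alpha> l \<psi>" "L2_inner S0_measure F F = 0" and p: "p \<in> S0" for F p
  proof -
    have "L2_norm S0_measure F = 0"
      using F(2) by (simp add: L2_inner_self)
    moreover have "cmod (F p) \<le> L2_norm S0_measure F * L2_norm S0_measure (\<lambda>q. mfrwt_kernel \<alpha> l \<psi> q p)"
      using cmod_L2_inner_le[OF mem[OF F(1)] mem[OF mfrwt_kernel_in_range[OF p]]]
      by (simp add: mfrwt_reproducing[OF C F(1) p])
    ultimately show "F p = 0" by simp
  qed
  show "F p = L2_inner S0_measure F (\<lambda>q. mfrwt_kernel \<alpha> l \<psi> q p)" if "F \<in> mfrwt_range \<alpha> l \<psi>" "p \<in> S0" for F p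
    using mfrwt_reproducing[OF C that] by simp
  show "0 \<le> Re (L2_inner S0_measure F F)" for F
    by (simp add: L2_inner_self del: of_real_power)
  show "L2_inner S0_measure G F = cnj (L2_inner S0_measure F G)" for F G
    by (rule L2_inner_cnj)
  show "\<exists>F\<in>mfrwt_range \<alpha> l \<psi>. (\<lambda>n. sqrt (Re (L2_inner S0_measure (\<lambda>p. s n p - F p) (\<lambda>p. s n p - F p)))) \<longlonglongrightarrow> 0"
    if "\<And>n. s n \<in> mfrwt_range \<alpha> l \<psi>"
      "\<And>\<epsilon>. \<epsilon> > 0 \<Longrightarrow> \<exists>M. \<forall>m\<ge>M. \<forall>n\<ge>M. sqrt (Re (L2_inner S0_measure (\<lambda>p. s m p - s n p) (\<lambda>p. s m p - s n p))) < \<epsilon>"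
    for s :: "nat \<Rightarrow> _"
    unfolding sqrt_Re_L2_inner_self
    by (rule mfrwt_range_complete[OF C that(1) that(2)[unfolded sqrt_Re_L2_inner_self]])
qed (auto intro: mfrwt_range_zero mfrwt_range_add mfrwt_range_scale mfrwt_kernel_in_range
      L2_inner_add_left L2_inner_scale_left subsetD[OF mfrwt_range_L2])

text \<open>
  The integrand is a product of two square-integrable functions, the second being the conjugate of an
  element of the range, so Fubini applies.
\<close>

lemma reproducing_integral_iterated:
  assumes F: "F \<in> L2 S0_measure" and a0: "a0 \<in> R0"
  shows "(LINT a:R0|lebesgue. (LINT b|lebesgue.
      F (a, b) * mfrwt_kernel \<alpha> l \<psi> (a0, b0) (a, b) / complex_of_real ((mabs a)\<^sup>2))) =
    L2_inner S0_measure F (\<lambda>q. mfrwt_kernel \<alpha> l \<psi> q (a0, b0))"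
proof -
  have p: "(a0, b0) \<in> S0" using a0 by (simp add: S0_def)
  have eq: "F q * mfrwt_kernel \<alpha> l \<psi> (a0, b0) q = F q * cnj (mfrwt_kernel \<alpha> l \<psi> q (a0, b0))" for q
    by (subst mfrwt_kernel_cnj) (rule refl)
  have "integrable S0_measure (\<lambda>q. F q * mfrwt_kernel \<alpha> l \<psi> (a0, b0) q)"
    unfolding eq using F subsetD[OF mfrwt_range_L2 mfrwt_kernel_in_range[OF p]] by (rule L2_times_integrable)
  from integral_S0_measure_iterated[OF this] show ?thesis
    unfolding L2_inner_def eq by simp
qed

text \<open>
  The projection of \<open>F\<close> to the range has the same inner products with the kernels as \<open>F\<close>, and therefore
  the same values.
\<close>

lemma mfrwt_range_if_reproduced:
  assumes C: "C_adm \<alpha> l \<psi> \<noteq> 0" and F: "F \<in> L2 S0_measure"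
    and rep: "\<And>p. p \<in> S0 \<Longrightarrow> F p = L2_inner S0_measure F (\<lambda>q. mfrwt_kernel \<alpha> l \<psi> q p)"
  shows "F \<in> mfrwt_range \<alpha> l \<psi>"
proof -
  note mem = subsetD[OF mfrwt_range_L2]
  have "\<exists>P\<in>mfrwt_range \<alpha> l \<psi>. \<forall>h\<in>mfrwt_range \<alpha> l \<psi>. L2_inner S0_measure (\<lambda>p. F p - P p) h = 0"
  proof (rule L2_projection[OF F mfrwt_range_L2])
    show "mfrwt_range \<alpha> l \<psi> \<noteq> {}" using mfrwt_range_zero by blast
  qed (auto intro: mfrwt_range_add mfrwt_range_scale mfrwt_range_complete[OF C])
  then obtain P where P: "P \<in> mfrwt_range \<alpha> l \<psi>"
    and orth: "\<And>h. h \<in> mfrwt_range \<alpha> l \<psi> \<Longrightarrow> L2_inner S0_measure (\<lambda>p. F p - P p) h = 0"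
    by blast
  have "F p = P p" if p: "p \<in> S0" for p
  proof -
    have K: "(\<lambda>q. mfrwt_kernel \<alpha> l \<psi> q p) \<in> mfrwt_range \<alpha> l \<psi>" by (rule mfrwt_kernel_in_range[OF p])
    show ?thesis
      using orth[OF K] L2_inner_diff_left[OF F mem[OF P] mem[OF K]] rep[OF p] mfrwt_reproducing[OF C P p]
      by simp
  qed
  then show ?thesis using P by (auto simp: mfrwt_range_def)
qed

end

lemma admissible_wavelet_if_wavelet:
  fixes \<alpha> :: "real ^ 'n" and l :: real and \<psi> :: "real ^ 'n \<Rightarrow> complex"
  assumes l: "l \<noteq> 0"
    and \<alpha>: "\<And>k. - pi < \<alpha> $ k \<and> \<alpha> $ k < pi \<and> \<alpha> $ k \<noteq> 0"
    and wave: "wavelet \<alpha> l \<psi>"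
  obtains \<psi>' g where "admissible_wavelet \<alpha> l \<psi> \<psi>' g"
proof -
  have "\<psi> \<in> L2 lebesgue" using wave by (simp add: wavelet_def)
  then obtain \<psi>' where \<psi>': "\<psi>' \<in> L2 lborel" "AE x in lborel. \<psi> x = \<psi>' x"
    by (rule L2_lebesgue_borel_version)
  have "(\<lambda>x. chirp \<alpha> (l\<^sup>2) x * \<psi>' x) \<in> L2 lborel"
    by (rule L2_unimodular[OF \<psi>'(1)]) auto
  then obtain g where g: "fourier_pair (\<lambda>x. chirp \<alpha> (l\<^sup>2) x * \<psi>' x) g"
    using fourier_pair_exists by blast
  have sin: "sin (\<alpha> $ k) \<noteq> 0" for k
    using \<alpha>[of k] sin_eq_0_pi[of "\<alpha> $ k"] by auto
  have scale: "vol (freq_scale \<alpha> l) \<noteq> 0"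
    using l sin by (simp add: vol_eq_mabs mabs_def freq_scale_def)
  have "1 - \<i> * complex_of_real (cot \<theta>) \<noteq> 0" for \<theta>
    by (simp add: complex_eq_iff)
  then have c: "c_prod \<alpha> \<noteq> 0"
    by (simp add: c_prod_def c_coeff_def)
  have "ennreal ((cmod (norm_const \<alpha>))\<^sup>2) * (\<integral>\<^sup>+u. ennreal ((cmod (g u))\<^sup>2 / vol u) \<partial>lborel) < \<infinity>"
    using wave nn_integral_mfrft_over_vol[OF \<psi>' g scale] by (simp add: wavelet_def)
  moreover have "norm_const \<alpha> \<noteq> 0"
    using c by (simp add: norm_const_def)
  ultimately have "(\<integral>\<^sup>+u. ennreal ((cmod (g u))\<^sup>2 / vol u) \<partial>lborel) < \<infinity>"
    by (auto simp: ennreal_mult_less_top)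
  then show ?thesis
    using that \<psi>' g scale by (simp add: admissible_wavelet_def)
qed

theorem theorem3p4:
  fixes \<alpha> :: "real ^ 'n" and l :: real and \<psi> :: "real ^ 'n \<Rightarrow> complex"
  assumes "l \<noteq> 0"
    and "\<And>k. - pi < \<alpha> $ k \<and> \<alpha> $ k < pi \<and> \<alpha> $ k \<noteq> 0"
    and "wavelet \<alpha> l \<psi>"
    and "C_adm \<alpha> l \<psi> \<noteq> 0"
  shows "mfrwt_range \<alpha> l \<psi> \<subseteq> L2 S0_measure \<and>
    reproducing_kernel S0 (mfrwt_range \<alpha> l \<psi>) (L2_inner S0_measure)
      (mfrwt_kernel \<alpha> l \<psi>) \<and>
    (\<forall>F \<in> L2 S0_measure.
       (\<exists>f \<in> L2 lebesgue. \<forall>p\<in>S0. F p = mfrwt \<alpha> l \<psi> f p) \<longleftrightarrow>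
       (\<forall>a0\<in>R0. \<forall>b0.
          F (a0, b0) =
            (LINT a:R0|lebesgue. (LINT b|lebesgue.
               F (a, b) * mfrwt_kernel \<alpha> l \<psi> (a0, b0) (a, b) / complex_of_real ((mabs a)\<^sup>2)))))"
proof -
  obtain \<psi>' g where "admissible_wavelet \<alpha> l \<psi> \<psi>' g"
    using admissible_wavelet_if_wavelet[OF assms(1-3)] by blast
  then interpret admissible_wavelet \<alpha> l \<psi> \<psi>' g .
  have "(\<exists>f \<in> L2 lebesgue. \<forall>p\<in>S0. F p = mfrwt \<alpha> l \<psi> f p) \<longleftrightarrow>
       (\<forall>a0\<in>R0. \<forall>b0.
          F (a0, b0) =
            (LINT a:R0|lebesgue. (LINT b|lebesgue.
               F (a, b) * mfrwt_kernel \<alpha> l \<psi> (a0, b0) (a, b) / complex_of_real ((mabs a)\<^sup>2))))"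
    if F: "F \<in> L2 S0_measure" for F
  proof -
    have "(\<forall>a0\<in>R0. \<forall>b0.
          F (a0, b0) =
            (LINT a:R0|lebesgue. (LINT b|lebesgue.
               F (a, b) * mfrwt_kernel \<alpha> l \<psi> (a0, b0) (a, b) / complex_of_real ((mabs a)\<^sup>2)))) \<longleftrightarrow>
        (\<forall>a0\<in>R0. \<forall>b0. F (a0, b0) = L2_inner S0_measure F (\<lambda>q. mfrwt_kernel \<alpha> l \<psi> q (a0, b0)))"
      by (intro ball_cong refl) (simp only: reproducing_integral_iterated[OF F])
    also have "\<dots> \<longleftrightarrow> (\<forall>p\<in>S0. F p = L2_inner S0_measure F (\<lambda>q. mfrwt_kernel \<alpha> l \<psi> q p))"
      by (simp add: S0_def)
    also have "\<dots> \<longleftrightarrow> F \<in> mfrwt_range \<alpha> l \<psi>"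
      using mfrwt_range_if_reproduced[OF assms(4) F] mfrwt_reproducing[OF assms(4), of F] by metis
    finally show ?thesis by (simp add: mfrwt_range_def)
  qed
  then show ?thesis
    using mfrwt_range_L2 reproducing_kernel_mfrwt[OF assms(4)] by blast
qed

end
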